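(* Let $\alpha\in\mathbb{R}$, let $m$ be a positive integer, and let $(s_j)_{j=0}^m\in\mathcal{K}^{\ge}_{q,m,\alpha}\cap\mathcal{D}_{q\times q,m}$ with first $\alpha$-S-transform $(s_j^{[1,\alpha]})_{j=0}^{m-1}$. Then: (a) $(s_j^{[1,\alpha]})_{j=0}^{m-1}\in\mathcal{K}^{\ge}_{q,m-1,\alpha}$ and $\mathcal{S}_{q,\alpha}[(s_j^{[1,\alpha]})_{j=0}^{m-1},\le]\neq\emptyset$. (b) If $F\in\mathcal{S}_{q,\alpha}[(s_j^{[1,\alpha]})_{j=0}^{m-1},\le]$, then $F^{[-,\alpha,s_0]}\in\mathcal{S}_{q,\alpha}[(s_j)_{j=0}^m,\le]$.
   Context: Notation: $q$ is a positive integer; $A^*$ is the conjugate transpose and $A^\dagger$ the Moore-Penrose inverse of a complex matrix $A$; $A\ge0$ means non-negative Hermitian; $\operatorname{ran}$, $\operatorname{nul}$ denote column space and null space; $\operatorname{Im}A=\frac1{2i}(A-A^* )$; $\|\cdot\|$ is the operator norm. Classes of sequences. For complex $q\times q$ matrices put $H_n=(s_{j+k})_{j,k=0}^n$ and $K_n=(s_{j+k+1})_{j,k=0}^n$ (block Hankel matrices). $\mathcal{K}^{\ge}_{q,0,\alpha}$ is the set of $(s_0)$ with $s_0\ge0$; for $n\ge1$, $\mathcal{K}^{\ge}_{q,2n,\alpha}$ is the set of $(s_j)_{j=0}^{2n}$ with $H_n\ge0$ and $-\alpha H_{n-1}+K_{n-1}\ge0$; for $n\ge0$, $\mathcal{K}^{\ge}_{q,2n+1,\alpha}$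 is the set of $(s_j)_{j=0}^{2n+1}$ with $H_n\ge0$ and $-\alpha H_n+K_n\ge0$. $\mathcal{D}_{q\times q,m}$ (first term dominant sequences) is the set of sequences $(s_j)_{j=0}^m$ of complex $q\times q$ matrices with $\bigcup_{j=0}^m\operatorname{ran}s_j\subseteq\operatorname{ran}s_0$ and $\operatorname{nul}s_0\subseteq\bigcap_{j=0}^m\operatorname{nul}s_j$. First $\alpha$-S-transform. Put $u_j=-\alpha s_{j-1}+s_j$ for $0\le j\le m$, with $s_{-1}=0$; let $u_0^\sharp=u_0^\dagger$, $u_j^\sharp=-u_0^\dagger\sum_{l=0}^{j-1}u_{j-l}u_l^\sharp$ for $1\le j\le m$; then $s_j^{[1,\alpha]}=-s_0u_{j+1}^\sharp s_0$ for $0\le j\le m-1$. Transform of functions. For $A\in\mathbb{C}^{q\times q}$ and $F:\mathbb{C}\setminus[\alpha,\infty)\to\mathbb{C}^{q\times q}$, $F^{[-,\alpha,A]}(z)=-(z-\alpha)^{-1}A\,[I_q+A^\dagger F(z)]^\dagger$ for $z\in\mathbb{C}\setminus[\alpha,\infty)$. Classes of functions. $\mathcal{S}_{q,\alpha}$ is the set of holomorphic $F:\mathbb{C}\setminus[\alpha,\infty)\to\mathbb{C}^{q\times q}$ with $\operatorname{Im}F(w)\ge0$ whenever $\operatorname{Im}w>0$ and $F(w)\ge0$ for $w\in(-\infty,\alpha)$. $\mathcal{S}_{0,q,\alpha}$ is the set of $F\in\mathcal{S}_{q,\alpha}$ with $\sup_{y\in[1,\infty)}y\|F(iy)\|<\infty$.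 For each $F\in\mathcal{S}_{0,q,\alpha}$ there is a unique non-negative Hermitian $q\times q$ measure $\sigma_F$ (a $\sigma$-additive map from the Borel subsets of $[\alpha,\infty)$ to the non-negative Hermitian matrices) with $F(z)=\int_{[\alpha,\infty)}(t-z)^{-1}\sigma_F(dt)$ (known fact). For a sequence $(t_j)_{j=0}^n$ of complex $q\times q$ matrices, $\mathcal{S}_{q,\alpha}[(t_j)_{j=0}^n,\le]$ is the set of $F\in\mathcal{S}_{0,q,\alpha}$ such that the moments $s_j^{(\sigma_F)}=\int_{[\alpha,\infty)}t^j\sigma_F(dt)$ exist for $j=0,\dots,n$, $s_j^{(\sigma_F)}=t_j$ for $0\le j\le n-1$, and $t_n-s_n^{(\sigma_F)}\ge0$. *)

theory Defs
  imports "HOL-Analysis.Analysis"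
begin

section \<open>Complex matrices\<close>

definition conj_transpose :: "complex^'n^'m \<Rightarrow> complex^'m^'n" where
  "conj_transpose A = (\<chi> i j. cnj (A $ j $ i))"

text \<open>The operator \<open>*s\<close> of the library scales vectors only.\<close>
definition mat_scale :: "complex \<Rightarrow> complex^'n^'m \<Rightarrow> complex^'n^'m" where
  "mat_scale c A = (\<chi> i j. c * A $ i $ j)"

definition cdot :: "complex^'n \<Rightarrow> complex^'n \<Rightarrow> complex" where
  "cdot x y = (\<Sum>i\<in>UNIV. cnj (x $ i) * y $ i)"

definition nonneg_herm :: "complex^'n^'n \<Rightarrow> bool" where
  "nonneg_herm A \<longleftrightarrow>
     conj_transpose A = A \<and> (\<forall>x. cdot x (A *v x) \<in> \<real>\<^sub>\<ge>\<^sub>0)"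

definition im_part :: "complex^'n^'n \<Rightarrow> complex^'n^'n" where
  "im_part A = mat_scale (1 / (2 * \<i>)) (A - conj_transpose A)"

definition col_space :: "complex^'n^'m \<Rightarrow> (complex^'m) set" where
  "col_space A = range (\<lambda>x. A *v x)"

definition nul_space :: "complex^'n^'m \<Rightarrow> (complex^'n) set" where
  "nul_space A = {x. A *v x = 0}"

text \<open>The Moore-Penrose inverse, as the unique solution of the four Penrose equations.\<close>
definition mp_inverse :: "complex^'n^'m \<Rightarrow> complex^'m^'n" where
  "mp_inverse A = (THE X. A ** X ** A = A \<and> X ** A ** X = X \<and>
     conj_transpose (A ** X) = A ** X \<and> conj_transpose (X ** A) = X ** A)"

definition op_norm :: "complex^'n^'m \<Rightarrow> real" where
  "op_norm A = onorm (\<lambda>x. A *v x)"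


section \<open>Classes of matrix sequences\<close>

text \<open>
  A finite sequence with terms \<open>s 0, \<dots>, s m\<close> is given by a function on \<open>nat\<close> together
  with \<open>m\<close>; terms beyond \<open>m\<close> are irrelevant. A block matrix with blocks \<open>B j k\<close>,
  \<open>0 \<le> j, k \<le> n\<close>, is likewise a function \<open>B\<close> together with \<open>n\<close>, and it acts on
  block vectors \<open>x 0, \<dots>, x n\<close>.
\<close>
definition block_nonneg_herm :: "nat \<Rightarrow> (nat \<Rightarrow> nat \<Rightarrow> complex^'q^'q) \<Rightarrow> bool" where
  "block_nonneg_herm n B \<longleftrightarrow>
     (\<forall>j\<le>n. \<forall>k\<le>n. conj_transpose (B j k) = B k j) \<and>
     (\<forall>x. (\<Sum>j\<le>n. \<Sum>k\<le>n. cdot (x j) (B j k *v x k)) \<in> \<real>\<^sub>\<ge>\<^sub>0)"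

definition hankel :: "(nat \<Rightarrow> complex^'q^'q) \<Rightarrow> nat \<Rightarrow> nat \<Rightarrow> complex^'q^'q" where
  "hankel s j k = s (j + k)"

definition hankel_shift :: "(nat \<Rightarrow> complex^'q^'q) \<Rightarrow> nat \<Rightarrow> nat \<Rightarrow> complex^'q^'q" where
  "hankel_shift s j k = s (j + k + 1)"

text \<open>The class of sequences $\mathcal{K}^{\ge}_{q,m,\alpha}$.\<close>
definition K_class :: "nat \<Rightarrow> real \<Rightarrow> (nat \<Rightarrow> complex^'q^'q) set" where
  "K_class m \<alpha> = {s.
     if m = 0 then nonneg_herm (s 0)
     else let n = m div 2 in
       block_nonneg_herm n (hankel s) \<and>
       block_nonneg_herm (if even m then n - 1 else n)
         (\<lambda>j k. - (\<alpha> *\<^sub>R hankel s j k) + hankel_shift s j k)}"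

text \<open>The first term dominant sequences $\mathcal{D}_{q\times q,m}$.\<close>
definition D_class :: "nat \<Rightarrow> (nat \<Rightarrow> complex^'q^'q) set" where
  "D_class m = {s.
     (\<Union>j\<le>m. col_space (s j)) \<subseteq> col_space (s 0) \<and>
     nul_space (s 0) \<subseteq> (\<Inter>j\<le>m. nul_space (s j))}"


section \<open>The first S-transform of a sequence and the transform of a function\<close>

definition shifted_seq :: "real \<Rightarrow> (nat \<Rightarrow> complex^'q^'q) \<Rightarrow> nat \<Rightarrow> complex^'q^'q" where
  "shifted_seq \<alpha> s j = - (\<alpha> *\<^sub>R (if j = 0 then 0 else s (j - 1))) + s j"

fun recip_seq :: "(nat \<Rightarrow> complex^'q^'q) \<Rightarrow> nat \<Rightarrow> complex^'q^'q" where
  "recip_seq u j =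
     (if j = 0 then mp_inverse (u 0)
      else - (mp_inverse (u 0) ** (\<Sum>l<j. u (j - l) ** recip_seq u l)))"

declare recip_seq.simps [simp del]

definition S_transform :: "real \<Rightarrow> (nat \<Rightarrow> complex^'q^'q) \<Rightarrow> nat \<Rightarrow> complex^'q^'q" where
  "S_transform \<alpha> s j = - (s 0 ** recip_seq (shifted_seq \<alpha> s) (j + 1) ** s 0)"

definition inv_transform ::
  "real \<Rightarrow> complex^'q^'q \<Rightarrow> (complex \<Rightarrow> complex^'q^'q) \<Rightarrow> complex \<Rightarrow> complex^'q^'q" where
  "inv_transform \<alpha> A F z =
     - mat_scale (inverse (z - of_real \<alpha>)) (A ** mp_inverse (mat 1 + mp_inverse A ** F z))"


section \<open>Non-negative Hermitian measures on a half-line\<close>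

abbreviation borel_from :: "real \<Rightarrow> real measure" where
  "borel_from \<alpha> \<equiv> restrict_space borel {\<alpha>..}"

text \<open>
  The last clause fixes a value outside the domain of the set function, so that a measure is
  determined as a function by its values on the Borel subsets of \<open>{\<alpha>..}\<close>.
\<close>
definition nonneg_herm_measure :: "real \<Rightarrow> (real set \<Rightarrow> complex^'q^'q) \<Rightarrow> bool" where
  "nonneg_herm_measure \<alpha> \<sigma> \<longleftrightarrow>
     (\<forall>B\<in>sets (borel_from \<alpha>). nonneg_herm (\<sigma> B)) \<and>
     (\<forall>A :: nat \<Rightarrow> real set. range A \<subseteq> sets (borel_from \<alpha>) \<longrightarrow> disjoint_family A \<longrightarrow>
        (\<lambda>n. \<sigma> (A n)) sums \<sigma> (\<Union>n. A n)) \<and>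
     (\<forall>B. B \<notin> sets (borel_from \<alpha>) \<longrightarrow> \<sigma> B = 0)"

text \<open>The finite scalar measure $B \mapsto x^* \sigma(B) x$.\<close>
definition quad_measure ::
  "real \<Rightarrow> (real set \<Rightarrow> complex^'q^'q) \<Rightarrow> complex^'q \<Rightarrow> real measure" where
  "quad_measure \<alpha> \<sigma> x =
     measure_of {\<alpha>..} (sets (borel_from \<alpha>)) (\<lambda>B. ennreal (Re (cdot x (\<sigma> B *v x))))"

text \<open>
  $\int f\,d\sigma = M$ means $\int f\,d(x^*\sigma x) = x^* M x$ for every vector $x$. By
  polarization this says that each entry of $M$ is the integral of $f$ with respect to the
  corresponding entry of $\sigma$, a complex measure. The measures $x^*\sigma x$ are all
  dominated by multiples of the trace measure of $\sigma$, so \<open>f\<close> is integrable in the sense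
  below iff it is integrable with respect to the trace measure.
\<close>
definition has_mm_integral ::
  "real \<Rightarrow> (real set \<Rightarrow> complex^'q^'q) \<Rightarrow> (real \<Rightarrow> complex) \<Rightarrow> complex^'q^'q \<Rightarrow> bool" where
  "has_mm_integral \<alpha> \<sigma> f M \<longleftrightarrow>
     (\<forall>x. has_bochner_integral (quad_measure \<alpha> \<sigma> x) f (cdot x (M *v x)))"

definition moment_exists :: "real \<Rightarrow> (real set \<Rightarrow> complex^'q^'q) \<Rightarrow> nat \<Rightarrow> bool" where
  "moment_exists \<alpha> \<sigma> j \<longleftrightarrow> (\<exists>M. has_mm_integral \<alpha> \<sigma> (\<lambda>t. of_real t ^ j) M)"

definition moment :: "real \<Rightarrow> (real set \<Rightarrow> complex^'q^'q) \<Rightarrow> nat \<Rightarrow> complex^'q^'q" where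
  "moment \<alpha> \<sigma> j = (THE M. has_mm_integral \<alpha> \<sigma> (\<lambda>t. of_real t ^ j) M)"


section \<open>Classes of matrix functions\<close>

text \<open>
  Functions on \<open>slit_plane \<alpha>\<close> are represented by total functions whose values on
  \<open>{\<alpha>..}\<close> are irrelevant. Holomorphy of a matrix function is meant entrywise.
\<close>
definition slit_plane :: "real \<Rightarrow> complex set" where
  "slit_plane \<alpha> = - (complex_of_real ` {\<alpha>..})"

definition S_class :: "real \<Rightarrow> (complex \<Rightarrow> complex^'q^'q) set" where
  "S_class \<alpha> = {F.
     (\<forall>i j. (\<lambda>z. F z $ i $ j) holomorphic_on slit_plane \<alpha>) \<and>
     (\<forall>w. Im w > 0 \<longrightarrow> nonneg_herm (im_part (F w))) \<and>
     (\<forall>w::real. w < \<alpha> \<longrightarrow> nonneg_herm (F (of_real w)))}"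

definition S0_class :: "real \<Rightarrow> (complex \<Rightarrow> complex^'q^'q) set" where
  "S0_class \<alpha> = {F \<in> S_class \<alpha>.
     bdd_above ((\<lambda>y. y * op_norm (F (\<i> * complex_of_real y))) ` {1..})}"

text \<open>
  The measure $\sigma_F$; every \<open>F \<in> S0_class \<alpha>\<close> has exactly one such measure.
\<close>
definition stieltjes_measure ::
  "real \<Rightarrow> (complex \<Rightarrow> complex^'q^'q) \<Rightarrow> real set \<Rightarrow> complex^'q^'q" where
  "stieltjes_measure \<alpha> F = (THE \<sigma>. nonneg_herm_measure \<alpha> \<sigma> \<and>
     (\<forall>z\<in>slit_plane \<alpha>. has_mm_integral \<alpha> \<sigma> (\<lambda>t. inverse (of_real t - z)) (F z)))"

text \<open>The class $\mathcal{S}_{q,\alpha}[(t_j)_{j=0}^n, \le]$.\<close>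
definition S_moment_class ::
  "real \<Rightarrow> nat \<Rightarrow> (nat \<Rightarrow> complex^'q^'q) \<Rightarrow> (complex \<Rightarrow> complex^'q^'q) set" where
  "S_moment_class \<alpha> n t = {F \<in> S0_class \<alpha>.
     let \<sigma> = stieltjes_measure \<alpha> F in
       (\<forall>j\<le>n. moment_exists \<alpha> \<sigma> j) \<and>
       (\<forall>j<n. moment \<alpha> \<sigma> j = t j) \<and>
       nonneg_herm (t n - moment \<alpha> \<sigma> n)}"

end

theory Submission
  imports Defs "HOL-Probability.Probability" "HOL-Complex_Analysis.Complex_Analysis"
begin

text \<open>
  Write \<open>A\<close> for the first term of the sequence, \<open>G\<close> for the transform of \<open>F\<close>, and \<open>u\<close> for the
  shifted sequence with reciprocal sequence \<open>r\<close>. The transform is the inversion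
  \<open>(z - \<alpha>) G(z) A\<^sup>\<dagger> (A + F(z)) = - A\<close>. On the level of sequences, the divided differences of the
  formal series turn this into congruences: the Hankel matrices of the transformed sequence are
  \<open>t (j + k) = \<Sum> A r (j - a) u (a + b + 1) r (k - b) A\<close> (summed over \<open>a \<le> j\<close>, \<open>b \<le> k\<close>), and the same holds for
  \<open>t (j + k + 1) - \<alpha> t (j + k)\<close> with the reciprocal sequence of \<open>s\<close> itself; hence positivity is inherited.

  On the level of functions, \<open>G\<close> is again a Stieltjes function, and inverting the asymptotic
  expansion of \<open>F\<close> along the imaginary axis gives one of \<open>G\<close> that is one order longer. On a half-line
  an expansion of the Stieltjes transform forces the moments to exist (Fatou), and the last coefficient
  of \<open>G\<close> falls short of the last term of \<open>s\<close> by exactly the same matrix as that of \<open>F\<close>. Solvability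
  follows by induction on the length, after the last term has been lowered so that it is dominated by
  the first one.
\<close>

section \<open>Complex matrices\<close>

text \<open>Three obstacles shape the proof. The measure of F is given only by a definite
  description, so its existence and uniqueness have to be proved: each form of F(z) gets a scalar
  measure via Herglotz, Nevanlinna and Stieltjes, and uniqueness is proved for finite complex
  combinations of measures, the shape that polarization needs to assemble the matrix entries. Next,
  A may be singular, while F is not assumed to respect its null space. That it does follows from the
  constraint: the mass of F is at most the first transformed term, of the form A R A, and every
  integral against the measure vanishes where the mass does. Hence I + \<open>mp_inverse A\<close>
  F(z) is invertible on the slit plane, and the generalized inverse in the transform is an ordinary
  one. Finally, positivity of the Hankel matrices yields null space inclusions for all terms but the
  last, and the transform of a dominated sequence need not be dominated: the scalar sequence 1,
  \<alpha>, \<alpha>^2 + 1 has the transform 0, 1. So solvability cannot just iterate the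
  transform.\<close>

abbreviation qf :: "complex^'n^'n \<Rightarrow> complex^'n \<Rightarrow> complex" where
  "qf A x \<equiv> cdot x (A *v x)"

section \<open>The sesquilinear form and matrix arithmetic\<close>

lemma cdot_add_left: "cdot (x + y) z = cdot x z + cdot y z"
  by (simp add: cdot_def algebra_simps sum.distrib)

lemma cdot_add_right: "cdot x (y + z) = cdot x y + cdot x z"
  by (simp add: cdot_def algebra_simps sum.distrib)

lemma cdot_diff_left: "cdot (x - y) z = cdot x z - cdot y z"
  by (simp add: cdot_def algebra_simps sum_subtractf)

lemma cdot_diff_right: "cdot x (y - z) = cdot x y - cdot x z"
  by (simp add: cdot_def algebra_simps sum_subtractf)

lemma cdot_minus_left: "cdot (- x) y = - cdot x y"
  by (simp add: cdot_def sum_negf)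

lemma cdot_minus_right: "cdot x (- y) = - cdot x y"
  by (simp add: cdot_def sum_negf)

lemma cdot_scale_left: "cdot (c *s x) y = cnj c * cdot x y"
  by (simp add: cdot_def sum_distrib_left algebra_simps)

lemma cdot_scale_right: "cdot x (c *s y) = c * cdot x y"
  by (simp add: cdot_def sum_distrib_left algebra_simps)

lemma cdot_zero [simp]: "cdot 0 x = 0" "cdot x 0 = 0"
  by (simp_all add: cdot_def)

lemma cdot_sum_left: "cdot (\<Sum>i\<in>I. f i) y = (\<Sum>i\<in>I. cdot (f i) y)"
  by (induction I rule: infinite_finite_induct) (simp_all add: cdot_add_left)

lemma cdot_sum_right: "cdot y (\<Sum>i\<in>I. f i) = (\<Sum>i\<in>I. cdot y (f i))"
  by (induction I rule: infinite_finite_induct) (simp_all add: cdot_add_right)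

lemmas cdot_linear = cdot_add_left cdot_add_right cdot_diff_left cdot_diff_right
  cdot_minus_left cdot_minus_right cdot_scale_left cdot_scale_right

lemma cnj_cdot: "cnj (cdot x y) = cdot y x"
  by (simp add: cdot_def mult.commute)

lemma cdot_self: "cdot x x = of_real ((norm x)\<^sup>2)"
  by (simp add: cdot_def norm_vec_def L2_set_def sum_nonneg complex_norm_square[symmetric] mult.commute
      flip: of_real_power)

lemma cdot_self_eq_0_iff: "cdot x x = 0 \<longleftrightarrow> x = 0"
  by (simp add: cdot_self)

lemma Re_cdot_eq_inner: "Re (cdot x y) = inner x y"
  by (simp add: cdot_def inner_vec_def inner_complex_def)

lemma cdot_adjoint: "cdot x (A *v y) = cdot (conj_transpose A *v x) y"
proof -
  have "cdot x (A *v y) = (\<Sum>i\<in>UNIV. \<Sum>j\<in>UNIV. cnj (x $ i) * (A $ i $ j * y $ j))"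
    by (simp add: cdot_def matrix_vector_mult_def sum_distrib_left)
  also have "\<dots> = (\<Sum>j\<in>UNIV. \<Sum>i\<in>UNIV. cnj (x $ i) * (A $ i $ j * y $ j))"
    by (rule sum.swap)
  also have "\<dots> = cdot (conj_transpose A *v x) y"
    by (simp add: cdot_def matrix_vector_mult_def conj_transpose_def sum_distrib_left mult_ac)
  finally show ?thesis .
qed

lemma axis_cdot: "cdot (axis i 1) x = x $ i"
  by (simp add: cdot_def axis_def if_distrib [of cnj] if_distrib [of "\<lambda>c. c * _"] cong: if_cong)

lemma mat_vec_axis: "(A *v axis j 1) $ i = (A $ i $ j :: complex)"
  by (simp add: matrix_vector_mult_def axis_def if_distrib [of "\<lambda>c. _ * c"] cong: if_cong)

lemma axis_cdot_axis: "cdot (axis i 1) (A *v axis j 1) = A $ i $ j"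
  by (simp add: axis_cdot mat_vec_axis)

lemma eq_if_cdot_eq: "(\<And>y. cdot y x = cdot y x') \<Longrightarrow> x = x'"
  by (metis axis_cdot vec_eq_iff)

lemma matrix_eq_if_cdot_eq: "(\<And>x y. cdot x (A *v y) = cdot x (B *v y)) \<Longrightarrow> A = B"
  by (metis axis_cdot_axis vec_eq_iff)

lemma mat_scale_vec: "mat_scale c A *v x = c *s (A *v x)"
  by (simp add: vec_eq_iff mat_scale_def matrix_vector_mult_def sum_distrib_left algebra_simps)

lemma scaleR_mat_vec: "((c::real) *\<^sub>R A) *v (x::complex^'n) = of_real c *s (A *v x)"
  by (simp add: vec_eq_iff matrix_vector_mult_def sum_distrib_left algebra_simps scaleR_conv_of_real[where 'a = complex])

lemma mat_vec_scale: "A *v (c *s x) = c *s (A *v (x::complex^'n))"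
  by (simp add: vec_eq_iff matrix_vector_mult_def sum_distrib_left algebra_simps)

lemma minus_mat_vec: "(- A) *v (x::complex^'n) = - (A *v x)"
  by (simp add: vec_eq_iff matrix_vector_mult_def sum_negf)

lemma sum_mat_vec: "(\<Sum>i\<in>I. A i) *v (x::complex^'n) = (\<Sum>i\<in>I. A i *v x)"
  by (induction I rule: infinite_finite_induct)
    (simp_all add: matrix_vector_mult_add_rdistrib)

lemma mat_vec_sum: "A *v (\<Sum>i\<in>I. f i) = (\<Sum>i\<in>I. A *v (f i::complex^'n))"
  by (induction I rule: infinite_finite_induct)
    (simp_all add: matrix_vector_right_distrib)

lemma conj_transpose_invol [simp]: "conj_transpose (conj_transpose A) = A"
  by (simp add: conj_transpose_def vec_eq_iff)

lemma conj_transpose_mult: "conj_transpose (A ** B) = conj_transpose B ** conj_transpose A"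
  by (simp add: conj_transpose_def matrix_matrix_mult_def vec_eq_iff mult.commute)

lemma conj_transpose_add: "conj_transpose (A + B) = conj_transpose A + conj_transpose B"
  by (simp add: conj_transpose_def vec_eq_iff)

lemma conj_transpose_diff: "conj_transpose (A - B) = conj_transpose A - conj_transpose B"
  by (simp add: conj_transpose_def vec_eq_iff)

lemma conj_transpose_minus: "conj_transpose (- A) = - conj_transpose A"
  by (simp add: conj_transpose_def vec_eq_iff)

lemma conj_transpose_scaleR: "conj_transpose (c *\<^sub>R A) = c *\<^sub>R conj_transpose A"
  by (simp add: conj_transpose_def vec_eq_iff)

lemma conj_transpose_sum: "conj_transpose (\<Sum>i\<in>I. f i) = (\<Sum>i\<in>I. conj_transpose (f i))"
  by (simp add: conj_transpose_def vec_eq_iff)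

lemma conj_transpose_0 [simp]: "conj_transpose 0 = 0"
  by (simp add: conj_transpose_def vec_eq_iff)

lemma hermitian_cdot: "conj_transpose A = A \<Longrightarrow> cdot (A *v x) y = cdot x (A *v y)"
  by (simp add: cdot_adjoint)

lemma matrix_mult_sum_left: "(\<Sum>i\<in>I. f i) ** (B::complex^'p^'n) = (\<Sum>i\<in>I. f i ** B)"
  by (induction I rule: infinite_finite_induct)
    (simp_all add: matrix_matrix_mult_def vec_eq_iff sum.distrib distrib_right)

lemma matrix_mult_sum_right: "(B::complex^'n^'p) ** (\<Sum>i\<in>I. f i) = (\<Sum>i\<in>I. B ** f i)"
  by (induction I rule: infinite_finite_induct)
    (simp_all add: matrix_add_ldistrib)

lemma matrix_mult_minus_left: "(- A) ** B = - (A ** (B::complex^'p^'n))"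
  by (simp add: matrix_matrix_mult_def vec_eq_iff sum_negf)

lemma matrix_mult_minus_right: "A ** (- B) = - (A ** (B::complex^'p^'n))"
  by (simp add: matrix_matrix_mult_def vec_eq_iff sum_negf)

lemma matrix_mult_diff_right: "A ** (B - C) = A ** B - A ** (C::complex^'p^'n)"
  by (simp add: matrix_matrix_mult_def vec_eq_iff sum_subtractf algebra_simps)

lemma matrix_mult_diff_left: "(A - B) ** C = A ** C - B ** (C::complex^'p^'n)"
  by (simp add: matrix_matrix_mult_def vec_eq_iff sum_subtractf algebra_simps)

lemma matrix_mult_scaleR_left: "(c *\<^sub>R A) ** B = c *\<^sub>R (A ** (B::complex^'p^'n))"
  by (simp add: matrix_matrix_mult_def vec_eq_iff scaleR_right.sum)

lemma matrix_mult_scaleR_right: "A ** (c *\<^sub>R B) = c *\<^sub>R (A ** (B::complex^'p^'n))"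
  by (simp add: matrix_matrix_mult_def vec_eq_iff scaleR_right.sum)

text \<open>Of the four terms in the expansion only \<open>cdot x (A *v y)\<close> comes with the
  weight (-i)^p i^p = 1; the others come with (-i)^p or (-1)^p, which sum to zero over p < 4. This
  is the bridge by which matrix integrals, measures and expansions are reduced to scalar
  ones.\<close>

lemma polarization:
  "4 * cdot x (A *v y) = (\<Sum>p<4. (-\<i>)^p * qf A (x + \<i>^p *s y))"
  by (simp add: eval_nat_numeral lessThan_Suc cdot_linear mat_vec_scale matrix_vector_right_distrib algebra_simps)

lemma entry_polarization:
  "A $ i $ j = (\<Sum>p<4. (-\<i>)^p / 4 * qf A (axis i 1 + \<i>^p *s axis j 1))"
  using polarization[of "axis i 1" A "axis j 1"]
  by (simp add: axis_cdot_axis field_simps flip: sum_divide_distrib)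

lemma qf_entries: "qf A x = (\<Sum>i\<in>UNIV. \<Sum>j\<in>UNIV. cnj (x $ i) * x $ j * A $ i $ j)"
  by (simp add: cdot_def matrix_vector_mult_def sum_distrib_left algebra_simps)

lemma matrix_eq_if_qf_eq: "(\<And>x. qf A x = qf B x) \<Longrightarrow> A = B"
  by (simp add: vec_eq_iff entry_polarization[of A] entry_polarization[of B])

lemma qf_conj_transpose: "qf (conj_transpose A) x = cnj (qf A x)"
  by (simp add: cnj_cdot cdot_adjoint)

text \<open>Over the complex numbers a real quadratic form already forces the matrix to be
  Hermitian, because the form determines the matrix. Hence positivity can be checked on forms
  alone.\<close>

lemma nonneg_herm_iff: "nonneg_herm A \<longleftrightarrow> (\<forall>x. qf A x \<in> \<real>\<^sub>\<ge>\<^sub>0)"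
proof
  assume *: "\<forall>x. qf A x \<in> \<real>\<^sub>\<ge>\<^sub>0"
  have "conj_transpose A = A"
  proof (rule matrix_eq_if_qf_eq)
    fix x
    have "qf A x \<in> \<real>" using * nonneg_Reals_subset_Reals by blast
    then show "qf (conj_transpose A) x = qf A x"
      by (simp add: qf_conj_transpose Reals_cnj_iff)
  qed
  then show "nonneg_herm A" using * by (simp add: nonneg_herm_def)
qed (simp add: nonneg_herm_def)

lemma nonneg_hermD:
  assumes "nonneg_herm A"
  shows "conj_transpose A = A" "0 \<le> Re (qf A x)" "Im (qf A x) = 0"
  using assms by (auto simp: nonneg_herm_def complex_nonneg_Reals_iff)

lemma qf_nonneg_herm: "nonneg_herm A \<Longrightarrow> qf A x = of_real (Re (qf A x))"
  by (simp add: complex_eq_iff nonneg_hermD)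

lemma qf_im_part: "qf (im_part A) x = of_real (Im (qf A x))"
proof -
  have "qf (im_part A) x = (qf A x - cnj (qf A x)) / (2 * \<i>)"
    by (simp add: im_part_def mat_scale_vec cdot_linear matrix_vector_mult_diff_rdistrib
        qf_conj_transpose field_simps)
  then show ?thesis by (simp add: complex_eq_iff)
qed

lemma nonneg_herm_im_part_iff: "nonneg_herm (im_part A) \<longleftrightarrow> (\<forall>x. 0 \<le> Im (qf A x))"
  by (simp add: nonneg_herm_iff qf_im_part)

text \<open>For small e the linear term decides the sign. The choice of \<open>e\<close> gives e q
  \<le> p < 2 p, so a single value replaces a limit.\<close>

lemma quadratic_nonneg_imp_nonpos:
  fixes p q :: real
  assumes "\<And>e. e > 0 \<Longrightarrow> - 2 * e * p + e\<^sup>2 * q \<ge> 0"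
  shows "p \<le> 0"
proof (rule ccontr)
  assume "\<not> p \<le> 0"
  then have p: "p > 0" by simp
  define e where "e = p / (\<bar>q\<bar> + 1)"
  have e: "e > 0" using p by (simp add: e_def add_nonneg_pos)
  have "e * q \<le> e * \<bar>q\<bar>" using e by simp
  also have "\<dots> \<le> e * (\<bar>q\<bar> + 1)" using e by simp
  also have "\<dots> = p" by (simp add: e_def add_nonneg_eq_0_iff)
  finally have "e * (- 2 * p + e * q) < 0" using p e by (simp add: mult_pos_neg)
  with assms[OF e] show False by (simp add: power2_eq_square algebra_simps)
qed

text \<open>With y = - e C x the mixed terms of the nonnegative 2 x 2 block form add up to - 2 e |C
  x|^2, while the pure y term is of order e^2; so C x = 0. The null space inclusions between Hankel
  blocks rest on this perturbation.\<close>

lemma qf_eq_0_imp_block_eq_0: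
  assumes pos: "\<And>y. 0 \<le> Re (qf A x + cdot x (B *v y) + cdot y (C *v x) + qf D y)"
    and "qf A x = 0" and adj: "conj_transpose B = C"
  shows "C *v x = 0"
proof -
  let ?y = "C *v x"
  have BC: "conj_transpose C = B" using adj by auto
  have "- 2 * e * (norm ?y)\<^sup>2 + e\<^sup>2 * Re (qf D ?y) \<ge> 0" if "e > 0" for e :: real
  proof -
    define c where "c = complex_of_real (- e)"
    have 1: "cdot x (B *v (c *s ?y)) = c * of_real ((norm ?y)\<^sup>2)"
      by (simp only: mat_vec_scale cdot_scale_right cdot_adjoint[of x B] adj cdot_self)
    have 2: "cdot (c *s ?y) ?y = c * of_real ((norm ?y)\<^sup>2)"
      by (simp only: cdot_scale_left cdot_self c_def complex_cnj_complex_of_real)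
    have 3: "qf D (c *s ?y) = of_real (e\<^sup>2) * qf D ?y"
      by (simp only: mat_vec_scale cdot_linear) (simp add: power2_eq_square c_def)
    show ?thesis
      using pos[of "c *s ?y"] unfolding 1 2 3 \<open>qf A x = 0\<close> by (simp add: c_def)
  qed
  then have "(norm ?y)\<^sup>2 \<le> 0" by (rule quadratic_nonneg_imp_nonpos)
  then show ?thesis by simp
qed

lemma nonneg_herm_qf_eq_0:
  assumes "nonneg_herm A" "qf A x = 0"
  shows "A *v x = 0"
proof (rule qf_eq_0_imp_block_eq_0[where A = A and B = A and D = A])
  fix y
  have "qf A x + cdot x (A *v y) + cdot y (A *v x) + qf A y = qf A (x + y)"
    by (simp add: cdot_linear matrix_vector_right_distrib)
  then show "0 \<le> Re (qf A x + cdot x (A *v y) + cdot y (A *v x) + qf A y)"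
    using assms(1) nonneg_hermD by metis
qed (use assms nonneg_hermD in auto)

section \<open>The Moore-Penrose inverse of a Hermitian matrix\<close>

definition penrose :: "complex^'n^'m \<Rightarrow> complex^'m^'n \<Rightarrow> bool" where
  "penrose A X \<longleftrightarrow> A ** X ** A = A \<and> X ** A ** X = X \<and>
     conj_transpose (A ** X) = A ** X \<and> conj_transpose (X ** A) = X ** A"

text \<open>Since A Y A = A, the product A X equals (A Y)(A X); the factors are Hermitian, and
  taking adjoints reverses them into (A X)(A Y) = A Y. Likewise X A = Y A, and then X = X A X = X A
  Y = Y A Y = Y.\<close>

lemma penrose_unique:
  assumes "penrose A X" "penrose A Y"
  shows "X = Y"
proof -
  note X = assms(1)[unfolded penrose_def] and Y = assms(2)[unfolded penrose_def]
  have AX: "A ** X = A ** Y"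
  proof -
    have "A ** X = (A ** Y) ** (A ** X)"
      using Y by (simp add: matrix_mul_assoc)
    also have "\<dots> = conj_transpose ((A ** X) ** (A ** Y))"
      using X Y by (simp add: conj_transpose_mult)
    also have "\<dots> = A ** Y" using X Y by (simp add: matrix_mul_assoc)
    finally show ?thesis .
  qed
  have XA: "X ** A = Y ** A"
  proof -
    have "X ** A = (X ** A) ** (Y ** A)"
      using Y by (simp add: matrix_mul_assoc[symmetric])
    also have "\<dots> = conj_transpose ((Y ** A) ** (X ** A))"
      using X Y by (simp add: conj_transpose_mult)
    also have "\<dots> = Y ** A" using X Y by (simp add: matrix_mul_assoc[symmetric])
    finally show ?thesis .
  qed
  have "X = X ** (A ** X)" using X by (simp add: matrix_mul_assoc)
  also have "\<dots> = (X ** A) ** Y" by (simp add: AX matrix_mul_assoc)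
  also have "\<dots> = Y" using Y by (simp add: XA)
  finally show ?thesis .
qed

lemma mp_inverse_eqI: "penrose A X \<Longrightarrow> mp_inverse A = X"
  unfolding mp_inverse_def using penrose_unique
  by (intro the_equality) (auto simp: penrose_def)

lemma mp_inverse_inverse:
  fixes A :: "complex^'n^'n"
  assumes "A ** X = mat 1" "X ** A = mat 1"
  shows "mp_inverse A = X"
proof (rule mp_inverse_eqI)
  have "conj_transpose (mat 1 :: complex^'n^'n) = mat 1"
    by (simp add: conj_transpose_def mat_def vec_eq_iff)
  then show "penrose A X" using assms by (simp add: penrose_def)
qed

context
  fixes A :: "complex^'n^'n"
  assumes herm: "conj_transpose A = A"
begin

lemma herm_nul_ran: "A *v (A *v x) = 0 \<Longrightarrow> A *v x = 0"
  by (metis cdot_self_eq_0_iff cdot_zero(2) herm hermitian_cdot)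

text \<open>The condition A (x - A v) = 0 says that A v is the orthogonal projection of x onto the
  range of A, and A is injective on its range. Thus v is the value at x of the Moore-Penrose
  inverse.\<close>

lemma herm_range_decomp: "\<exists>!v. v \<in> range ((*v) A) \<and> A *v (x - A *v v) = 0"
proof -
  let ?R = "range ((*v) A)"
  have dec: "\<exists>w y. x = A *v w + y \<and> A *v y = 0" for x
  proof -
    \<comment> \<open>This decomposition is orthogonal for the real inner product only; testing z
      against A (A z) still yields |A z| = 0.\<close>
    obtain y z where y: "y \<in> span ?R" and z: "\<And>w. w \<in> span ?R \<Longrightarrow> orthogonal z w" and x: "x = y + z"
      using orthogonal_subspace_decomp_exists[of ?R x] by blast
    have "subspace ?R"
      by (rule linear_subspace_image[OF _ subspace_UNIV])
        (simp add: bounded_linear.linear[OF matrix_vector_mul_bounded_linear])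
    then have "span ?R = ?R" by (simp add: span_eq_iff)
    moreover have "inner z (A *v (A *v z)) = 0" using z[of "A *v (A *v z)"]
      by (simp add: \<open>span ?R = ?R\<close> orthogonal_def)
    then have "inner (A *v z) (A *v z) = 0"
      by (metis Re_cdot_eq_inner herm hermitian_cdot)
    ultimately show ?thesis using x y by (metis image_iff inner_eq_zero_iff)
  qed
  obtain w y where wy: "x = A *v w + y" "A *v y = 0" using dec by blast
  obtain w' y' where w': "w = A *v w' + y'" "A *v y' = 0" using dec by blast
  show ?thesis
  proof (rule ex1I)
    show "A *v w' \<in> ?R \<and> A *v (x - A *v (A *v w')) = 0"
      using wy w' by (auto simp: matrix_vector_right_distrib)
    fix v assume v: "v \<in> ?R \<and> A *v (x - A *v v) = 0"
    then obtain a where a: "v = A *v a" by auto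
    have "A *v (A *v (v - A *v w')) = 0" using v wy w'
      by (simp add: matrix_vector_right_distrib matrix_vector_mult_diff_distrib)
    then have "A *v (A *v (a - w')) = 0"
      by (metis a herm_nul_ran matrix_vector_mult_diff_distrib)
    then show "v = A *v w'"
      by (metis a herm_nul_ran matrix_vector_mult_diff_distrib right_minus_eq)
  qed
qed

definition "herm_pinv x = (THE v. v \<in> range ((*v) A) \<and> A *v (x - A *v v) = 0)"

lemma herm_pinv: "herm_pinv x \<in> range ((*v) A)" "A *v (x - A *v herm_pinv x) = 0"
  using theI'[OF herm_range_decomp[of x]] unfolding herm_pinv_def by blast+

lemma herm_pinv_eqI: "v \<in> range ((*v) A) \<Longrightarrow> A *v (x - A *v v) = 0 \<Longrightarrow> herm_pinv x = v"
  unfolding herm_pinv_def using herm_range_decomp[of x] by (intro the1_equality) auto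

text \<open>Linearity and the Penrose equations come from the uniqueness of v and the injectivity of
  A on its range. As A is Hermitian, the candidate commutes with A, so only A X has to be shown
  Hermitian.\<close>

lemma penrose_herm_pinv: "penrose A (matrix herm_pinv)"
proof -
  have lin: "Vector_Spaces.linear (*s) (*s) herm_pinv"
  proof
    fix x y
    obtain a b where ab: "herm_pinv x = A *v a" "herm_pinv y = A *v b" using herm_pinv(1) by (metis imageE)
    show "herm_pinv (x + y) = herm_pinv x + herm_pinv y"
    proof (rule herm_pinv_eqI)
      show "herm_pinv x + herm_pinv y \<in> range ((*v) A)"
        unfolding ab by (metis matrix_vector_right_distrib rangeI)
      show "A *v (x + y - A *v (herm_pinv x + herm_pinv y)) = 0"
        using herm_pinv(2)[of x] herm_pinv(2)[of y]
        by (simp add: matrix_vector_right_distrib matrix_vector_mult_diff_distrib)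
    qed
  next
    fix c x
    obtain a where a: "herm_pinv x = A *v a" using herm_pinv(1) by (metis imageE)
    show "herm_pinv (c *s x) = c *s herm_pinv x"
    proof (rule herm_pinv_eqI)
      show "c *s herm_pinv x \<in> range ((*v) A)"
        unfolding a by (metis mat_vec_scale rangeI)
      show "A *v (c *s x - A *v (c *s herm_pinv x)) = 0"
        using herm_pinv(2)[of x]
        by (simp add: mat_vec_scale matrix_vector_mult_diff_distrib)
    qed
  qed
  define X where "X = matrix herm_pinv"
  have X: "X *v x = herm_pinv x" for x unfolding X_def by (rule matrix_works[OF lin])
  have AXA: "A *v (A *v (X *v x)) = A *v x" for x
    using herm_pinv(2)[of x] by (simp add: X matrix_vector_mult_diff_distrib)
  have XX: "X *v (A *v (X *v x)) = X *v x" for x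
    unfolding X[of "A *v _"] X by (rule herm_pinv_eqI) (auto simp: herm_pinv(1))
  have ranX: "\<exists>w. X *v x = A *v w" for x using herm_pinv(1)[of x] by (auto simp: X)
  have comm: "X *v (A *v x) = A *v (X *v x)" for x
  proof -
    obtain w where w: "X *v (A *v x) = A *v w" using ranX by blast
    have "A *v (A *v (X *v (A *v x))) = A *v (A *v x)" by (rule AXA)
    then have "A *v (A *v (X *v (A *v x) - x)) = 0" by (simp add: matrix_vector_mult_diff_distrib)
    then have "A *v (X *v (A *v x)) = A *v x" using herm_nul_ran
      by (metis matrix_vector_mult_diff_distrib right_minus_eq)
    then have "A *v (A *v (w - X *v x)) = 0" using AXA[of x] w
      by (simp add: matrix_vector_mult_diff_distrib)
    then show ?thesis using herm_nul_ran w
      by (metis matrix_vector_mult_diff_distrib right_minus_eq)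
  qed
  have herm_AX: "conj_transpose (A ** X) = A ** X"
  proof (rule matrix_eq_if_cdot_eq)
    fix x y
    have orth: "cdot (A *v a) (y - A *v (X *v y)) = 0" for a y
      using AXA[of y] by (simp add: hermitian_cdot[OF herm] matrix_vector_mult_diff_distrib)
    have "cdot (A *v (X *v x)) y = cdot (A *v (X *v x)) (A *v (X *v y))"
      using orth[of "X *v x" y] by (simp add: cdot_linear)
    also have "\<dots> = cdot x (A *v (X *v y))"
      using orth[of "X *v y" x] by (metis cdot_diff_right cnj_cdot right_minus_eq)
    finally show "cdot x (conj_transpose (A ** X) *v y) = cdot x (A ** X *v y)"
      by (simp add: cdot_adjoint[of _ "conj_transpose _"] matrix_vector_mul_assoc)
  qed
  have eq: "X ** A = A ** X"
    unfolding matrix_eq by (simp add: comm flip: matrix_vector_mul_assoc)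
  have "A ** X ** A = A" "X ** A ** X = X"
    unfolding matrix_eq by (simp add: comm AXA flip: matrix_vector_mul_assoc)
      (simp add: XX flip: matrix_vector_mul_assoc)
  then show ?thesis using herm_AX eq unfolding X_def penrose_def by simp
qed

lemma mp_inverse_hermitian:
  "A ** mp_inverse A ** A = A" "mp_inverse A ** A ** mp_inverse A = mp_inverse A"
  "conj_transpose (mp_inverse A) = mp_inverse A" "mp_inverse A ** A = A ** mp_inverse A"
  "conj_transpose (A ** mp_inverse A) = A ** mp_inverse A"
proof -
  let ?X = "mp_inverse A"
  have P: "penrose A ?X"
    using penrose_herm_pinv mp_inverse_eqI by metis
  then have "penrose A (conj_transpose ?X)"
    using herm unfolding penrose_def
    by (metis conj_transpose_mult conj_transpose_invol matrix_mul_assoc)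
  then show X: "conj_transpose ?X = ?X" using P penrose_unique by blast
  show "A ** ?X ** A = A" "?X ** A ** ?X = ?X" "conj_transpose (A ** ?X) = A ** ?X"
    using P by (auto simp: penrose_def)
  then show "?X ** A = A ** ?X" by (metis X conj_transpose_mult herm)
qed

end

lemma nonneg_herm_mp_inverse:
  assumes "nonneg_herm A"
  shows "nonneg_herm (mp_inverse A)"
proof -
  note h = nonneg_hermD(1)[OF assms]
  have "qf (mp_inverse A) x = qf A (mp_inverse A *v x)" for x
    by (metis cdot_adjoint h matrix_vector_mul_assoc mp_inverse_hermitian(2,3))
  then show ?thesis using assms by (simp add: nonneg_herm_iff)
qed

section \<open>Reciprocal sequences and block Hankel matrices\<close>

text \<open>The Cauchy product of power series with matrix coefficients. In this language
  \<open>delay\<close> is multiplication by the variable w, \<open>unit_seq P\<close> is the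
  constant series P, and the shifted sequence is (1 - \<alpha> w) times the series of s.\<close>

definition conv :: "(nat \<Rightarrow> complex^'n^'n) \<Rightarrow> (nat \<Rightarrow> complex^'n^'n) \<Rightarrow> nat \<Rightarrow> complex^'n^'n" where
  "conv a b j = (\<Sum>i=0..j. a i ** b (j - i))"

definition delay :: "(nat \<Rightarrow> 'a::zero) \<Rightarrow> nat \<Rightarrow> 'a" where
  "delay a j = (if j = 0 then 0 else a (j - 1))"

lemma conv_cong:
  "(\<And>i. i \<le> j \<Longrightarrow> a i = a' i) \<Longrightarrow> (\<And>i. i \<le> j \<Longrightarrow> b i = b' i) \<Longrightarrow> conv a b j = conv a' b' j"
  by (simp add: conv_def)

lemma conv_assoc: "conv (conv a b) c j = conv a (conv b c) j"
  unfolding conv_def matrix_mult_sum_left matrix_mult_sum_right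
  using fps_mult_assoc_lemma[where k = j and n = j and f = "\<lambda>i k l. a i ** b k ** c l"]
  by (simp add: matrix_mul_assoc)

lemma conv_delay_left: "conv (delay a) b j = delay (conv a b) j"
  by (cases j) (simp_all add: conv_def delay_def sum.atLeast0_atMost_Suc_shift del: sum.cl_ivl_Suc)

lemma conv_delay_right: "conv a (delay b) j = delay (conv a b) j"
  by (cases j) (simp_all add: conv_def delay_def Suc_diff_le)

lemma conj_transpose_conv:
  "conj_transpose (conv a b j) = conv (\<lambda>i. conj_transpose (b i)) (\<lambda>i. conj_transpose (a i)) j"
  unfolding conv_def conj_transpose_sum conj_transpose_mult
  by (rule sum.reindex_bij_witness[of _ "\<lambda>i. j - i" "\<lambda>i. j - i"]) auto

definition unit_seq :: "'a::zero \<Rightarrow> nat \<Rightarrow> 'a" where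
  "unit_seq P j = (if j = 0 then P else 0)"

lemma conv_unit_left: "conv (unit_seq P) b j = P ** b j"
proof -
  have "conv (unit_seq P) b j = (\<Sum>i\<in>{0..j}. if i = 0 then P ** b j else 0)"
    unfolding conv_def by (rule sum.cong) (auto simp: unit_seq_def)
  then show ?thesis by simp
qed

lemma conv_unit_right: "conv b (unit_seq P) j = b j ** P"
proof -
  have "conv b (unit_seq P) j = (\<Sum>i\<in>{0..j}. if i = j then b j ** P else 0)"
    unfolding conv_def by (rule sum.cong) (auto simp: unit_seq_def)
  then show ?thesis by simp
qed

text \<open>Here v and \<rho> are reciprocal modulo w^(M + 1), with the projection P as unit. The
  two-variable series with coefficients \<open>v (a + b + 1)\<close> is (v(x) - v(y)) / (x - y), and
  multiplying it by \<rho>(x) from the left and \<rho>(y) from the right gives - (\<rho>(x) -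
  \<rho>(y)) / (x - y). The lemmas below extract coefficients of this identity while respecting the
  truncation.\<close>

context
  fixes v \<rho> :: "nat \<Rightarrow> complex^'n^'n" and P :: "complex^'n^'n" and M :: nat
  assumes right: "\<And>i. i \<le> M \<Longrightarrow> conv v \<rho> i = unit_seq P i"
    and left: "\<And>i. i \<le> M \<Longrightarrow> conv \<rho> v i = unit_seq P i"
    and P: "\<And>i. i \<le> M \<Longrightarrow> P ** \<rho> i = \<rho> i"
begin

text \<open>The inner sum is the part of the convolution in which v has index at most a. Reindexed
  by a - c, the double sum becomes the product of \<rho> v with \<rho> shifted by k + 1, and of the
  factor \<rho> v only the constant coefficient P survives.\<close>

lemma toeplitz_core:
  assumes "j + k + 1 \<le> M"
  shows "(\<Sum>a=0..j. \<rho> (j - a) ** (\<Sum>c=0..a. v c ** \<rho> (a + 1 + k - c))) = \<rho> (j + k + 1)"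
proof -
  have "(\<Sum>a=0..j. \<rho> (j - a) ** (\<Sum>c=0..a. v c ** \<rho> (a + 1 + k - c)))
      = (\<Sum>a=0..j. \<Sum>c=0..a. \<rho> (j - a) ** (v (a - c) ** \<rho> (c + 1 + k)))"
  proof (rule sum.cong)
    fix a assume "a \<in> {0..j}"
    have "(\<Sum>c=0..a. v c ** \<rho> (a + 1 + k - c)) = (\<Sum>c=0..a. v (a - c) ** \<rho> (c + 1 + k))"
      by (rule sum.reindex_bij_witness[of _ "\<lambda>i. a - i" "\<lambda>i. a - i"]) (auto simp: Suc_diff_le)
    then show "\<rho> (j - a) ** (\<Sum>c=0..a. v c ** \<rho> (a + 1 + k - c))
      = (\<Sum>c=0..a. \<rho> (j - a) ** (v (a - c) ** \<rho> (c + 1 + k)))"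
      by (simp add: matrix_mult_sum_right)
  qed simp
  also have "\<dots> = (\<Sum>d=0..j. \<Sum>c=0..j-d. \<rho> (j - d - c) ** (v c ** \<rho> (d + 1 + k)))"
    using fps_mult_assoc_lemma[where k = j and n = j and f = "\<lambda>d c e. \<rho> e ** (v c ** \<rho> (d + 1 + k))"] by simp
  also have "\<dots> = (\<Sum>d=0..j. conv \<rho> v (j - d) ** \<rho> (d + 1 + k))"
  proof (rule sum.cong)
    fix d assume "d \<in> {0..j}"
    have "(\<Sum>c=0..j-d. \<rho> (j - d - c) ** v c) = conv \<rho> v (j - d)"
      unfolding conv_def
      by (rule sum.reindex_bij_witness[of _ "\<lambda>i. j - d - i" "\<lambda>i. j - d - i"])
        (auto simp del: diff_diff_left)
    then show "(\<Sum>c=0..j-d. \<rho> (j - d - c) ** (v c ** \<rho> (d + 1 + k))) = conv \<rho> v (j - d) ** \<rho> (d + 1 + k)"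
      by (simp add: matrix_mult_sum_left matrix_mul_assoc flip: matrix_mult_sum_left)
  qed simp
  also have "\<dots> = (\<Sum>d\<in>{0..j}. if d = j then P ** \<rho> (j + k + 1) else 0)"
    using assms left by (intro sum.cong) (auto simp: unit_seq_def)
  also have "\<dots> = \<rho> (j + k + 1)"
    using assms P by simp
  finally show ?thesis .
qed

text \<open>The coefficient of v \<rho> of degree a + 1 + k vanishes, since that degree is positive;
  it is split after index a.\<close>

lemma conv_tail:
  assumes "a + 1 + k \<le> M"
  shows "(\<Sum>b=0..k. v (a + b + 1) ** \<rho> (k - b)) = - (\<Sum>c=0..a. v c ** \<rho> (a + 1 + k - c))"
proof -
  have "0 = conv v \<rho> (a + 1 + k)" using right[OF assms] by (simp add: unit_seq_def)
  also have "\<dots> = (\<Sum>c=0..a. v c ** \<rho> (a + 1 + k - c)) + (\<Sum>c=a+1..a+1+k. v c ** \<rho> (a + 1 + k - c))"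
  proof -
    have "{0..a+1+k} = {0..a} \<union> {a+1..a+1+k}" by auto
    then show ?thesis unfolding conv_def by (simp only:) (subst sum.union_disjoint, auto)
  qed
  also have "(\<Sum>c=a+1..a+1+k. v c ** \<rho> (a + 1 + k - c)) = (\<Sum>b=0..k. v (a + b + 1) ** \<rho> (k - b))"
    by (rule sum.reindex_bij_witness[of _ "\<lambda>b. a + b + 1" "\<lambda>c. c - a - 1"])
      (auto simp: Suc_diff_le add.commute[of k a])
  finally show ?thesis by (simp add: eq_neg_iff_add_eq_0 add.commute)
qed

lemma hankel_congruence_shift:
  assumes "j + k + 1 \<le> M"
  shows "(\<Sum>a=0..j. \<Sum>b=0..k. \<rho> (j - a) ** v (a + b + 1) ** \<rho> (k - b)) = - \<rho> (j + k + 1)"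
proof -
  have "(\<Sum>a=0..j. \<Sum>b=0..k. \<rho> (j - a) ** v (a + b + 1) ** \<rho> (k - b))
    = (\<Sum>a=0..j. \<rho> (j - a) ** (\<Sum>b=0..k. v (a + b + 1) ** \<rho> (k - b)))"
    by (simp add: matrix_mult_sum_right matrix_mul_assoc)
  also have "\<dots> = (\<Sum>a=0..j. \<rho> (j - a) ** - (\<Sum>c=0..a. v c ** \<rho> (a + 1 + k - c)))"
    using assms by (intro sum.cong refl arg_cong2[where f = "(**)"] conv_tail) auto
  also have "\<dots> = - \<rho> (j + k + 1)"
    using toeplitz_core[OF assms] by (simp add: matrix_mult_minus_right sum_negf)
  finally show ?thesis .
qed

text \<open>The unshifted matrix is reduced to the shifted one: the row a = 0 carries the
  coefficient of v \<rho> of degree k + 1, which is zero, and after lowering a by one the other rows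
  form the shifted sum with k + 1 in place of k.\<close>

lemma hankel_congruence:
  assumes "j + k + 2 \<le> M"
  shows "(\<Sum>a=0..j+1. \<Sum>b=0..k+1. \<rho> (j + 1 - a) ** v (a + b) ** \<rho> (k + 1 - b)) = - \<rho> (j + k + 2)"
proof -
  have "(\<Sum>a=0..j+1. \<Sum>b=0..k+1. \<rho> (j + 1 - a) ** v (a + b) ** \<rho> (k + 1 - b))
    = (\<Sum>a=0..Suc j. \<rho> (j + 1 - a) ** (\<Sum>b=0..k+1. v (a + b) ** \<rho> (k + 1 - b)))"
    by (simp add: matrix_mult_sum_right matrix_mul_assoc del: sum.cl_ivl_Suc)
  also have "\<dots> = \<rho> (j + 1) ** conv v \<rho> (k + 1)
      + (\<Sum>a=0..j. \<rho> (j - a) ** (\<Sum>b=0..k+1. v (a + b + 1) ** \<rho> (k + 1 - b)))"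
    by (subst sum.atLeast0_atMost_Suc_shift) (simp add: conv_def del: sum.cl_ivl_Suc)
  also have "conv v \<rho> (k + 1) = 0" using assms by (subst right) (auto simp: unit_seq_def)
  also have "(\<Sum>a=0..j. \<rho> (j - a) ** (\<Sum>b=0..k+1. v (a + b + 1) ** \<rho> (k + 1 - b)))
      = (\<Sum>a=0..j. \<rho> (j - a) ** - (\<Sum>c=0..a. v c ** \<rho> (a + 1 + (k + 1) - c)))"
    using assms by (intro sum.cong refl arg_cong2[where f = "(**)"] conv_tail) auto
  also have "\<dots> = - \<rho> (j + (k + 1) + 1)"
    using toeplitz_core[of j "k + 1"] assms by (simp add: matrix_mult_minus_right sum_negf)
  finally show ?thesis by simp
qed

end

section \<open>Congruences of block matrices\<close>

lemma sum_if_le: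
  fixes f :: "nat \<Rightarrow> 'a::comm_monoid_add"
  assumes "i \<le> N"
  shows "(\<Sum>a\<le>N. if a \<le> i then f a else 0) = (\<Sum>a=0..i. f a)"
proof -
  have "(\<Sum>a=0..i. f a) = (\<Sum>a\<in>{0..i}. if a \<le> i then f a else 0)" by (rule sum.cong) auto
  also have "\<dots> = (\<Sum>a\<le>N. if a \<le> i then f a else 0)"
    using assms by (intro sum.mono_neutral_left) auto
  finally show ?thesis by simp
qed

text \<open>\<open>W j a\<close> is the block in row a and column j of the transforming matrix. The
  sizes n and N may differ, so triangular Toeplitz factors and compressions are covered
  alike.\<close>

lemma block_nonneg_herm_congruence:
  fixes B C W :: "nat \<Rightarrow> nat \<Rightarrow> complex^'n^'n"
  assumes B: "block_nonneg_herm N B"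
    and C: "\<And>j k. j \<le> n \<Longrightarrow> k \<le> n \<Longrightarrow>
      C j k = (\<Sum>a\<le>N. \<Sum>b\<le>N. conj_transpose (W j a) ** B a b ** W k b)"
  shows "block_nonneg_herm n C"
  unfolding block_nonneg_herm_def
proof (intro conjI allI impI)
  fix j k assume jk: "j \<le> n" "k \<le> n"
  have Bh: "a \<le> N \<Longrightarrow> b \<le> N \<Longrightarrow> conj_transpose (B a b) = B b a" for a b
    using B by (simp add: block_nonneg_herm_def)
  have "conj_transpose (C j k) = (\<Sum>a\<le>N. \<Sum>b\<le>N. conj_transpose (W k b) ** B b a ** W j a)"
    using C[OF jk] by (simp add: conj_transpose_sum conj_transpose_mult Bh matrix_mul_assoc)
  also have "\<dots> = C k j" using C[OF jk(2,1)] by (subst sum.swap) simp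
  finally show "conj_transpose (C j k) = C k j" .
next
  fix x :: "nat \<Rightarrow> complex^'n"
  define y where "y a = (\<Sum>j\<le>n. W j a *v x j)" for a
  have "(\<Sum>j\<le>n. \<Sum>k\<le>n. cdot (x j) (C j k *v x k))
     = (\<Sum>j\<le>n. \<Sum>k\<le>n. \<Sum>a\<le>N. \<Sum>b\<le>N. cdot (W j a *v x j) (B a b *v (W k b *v x k)))"
    by (simp add: C sum_mat_vec cdot_sum_right cdot_adjoint[of _ "conj_transpose _"]
        flip: matrix_vector_mul_assoc)
  also have "\<dots> = (\<Sum>j\<le>n. \<Sum>a\<le>N. \<Sum>k\<le>n. \<Sum>b\<le>N. cdot (W j a *v x j) (B a b *v (W k b *v x k)))"
    by (intro sum.cong refl sum.swap)
  also have "\<dots> = (\<Sum>a\<le>N. \<Sum>j\<le>n. \<Sum>k\<le>n. \<Sum>b\<le>N. cdot (W j a *v x j) (B a b *v (W k b *v x k)))"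
    by (rule sum.swap)
  also have "\<dots> = (\<Sum>a\<le>N. \<Sum>j\<le>n. \<Sum>b\<le>N. \<Sum>k\<le>n. cdot (W j a *v x j) (B a b *v (W k b *v x k)))"
    by (intro sum.cong refl sum.swap)
  also have "\<dots> = (\<Sum>a\<le>N. \<Sum>b\<le>N. \<Sum>j\<le>n. \<Sum>k\<le>n. cdot (W j a *v x j) (B a b *v (W k b *v x k)))"
    by (intro sum.cong refl sum.swap)
  also have "\<dots> = (\<Sum>a\<le>N. \<Sum>b\<le>N. cdot (y a) (B a b *v y b))"
    by (simp only: y_def mat_vec_sum cdot_sum_left) (simp only: cdot_sum_right)
  also have "\<dots> \<in> \<real>\<^sub>\<ge>\<^sub>0" using B by (simp add: block_nonneg_herm_def)
  finally show "(\<Sum>j\<le>n. \<Sum>k\<le>n. cdot (x j) (C j k *v x k)) \<in> \<real>\<^sub>\<ge>\<^sub>0" .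
qed

lemma block_nonneg_herm_diag:
  fixes B :: "nat \<Rightarrow> nat \<Rightarrow> complex^'n^'n"
  assumes "block_nonneg_herm n B" "i \<le> n"
  shows "nonneg_herm (B i i)"
proof -
  have "block_nonneg_herm 0 (\<lambda>j k. B i i)"
  proof (rule block_nonneg_herm_congruence[OF assms(1), where W = "\<lambda>j a. if a = i then mat 1 else 0"])
    have "conj_transpose (mat 1 :: complex^'n^'n) = mat 1"
      by (simp add: conj_transpose_def mat_def vec_eq_iff)
    moreover have "0 ** X = 0" "X ** 0 = 0" for X :: "complex^'n^'n"
      by (simp_all add: matrix_matrix_mult_def vec_eq_iff)
    ultimately have "conj_transpose (if a = i then mat 1 else 0) ** B a b ** (if b = i then mat 1 else 0)
      = (if a = i then (if b = i then B i i else 0) else 0)" for a b by simp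
    then show "B i i = (\<Sum>a\<le>n. \<Sum>b\<le>n. conj_transpose (if a = i then mat 1 else 0) ** B a b ** (if b = i then mat 1 else 0))"
      using assms(2) by (simp add: if_distrib[of "\<lambda>f. sum f _"] sum.If_cases flip: if_distrib cong: if_cong)
  qed
  then have "\<forall>x::nat \<Rightarrow> complex^'n. qf (B i i) (x 0) \<in> \<real>\<^sub>\<ge>\<^sub>0"
    by (simp add: block_nonneg_herm_def)
  then have "qf (B i i) x \<in> \<real>\<^sub>\<ge>\<^sub>0" for x by (rule allE[of _ "\<lambda>_. x"])
  then show ?thesis by (simp add: nonneg_herm_iff)
qed

lemma block_nonneg_herm_cong:
  "(\<And>j k. j \<le> n \<Longrightarrow> k \<le> n \<Longrightarrow> B j k = C j k) \<Longrightarrow> block_nonneg_herm n B = block_nonneg_herm n C"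
  by (simp add: block_nonneg_herm_def)

text \<open>Terms of even index are diagonal blocks of the first Hankel matrix. Those of odd index
  are diagonal blocks of the second one, up to a real multiple of the preceding even term.\<close>

lemma K_class_hermitian:
  assumes "s \<in> K_class m \<alpha>" "j \<le> m"
  shows "conj_transpose (s j) = s j"
proof (cases "m = 0")
  case True
  then show ?thesis using assms by (simp add: K_class_def nonneg_herm_def)
next
  case False
  define n where "n = m div 2"
  define n' where "n' = (if even m then n - 1 else n)"
  have H: "block_nonneg_herm n (hankel s)"
    and L: "block_nonneg_herm n' (\<lambda>j k. - (\<alpha> *\<^sub>R hankel s j k) + hankel_shift s j k)"
    using assms False by (auto simp: K_class_def n_def n'_def Let_def)
  have even: "conj_transpose (s (2 * i)) = s (2 * i)" if "i \<le> n" for i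
    using H that by (auto simp: block_nonneg_herm_def hankel_def mult_2)
  show ?thesis
  proof (cases "even j")
    case True
    then obtain i where "j = 2 * i" by auto
    then show ?thesis using even[of i] assms by (auto simp: n_def)
  next
    case False
    then obtain i where j: "j = 2 * i + 1" by (auto elim: oddE)
    then have i: "i \<le> n'" "i \<le> n" using assms by (auto simp: n'_def n_def)
    then have "conj_transpose (- (\<alpha> *\<^sub>R s (2 * i)) + s (2 * i + 1)) = - (\<alpha> *\<^sub>R s (2 * i)) + s (2 * i + 1)"
      using L by (auto simp: block_nonneg_herm_def hankel_def hankel_shift_def mult_2)
    then show ?thesis using even[of i] i j
      by (simp add: conj_transpose_add conj_transpose_diff conj_transpose_minus conj_transpose_scaleR)
  qed
qed

section \<open>The reciprocal sequence and the S-transform of a dominated Hermitian sequence\<close>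

locale dominated_seq =
  fixes \<alpha> :: real and m :: nat and s :: "nat \<Rightarrow> complex^'q^'q"
  assumes herm: "j \<le> m \<Longrightarrow> conj_transpose (s j) = s j"
    and dom: "s \<in> D_class m"
begin

abbreviation "A \<equiv> s 0"
abbreviation "X \<equiv> mp_inverse A"
abbreviation "u \<equiv> shifted_seq \<alpha> s"
abbreviation "r \<equiv> recip_seq u"
abbreviation "P \<equiv> A ** X"
abbreviation "t \<equiv> S_transform \<alpha> s"

lemma A_herm: "conj_transpose A = A" using herm by simp

lemmas X = mp_inverse_hermitian[OF A_herm]

lemma P_s: "j \<le> m \<Longrightarrow> P ** s j = s j"
  unfolding matrix_eq
proof
  fix x assume "j \<le> m"
  then have "s j *v x \<in> col_space A" using dom by (fastforce simp: D_class_def col_space_def)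
  then obtain w where w: "s j *v x = A *v w" by (auto simp: col_space_def)
  have "P ** s j *v x = (A ** X ** A) *v w"
    by (metis w matrix_vector_mul_assoc)
  then show "P ** s j *v x = s j *v x" using X(1) w by simp
qed

lemma s_P: "j \<le> m \<Longrightarrow> s j ** P = s j"
  using P_s[of j] herm[of j] X(5) by (metis conj_transpose_mult)

lemma u_0: "u 0 = A" by (simp add: shifted_seq_def)

lemma u_delay: "u j = s j - \<alpha> *\<^sub>R delay s j" by (simp add: shifted_seq_def delay_def)

lemma P_u: "j \<le> m \<Longrightarrow> P ** u j = u j"
  by (simp add: u_delay delay_def matrix_mult_diff_right matrix_mult_scaleR_right P_s)

lemma u_P: "j \<le> m \<Longrightarrow> u j ** P = u j"
  by (simp add: u_delay delay_def matrix_mult_diff_left matrix_mult_scaleR_left s_P)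

lemma u_herm: "j \<le> m \<Longrightarrow> conj_transpose (u j) = u j"
  by (simp add: u_delay delay_def conj_transpose_diff conj_transpose_scaleR herm)

lemma P_X: "P ** X = X" "X ** P = X"
  using X by (metis matrix_mul_assoc)+

lemma r_rec: "r j = (if j = 0 then X else - (X ** (\<Sum>l<j. u (j - l) ** r l)))"
  by (subst recip_seq.simps) (simp add: u_0)

lemma P_r: "P ** r j = r j"
  by (subst (1 2) r_rec) (simp add: matrix_mult_minus_right matrix_mul_assoc P_X)

text \<open>Multiplying the recursion by A turns A X into P, and by domination P fixes the ranges of
  all u_j. So r is a right reciprocal of u with P as unit.\<close>

lemma conv_u_r:
  assumes "j \<le> m"
  shows "conv u r j = unit_seq P j"
proof (cases j)
  case 0
  then show ?thesis by (simp add: conv_def unit_seq_def u_0 r_rec[of 0])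
next
  case (Suc j')
  have "P ** (\<Sum>l<j. u (j - l) ** r l) = (\<Sum>l<j. u (j - l) ** r l)"
    using assms by (simp add: matrix_mult_sum_right matrix_mul_assoc P_u)
  then have "A ** r j = - (\<Sum>l<j. u (j - l) ** r l)"
    using Suc by (subst r_rec) (simp add: matrix_mult_minus_right matrix_mul_assoc)
  moreover have "conv u r j = A ** r j + (\<Sum>l<j. u (j - l) ** r l)"
  proof -
    have "conv u r j = (\<Sum>l=0..j. u (j - l) ** r l)"
      unfolding conv_def by (rule sum.reindex_bij_witness[of _ "\<lambda>i. j - i" "\<lambda>i. j - i"]) auto
    also have "{0..j} = insert j {..<j}" by auto
    finally show ?thesis by (simp add: u_0)
  qed
  ultimately show ?thesis using Suc by (simp add: unit_seq_def)
qed

lemma conv_r'_u: "j \<le> m \<Longrightarrow> conv (\<lambda>i. conj_transpose (r i)) u j = unit_seq P j"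
proof -
  assume j: "j \<le> m"
  have "conv (\<lambda>i. conj_transpose (r i)) u j = conv (\<lambda>i. conj_transpose (r i)) (\<lambda>i. conj_transpose (u i)) j"
    using j by (intro conv_cong) (auto simp: u_herm)
  also have "\<dots> = conj_transpose (conv u r j)" by (simp add: conj_transpose_conv)
  also have "\<dots> = unit_seq P j" using j X(5) by (simp add: conv_u_r unit_seq_def)
  finally show ?thesis .
qed

text \<open>The adjoint of \<open>conv_u_r\<close> makes the adjoint sequence of r a left reciprocal
  of u. A left and a right reciprocal coincide by associativity, P acting as the unit on
  both.\<close>

lemma r_herm:
  assumes "j \<le> m"
  shows "conj_transpose (r j) = r j"
proof -
  let ?r = "\<lambda>i. conj_transpose (r i)"
  have "?r j = ?r j ** P" using P_r X(5) by (metis conj_transpose_mult)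
  also have "\<dots> = conv ?r (unit_seq P) j" by (simp add: conv_unit_right)
  also have "\<dots> = conv ?r (conv u r) j" using assms by (intro conv_cong) (auto simp: conv_u_r)
  also have "\<dots> = conv (conv ?r u) r j" by (simp add: conv_assoc)
  also have "\<dots> = conv (unit_seq P) r j" using assms by (intro conv_cong) (auto simp: conv_r'_u)
  also have "\<dots> = r j" by (simp add: conv_unit_left P_r)
  finally show ?thesis .
qed

lemma conv_r_u:
  assumes "j \<le> m"
  shows "conv r u j = unit_seq P j"
  using conv_r'_u[OF assms] conv_cong[of j r "\<lambda>i. conj_transpose (r i)" u u] assms r_herm by auto

text \<open>The reciprocal of s itself: u = (1 - \<alpha> w) s, so moving the scalar factor over to
  r gives s \<rho> = u r.\<close>

definition "\<rho> j = r j - \<alpha> *\<^sub>R delay r j"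

lemma conv_s_\<rho>: "conv s \<rho> j = conv u r j"
proof -
  have "conv s \<rho> j = conv s r j - \<alpha> *\<^sub>R conv s (delay r) j"
    by (simp add: conv_def \<rho>_def matrix_mult_diff_right matrix_mult_scaleR_right sum_subtractf scaleR_sum_right)
  moreover have "conv u r j = conv s r j - \<alpha> *\<^sub>R conv (delay s) r j"
    by (simp add: conv_def u_delay matrix_mult_diff_left matrix_mult_scaleR_left sum_subtractf scaleR_sum_right)
  ultimately show ?thesis by (simp add: conv_delay_left conv_delay_right)
qed

lemma conv_\<rho>_s: "conv \<rho> s j = conv r u j"
proof -
  have "conv \<rho> s j = conv r s j - \<alpha> *\<^sub>R conv (delay r) s j"
    by (simp add: conv_def \<rho>_def matrix_mult_diff_left matrix_mult_scaleR_left sum_subtractf scaleR_sum_right)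
  moreover have "conv r u j = conv r s j - \<alpha> *\<^sub>R conv r (delay s) j"
    by (simp add: conv_def u_delay matrix_mult_diff_right matrix_mult_scaleR_right sum_subtractf scaleR_sum_right)
  ultimately show ?thesis by (simp add: conv_delay_left conv_delay_right)
qed

lemma P_\<rho>: "P ** \<rho> j = \<rho> j"
  by (simp add: \<rho>_def delay_def matrix_mult_diff_right matrix_mult_scaleR_right P_r)

lemma \<rho>_herm: "j \<le> m \<Longrightarrow> conj_transpose (\<rho> j) = \<rho> j"
  by (simp add: \<rho>_def delay_def conj_transpose_diff conj_transpose_scaleR r_herm)

lemma t_eq: "t j = - (A ** r (j + 1) ** A)" by (simp add: S_transform_def)

text \<open>The blocks of the second matrix of s are \<open>u (a + b + 1)\<close>. The triangular
  Toeplitz factor built from r and A turns them into - A r_(j+k+1) A, which is the term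
  t_(j+k).\<close>

lemma hankel_t:
  assumes "2 * p + 1 \<le> m" and L: "block_nonneg_herm p (\<lambda>j k. - (\<alpha> *\<^sub>R hankel s j k) + hankel_shift s j k)"
  shows "block_nonneg_herm p (hankel t)"
proof (rule block_nonneg_herm_congruence[OF L, where W = "\<lambda>j a. if a \<le> j then r (j - a) ** A else 0"])
  fix j k assume jk: "j \<le> p" "k \<le> p"
  have z: "0 ** Y = 0" "Y ** 0 = 0" for Y :: "complex^'q^'q"
    by (simp_all add: matrix_matrix_mult_def vec_eq_iff)
  have "hankel t j k = A ** (\<Sum>a=0..j. \<Sum>b=0..k. r (j - a) ** u (a + b + 1) ** r (k - b)) ** A"
    using jk assms(1)
    by (subst hankel_congruence_shift[where M = m and P = P])
      (auto simp: conv_u_r conv_r_u P_r hankel_def t_eq matrix_mult_minus_left matrix_mult_minus_right)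
  also have "\<dots> = (\<Sum>a=0..j. \<Sum>b=0..k. A ** r (j - a) ** u (a + b + 1) ** (r (k - b) ** A))"
    by (simp add: matrix_mult_sum_right matrix_mult_sum_left matrix_mul_assoc)
  also have "\<dots> = (\<Sum>a\<le>p. if a \<le> j then \<Sum>b\<le>p. if b \<le> k then A ** r (j - a) ** u (a + b + 1) ** (r (k - b) ** A) else 0 else 0)"
    using jk by (simp add: sum_if_le)
  also have "\<dots> = (\<Sum>a\<le>p. \<Sum>b\<le>p. conj_transpose (if a \<le> j then r (j - a) ** A else 0) **
        (- (\<alpha> *\<^sub>R hankel s a b) + hankel_shift s a b) ** (if b \<le> k then r (k - b) ** A else 0))"
    using jk assms(1)
    by (intro sum.cong refl)
      (auto simp: z conj_transpose_mult r_herm A_herm hankel_def hankel_shift_def shifted_seq_def intro!: sum.cong)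
  finally show "hankel t j k = \<dots>" .
qed

text \<open>The roles of the two matrices are exchanged: the unshifted Hankel matrix of s, with
  \<rho> as reciprocal, produces the shifted matrix of t. Only rows and columns 1, ..., p + 1 of the
  transformed matrix are kept, which is why s enters with index p + 1 and t with index p.\<close>

lemma shifted_hankel_t:
  assumes "2 * p + 2 \<le> m" and H: "block_nonneg_herm (p + 1) (hankel s)"
  shows "block_nonneg_herm p (\<lambda>j k. - (\<alpha> *\<^sub>R hankel t j k) + hankel_shift t j k)"
proof (rule block_nonneg_herm_congruence[OF H, where W = "\<lambda>j a. if a \<le> j + 1 then \<rho> (j + 1 - a) ** A else 0"])
  fix j k assume jk: "j \<le> p" "k \<le> p"
  have z: "0 ** Y = 0" "Y ** 0 = 0" for Y :: "complex^'q^'q"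
    by (simp_all add: matrix_matrix_mult_def vec_eq_iff)
  have "- (\<alpha> *\<^sub>R hankel t j k) + hankel_shift t j k = - (A ** \<rho> (j + k + 2) ** A)"
    by (simp add: hankel_def hankel_shift_def t_eq \<rho>_def delay_def matrix_mult_diff_right matrix_mult_diff_left
        matrix_mult_scaleR_right matrix_mult_scaleR_left)
  also have "\<dots> = A ** (\<Sum>a=0..j+1. \<Sum>b=0..k+1. \<rho> (j + 1 - a) ** s (a + b) ** \<rho> (k + 1 - b)) ** A"
    using jk assms(1)
    by (subst hankel_congruence[where M = m and P = P])
      (auto simp: conv_u_r conv_r_u conv_s_\<rho> conv_\<rho>_s P_\<rho> matrix_mult_minus_left matrix_mult_minus_right)
  also have "\<dots> = (\<Sum>a=0..j+1. \<Sum>b=0..k+1. A ** \<rho> (j + 1 - a) ** s (a + b) ** (\<rho> (k + 1 - b) ** A))"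
    by (simp add: matrix_mult_sum_right matrix_mult_sum_left matrix_mul_assoc del: sum.cl_ivl_Suc)
  also have "\<dots> = (\<Sum>a\<le>p+1. if a \<le> j + 1 then \<Sum>b\<le>p+1. if b \<le> k + 1 then A ** \<rho> (j + 1 - a) ** s (a + b) ** (\<rho> (k + 1 - b) ** A) else 0 else 0)"
    using jk by (simp only: sum_if_le add_le_mono1)
  also have "\<dots> = (\<Sum>a\<le>p+1. \<Sum>b\<le>p+1. conj_transpose (if a \<le> j + 1 then \<rho> (j + 1 - a) ** A else 0) **
        hankel s a b ** (if b \<le> k + 1 then \<rho> (k + 1 - b) ** A else 0))"
    using jk assms(1)
    by (intro sum.cong refl)
      (auto simp: z conj_transpose_mult \<rho>_herm A_herm hankel_def simp del: sum.atMost_Suc intro!: sum.cong)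
  finally show "- (\<alpha> *\<^sub>R hankel t j k) + hankel_shift t j k = \<dots>" .
qed

text \<open>Each positivity condition for t comes from the opposite condition for s. The rest is
  parity bookkeeping: (m - 1) div 2 is the index of the second matrix of s and of the first matrix
  of t.\<close>

lemma S_transform_K_class:
  assumes "m \<ge> 1" "s \<in> K_class m \<alpha>"
  shows "t \<in> K_class (m - 1) \<alpha>"
proof -
  define n where "n = m div 2"
  define n' where "n' = (if even m then n - 1 else n)"
  have H: "block_nonneg_herm n (hankel s)"
    and L: "block_nonneg_herm n' (\<lambda>j k. - (\<alpha> *\<^sub>R hankel s j k) + hankel_shift s j k)"
    using assms by (auto simp: K_class_def n_def n'_def Let_def)
  have n': "2 * n' + 1 \<le> m" "n' = (m - 1) div 2" using assms(1)
    by (auto simp: n'_def n_def elim!: evenE oddE)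
  note H' = hankel_t[OF n'(1) L]
  show ?thesis
  proof (cases "m = 1")
    case True
    then show ?thesis using block_nonneg_herm_diag[OF H', of 0]
      by (simp add: K_class_def hankel_def)
  next
    case False
    define q where "q = (if even (m - 1) then (m - 1) div 2 - 1 else (m - 1) div 2)"
    have q: "2 * q + 2 \<le> m" "n = q + 1" using assms(1) False
      by (auto simp: q_def n_def elim!: evenE oddE)
    then have "block_nonneg_herm q (\<lambda>j k. - (\<alpha> *\<^sub>R hankel t j k) + hankel_shift t j k)"
      using shifted_hankel_t H by simp
    then show ?thesis using H' n' assms(1) False
      by (auto simp: K_class_def q_def Let_def split: if_splits)
  qed
qed

end

section \<open>Null spaces of the terms and domination by the first term\<close>

lemma matrix_mult_zero: "0 ** X = (0 :: complex^'p^'n)" "(Y :: complex^'m^'n) ** 0 = (0 :: complex^'p^'n)"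
  by (simp_all add: matrix_matrix_mult_def vec_eq_iff)

lemma block_nonneg_herm_diag_congruence:
  fixes D :: "nat \<Rightarrow> complex^'n^'n"
  assumes "block_nonneg_herm N B"
    and "\<And>j k. j \<le> N \<Longrightarrow> k \<le> N \<Longrightarrow> C j k = conj_transpose (D j) ** B j k ** D k"
  shows "block_nonneg_herm N C"
proof (rule block_nonneg_herm_congruence[OF assms(1), where W = "\<lambda>j a. if a = j then D j else 0"])
  fix j k assume jk: "j \<le> N" "k \<le> N"
  have "(\<Sum>a\<le>N. \<Sum>b\<le>N. conj_transpose (if a = j then D j else 0) ** B a b ** (if b = k then D k else 0))
    = (\<Sum>a\<le>N. if a = j then \<Sum>b\<le>N. if b = k then conj_transpose (D j) ** B a b ** D k else 0 else 0)"
    by (intro sum.cong refl) (simp add: matrix_mult_zero if_distrib cong: if_cong)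
  also have "\<dots> = C j k" using jk assms(2)[OF jk] by simp
  finally show "C j k = (\<Sum>a\<le>N. \<Sum>b\<le>N. conj_transpose (if a = j then D j else 0) ** B a b ** (if b = k then D k else 0))"
    by simp
qed

lemma block_nonneg_herm_nul:
  assumes B: "block_nonneg_herm N B" and ij: "i \<le> N" "j \<le> N" and 0: "B i i *v x = 0"
  shows "B j i *v x = 0"
proof (cases "i = j")
  case False
  show ?thesis
  proof (rule qf_eq_0_imp_block_eq_0[where A = "B i i" and B = "B i j" and D = "B j j"])
    fix y
    define w where "w l = (if l = i then x else if l = j then y else 0)" for l
    have "(\<Sum>a\<le>N. \<Sum>b\<le>N. cdot (w a) (B a b *v w b)) = (\<Sum>a\<in>{i,j}. \<Sum>b\<le>N. cdot (w a) (B a b *v w b))"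
      using ij by (intro sum.mono_neutral_right) (auto simp: w_def)
    also have "\<dots> = (\<Sum>a\<in>{i,j}. \<Sum>b\<in>{i,j}. cdot (w a) (B a b *v w b))"
      using ij by (intro sum.cong refl sum.mono_neutral_right) (auto simp: w_def)
    also have "\<dots> = qf (B i i) x + cdot x (B i j *v y) + cdot y (B j i *v x) + qf (B j j) y"
      using False by (simp add: w_def)
    finally have *: "(\<Sum>a\<le>N. \<Sum>b\<le>N. cdot (w a) (B a b *v w b)) = \<dots>" .
    have "(\<Sum>a\<le>N. \<Sum>b\<le>N. cdot (w a) (B a b *v w b)) \<in> \<real>\<^sub>\<ge>\<^sub>0"
      using B by (simp add: block_nonneg_herm_def)
    then show "0 \<le> Re (qf (B i i) x + cdot x (B i j *v y) + cdot y (B j i *v x) + qf (B j j) y)"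
      unfolding * by (simp add: complex_nonneg_Reals_iff)
  qed (use B ij 0 in \<open>auto simp: block_nonneg_herm_def\<close>)
qed (use 0 in auto)

lemma K_class_blocks:
  assumes "s \<in> K_class m \<alpha>" "m \<ge> 1"
  shows "block_nonneg_herm (m div 2) (hankel s)"
    and "block_nonneg_herm ((m - 1) div 2) (\<lambda>j k. - (\<alpha> *\<^sub>R hankel s j k) + hankel_shift s j k)"
proof -
  have "(m - 1) div 2 = (if even m then m div 2 - 1 else m div 2)"
  proof (cases "even m")
    case True
    then obtain k where "m = 2 * k" by (rule evenE)
    then show ?thesis using assms(2) by (cases k) auto
  next
    case False
    then obtain k where "m = 2 * k + 1" by (rule oddE)
    then show ?thesis by simp
  qed
  then show "block_nonneg_herm (m div 2) (hankel s)"
    "block_nonneg_herm ((m - 1) div 2) (\<lambda>j k. - (\<alpha> *\<^sub>R hankel s j k) + hankel_shift s j k)"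
    using assms by (auto simp: K_class_def Let_def)
qed

text \<open>A vector killed by a diagonal block is killed by its whole block column, so it suffices
  to find t_j in a column whose diagonal block is already known to kill x. The last term t_n is out
  of reach, since it enters only the corner diagonal block of one matrix.\<close>

lemma K_class_nul:
  assumes t: "t \<in> K_class n \<alpha>" and "n \<ge> 1" and 0: "t 0 *v x = 0" and "j < n"
  shows "t j *v x = 0"
  using \<open>j < n\<close>
proof (induction j rule: less_induct)
  case (less j)
  note H = K_class_blocks(1)[OF t \<open>n \<ge> 1\<close>] and L = K_class_blocks(2)[OF t \<open>n \<ge> 1\<close>]
  consider "j = 0" | "j \<ge> 1" "j - (j - 1) div 2 \<le> n div 2" | "j \<ge> 1" "j - (j - 1) div 2 > n div 2"
    by (metis One_nat_def Suc_leI neq0_conv not_le)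
  then show ?case
  proof cases
    case 2
    \<comment> \<open>The largest l with 2 l < j: the diagonal block t_(2 l) of column l is covered
      by the induction hypothesis, and the row k = j - l is as small as possible.\<close>
    define l where "l = (j - 1) div 2"
    define k where "k = j - l"
    have "2 * l \<le> j - 1" by (simp add: l_def)
    then have l: "2 * l < j" "l + k = j" using 2(1) by (auto simp: k_def)
    have k: "k \<le> n div 2" using 2(2) by (simp add: k_def l_def)
    have "l \<le> k" using l by linarith
    then have "l \<le> n div 2" using k by (rule order_trans)
    moreover have "hankel t l l *v x = 0"
      using less.IH[of "2 * l"] less.prems l(1) by (simp add: hankel_def mult_2)
    ultimately have "hankel t k l *v x = 0"
      using k by (rule_tac block_nonneg_herm_nul[OF H])
    then show ?thesis using l(2) by (simp add: hankel_def add.commute)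
  next
    case 3
    \<comment> \<open>The row k is too large only for j = 2 N and n = 2 N + 1. Then t_j is found in
      row N and column N - 1 of the second matrix, up to a multiple of t_(j-1), which kills x
      already.\<close>
    define N where "N = n div 2"
    define l where "l = (j - 1) div 2"
    have "n \<le> 2 * N + 1" by (simp add: N_def)
    moreover have "j - 1 \<le> 2 * l + 1" by (simp add: l_def)
    moreover have "N < j - l" using 3(2) by (simp add: N_def l_def)
    ultimately have j: "j = 2 * N" "N \<ge> 1" "n = 2 * N + 1"
      using 3(1) less.prems by linarith+
    have "(- (\<alpha> *\<^sub>R hankel t (N - 1) (N - 1)) + hankel_shift t (N - 1) (N - 1)) *v x = 0"
      using less j by (simp add: hankel_def hankel_shift_def scaleR_mat_vec minus_mat_vec matrix_vector_mult_add_rdistrib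
          matrix_vector_mult_diff_rdistrib)
    then have "(- (\<alpha> *\<^sub>R hankel t N (N - 1)) + hankel_shift t N (N - 1)) *v x = 0"
      by (rule_tac block_nonneg_herm_nul[OF L]) (use j in auto)
    then show ?thesis
      using less.IH[of "j - 1"] j
      by (simp add: hankel_def hankel_shift_def scaleR_mat_vec matrix_vector_mult_diff_rdistrib mult_2)
  qed (use 0 in simp)
qed

lemma hermitian_mult_mp_inverse:
  assumes "conj_transpose A = A"
  shows "A ** (A ** mp_inverse A) = A"
  using mp_inverse_hermitian(1,4)[OF assms] by (metis matrix_mul_assoc)

text \<open>The last block is replaced by its generalized Schur complement with respect to the null
  space of \<open>A\<close>, which is the least change that makes the null space of \<open>A\<close> disappear from it.\<close>
lemma shorted_block:
  fixes A N :: "complex^'n^'n"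
  assumes A: "conj_transpose A = A" and N: "nonneg_herm N"
  obtains Y where "nonneg_herm (N - Y)" "nonneg_herm Y" "\<And>x. A *v x = 0 \<Longrightarrow> Y *v x = N *v x"
    "\<And>K B. block_nonneg_herm K B \<Longrightarrow> B K K = N \<Longrightarrow>
      (\<And>j x. j < K \<Longrightarrow> A *v x = 0 \<Longrightarrow> B j K *v x = 0) \<Longrightarrow>
      block_nonneg_herm K (\<lambda>j k. if j = K \<and> k = K then N - Y else B j k)"
proof -
  let ?I = "mat 1 :: complex^'n^'n"
  have I: "conj_transpose ?I = ?I" by (simp add: conj_transpose_def mat_def vec_eq_iff)
  \<comment> \<open>The orthogonal projection onto the null space of A.\<close>
  define Q where "Q = ?I - A ** mp_inverse A"
  note XA = mp_inverse_hermitian[OF A]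
  have Q: "conj_transpose Q = Q" "A ** Q = 0"
    by (simp_all add: Q_def conj_transpose_diff I XA(5) matrix_mult_diff_right
        hermitian_mult_mp_inverse A)
  have QQ: "Q ** Q = Q"
  proof -
    have "Q ** Q = Q - mp_inverse A ** (A ** Q)"
      by (subst (1) Q_def) (simp add: matrix_mult_diff_left XA(4) matrix_mul_assoc)
    then show ?thesis by (simp add: Q(2) matrix_mult_zero)
  qed
  have Qx: "Q *v x = x" if "A *v x = 0" for x
    using that by (simp add: Q_def XA(4)[symmetric] matrix_vector_mult_diff_rdistrib flip: matrix_vector_mul_assoc)
  note Nh = nonneg_hermD(1)[OF N]
  \<comment> \<open>d is the compression of N to the null space of A, and e will be its generalized
    inverse, which lives on the same space. The part to be removed is N e N.\<close>
  define d where "d = Q ** N ** Q"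
  have d: "nonneg_herm d"
  proof -
    have "qf d x = qf N (Q *v x)" for x
      by (metis Q(1) cdot_adjoint d_def matrix_vector_mul_assoc)
    then show ?thesis using N by (simp add: nonneg_herm_iff)
  qed
  define e where "e = mp_inverse d"
  note de = mp_inverse_hermitian[OF nonneg_hermD(1)[OF d], folded e_def]
  have e: "nonneg_herm e" using nonneg_herm_mp_inverse[OF d] by (simp add: e_def)
  have Qe: "Q ** e = e"
  proof -
    have "e = d ** e ** e" using de(2,4) by simp
    moreover have "Q ** d = d" by (simp add: d_def QQ matrix_mul_assoc)
    ultimately show ?thesis by (metis matrix_mul_assoc)
  qed
  have eQ: "e ** Q = e" using Qe Q(1) de(3) by (metis conj_transpose_mult)
  have eNe: "e ** N ** e = e"
  proof -
    have "e ** N ** e = e ** (Q ** N ** Q) ** e"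
      using Qe eQ by (metis matrix_mul_assoc)
    then show ?thesis using de(2) by (simp add: d_def)
  qed
  define Y where "Y = N ** e ** N"
  have qY: "qf Y x = qf e (N *v x)" for x
    by (metis Nh Y_def cdot_adjoint matrix_vector_mul_assoc)
  have Y: "nonneg_herm Y" using e by (simp add: nonneg_herm_iff qY)
  \<comment> \<open>Because e N e = e, the matrix I - e N is a projection and N - Y is the
    congruence of N by it. This gives N - Y \<ge> 0 as well as the statement on block
    matrices.\<close>
  have NY: "N - Y = (?I - N ** e) ** N ** (?I - e ** N)"
  proof -
    have "N ** e ** N ** e ** N = Y" using eNe by (metis Y_def matrix_mul_assoc)
    then show ?thesis
      by (simp add: matrix_mult_diff_left matrix_mult_diff_right matrix_mul_assoc flip: Y_def)
  qed
  have adj: "conj_transpose (?I - e ** N) = ?I - N ** e"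
    by (simp add: conj_transpose_diff conj_transpose_mult I de(3) Nh)
  show thesis
  proof
    have "qf (N - Y) x = qf N ((?I - e ** N) *v x)" for x
      by (metis NY adj cdot_adjoint conj_transpose_invol matrix_vector_mul_assoc)
    then show "nonneg_herm (N - Y)" using N by (simp add: nonneg_herm_iff)
    show "nonneg_herm Y" by (rule Y)
    have NQ: "N ** Q = Y ** Q"
    proof -
      \<comment> \<open>Vectors w in the range of Q - e d are fixed by Q and killed by d, so the
        form of N vanishes at w, whence N w = 0.\<close>
      have "N ** (Q - e ** d) = 0"
        unfolding matrix_eq
      proof
        fix v
        define w where "w = (Q - e ** d) *v v"
        have "Q *v w = w"
          by (simp add: w_def matrix_vector_mul_assoc matrix_mult_diff_right QQ matrix_mul_assoc Qe)
        moreover have "d *v w = 0"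
        proof -
          have "d ** Q = d" by (simp add: d_def QQ flip: matrix_mul_assoc)
          moreover have "d ** (e ** d) = d" using de(1) by (simp add: matrix_mul_assoc)
          ultimately show ?thesis by (simp add: w_def matrix_vector_mul_assoc matrix_mult_diff_right)
        qed
        ultimately have "qf N w = 0"
          by (metis Q(1) cdot_adjoint cdot_zero(2) d_def matrix_vector_mul_assoc)
        then have "N *v w = 0" by (rule nonneg_herm_qf_eq_0[OF N])
        then show "N ** (Q - e ** d) *v v = 0 *v v" by (simp add: w_def matrix_vector_mul_assoc)
      qed
      then have "N ** Q = N ** (e ** Q) ** N ** Q" by (simp add: matrix_mult_diff_right d_def matrix_mul_assoc)
      then show ?thesis by (simp add: eQ Y_def)
    qed
    show "Y *v x = N *v x" if "A *v x = 0" for x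
      using Qx[OF that] NQ by (metis matrix_vector_mul_assoc)
    fix K B assume B: "block_nonneg_herm K B" "B K K = N"
      and nul: "\<And>j x. j < K \<Longrightarrow> A *v x = 0 \<Longrightarrow> B j K *v x = 0"
    \<comment> \<open>The range of e lies in the null space of A, so a congruence by I - e N in the
      last place leaves the off-diagonal blocks of the last row and column unchanged.\<close>
    have BQ: "B j K ** e = 0" if "j < K" for j
    proof -
      have "B j K ** Q = 0" unfolding matrix_eq
        using nul[OF that] Q(2) by (metis matrix_vector_mul_assoc matrix_vector_mult_0)
      then show ?thesis using Qe by (metis matrix_mul_assoc matrix_mult_zero(1))
    qed
    have eB: "e ** B K j = 0" if "j < K" for j
    proof -
      have "conj_transpose (B j K ** e) = 0" using BQ[OF that] by simp
      then show ?thesis using B(1) that de(3) by (simp add: block_nonneg_herm_def conj_transpose_mult)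
    qed
    show "block_nonneg_herm K (\<lambda>j k. if j = K \<and> k = K then N - Y else B j k)"
    proof (rule block_nonneg_herm_diag_congruence[OF B(1), where D = "\<lambda>j. if j = K then ?I - e ** N else ?I"])
      fix j k assume "j \<le> K" "k \<le> K"
      then consider "j = K" "k = K" | "j < K" "k = K" | "j = K" "k < K" | "j < K" "k < K" by linarith
      then show "(if j = K \<and> k = K then N - Y else B j k) =
           conj_transpose (if j = K then ?I - e ** N else ?I) ** B j k ** (if k = K then ?I - e ** N else ?I)"
      proof cases
        case 1
        then show ?thesis by (simp add: NY adj B(2))
      next
        case 2
        then show ?thesis using BQ[of j] by (simp add: I matrix_mult_diff_right matrix_mul_assoc matrix_mult_zero)
      next
        case 3
        then show ?thesis using eB[of k] by (simp add: adj matrix_mult_diff_left matrix_mult_zero flip: matrix_mul_assoc)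
      next
        case 4
        then show ?thesis by (simp add: I)
      qed
    qed
  qed
qed

text \<open>The last term enters exactly one of the two Hankel matrices, and there only the corner.
  Lowering it by the matrix Y of \<open>shorted_block\<close> makes the corner vanish on the null
  space of t_0 and keeps the whole matrix nonnegative.\<close>

lemma K_class_dominated_modification:
  assumes t: "t \<in> K_class n \<alpha>" and n: "n \<ge> 1"
  obtains t' where "t' \<in> K_class n \<alpha>" "t' \<in> D_class n" "\<And>j. j < n \<Longrightarrow> t' j = t j"
    "nonneg_herm (t n - t' n)"
proof -
  note H = K_class_blocks(1)[OF t n] and L = K_class_blocks(2)[OF t n]
  note herm = K_class_hermitian[OF t]
  note nul = K_class_nul[OF t n]
  define N where "N = (if even n then t n else t n - \<alpha> *\<^sub>R t (n - 1))"
  have N: "nonneg_herm N"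
  proof (cases "even n")
    case True
    then show ?thesis using block_nonneg_herm_diag[OF H, of "n div 2"]
      by (simp add: N_def hankel_def flip: mult_2)
  next
    case False
    then obtain k where "n = 2 * k + 1" by (auto elim: oddE)
    then show ?thesis using block_nonneg_herm_diag[OF L, of k]
      by (simp add: N_def hankel_def hankel_shift_def flip: mult_2)
  qed
  obtain Y where Y: "nonneg_herm (N - Y)" "nonneg_herm Y" "\<And>x. t 0 *v x = 0 \<Longrightarrow> Y *v x = N *v x"
    "\<And>K B. block_nonneg_herm K B \<Longrightarrow> B K K = N \<Longrightarrow>
      (\<And>j x. j < K \<Longrightarrow> t 0 *v x = 0 \<Longrightarrow> B j K *v x = 0) \<Longrightarrow>
      block_nonneg_herm K (\<lambda>j k. if j = K \<and> k = K then N - Y else B j k)"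
    using shorted_block[OF herm N, of 0] by blast
  define t' where "t' = t(n := t n - Y)"
  have t'_less: "t' j = t j" if "j < n" for j using that by (simp add: t'_def)
  have t'_herm: "conj_transpose (t' j) = t' j" if "j \<le> n" for j
    using herm[OF that] herm[of n] nonneg_hermD(1)[OF Y(2)] by (simp add: t'_def conj_transpose_diff)
  have t'_nul: "t' j *v x = 0" if "t 0 *v x = 0" "j \<le> n" for j x
  proof (cases "j = n")
    case True
    have "t (n - 1) *v x = 0" by (rule nul[OF that(1)]) (use n in simp)
    then have "t n *v x = N *v x"
      by (simp add: N_def matrix_vector_mult_diff_rdistrib scaleR_mat_vec)
    then show ?thesis using True Y(3)[OF that(1)]
      by (simp add: t'_def matrix_vector_mult_diff_rdistrib)
  next
    case False
    then show ?thesis using nul[OF that(1), of j] that(2) by (simp add: t'_def)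
  qed
  show thesis
  proof
    show "t' j = t j" if "j < n" for j by (rule t'_less[OF that])
    show "nonneg_herm (t n - t' n)" using Y(2) by (simp add: t'_def)
    show "t' \<in> D_class n"
    proof -
      note X = mp_inverse_hermitian[OF herm[OF le0]]
      have t0: "t' 0 = t 0" using n t'_less by simp
      have "t' j *v x \<in> col_space (t 0)" if "j \<le> n" for j x
      proof -
        let ?P = "t 0 ** mp_inverse (t 0)"
        \<comment> \<open>For Hermitian terms the null space inclusion, in the form t'_j (I - P) =
          0, becomes the range inclusion P t'_j = t'_j by taking adjoints.\<close>
        have "t' j ** (mat 1 - ?P) = 0"
          unfolding matrix_eq
        proof
          fix x
          have "t 0 *v ((mat 1 - ?P) *v x) = 0"
            by (simp add: matrix_vector_mul_assoc matrix_mult_diff_right hermitian_mult_mp_inverse herm)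
          then show "t' j ** (mat 1 - ?P) *v x = 0 *v x"
            using t'_nul[OF _ that] by (simp flip: matrix_vector_mul_assoc)
        qed
        then have "t' j ** ?P = t' j" by (simp add: matrix_mult_diff_right)
        then have "?P ** t' j = t' j" using t'_herm[OF that] X(5) by (metis conj_transpose_mult)
        then show ?thesis unfolding col_space_def by (metis matrix_vector_mul_assoc rangeI)
      qed
      then show ?thesis using t'_nul unfolding D_class_def mem_Collect_eq t0
        by (auto simp: nul_space_def col_space_def)
    qed
    show "t' \<in> K_class n \<alpha>"
    proof (cases "even n")
      case True
      define K where "K = n div 2"
      have K: "n = 2 * K" "K \<ge> 1" using True n by (auto simp: K_def)
      then have h: "(n - 1) div 2 = K - 1" by (cases K) auto
      have "block_nonneg_herm K (\<lambda>j k. if j = K \<and> k = K then N - Y else hankel t j k)"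
      proof (rule Y(4))
        show "block_nonneg_herm K (hankel t)" using H by (simp add: K_def)
      qed (use K nul True in \<open>auto simp: hankel_def N_def mult_2\<close>)
      also have "?this \<longleftrightarrow> block_nonneg_herm K (hankel t')"
        using K True by (intro block_nonneg_herm_cong) (auto simp: hankel_def t'_def N_def)
      finally have "block_nonneg_herm K (hankel t')" .
      moreover have "block_nonneg_herm (K - 1) (\<lambda>j k. - (\<alpha> *\<^sub>R hankel t' j k) + hankel_shift t' j k)"
        using L K h by (subst block_nonneg_herm_cong[where C = "\<lambda>j k. - (\<alpha> *\<^sub>R hankel t j k) + hankel_shift t j k"])
          (auto simp: hankel_def hankel_shift_def t'_def)
      ultimately show ?thesis using K True by (simp add: K_class_def)
    next
      case False
      define K where "K = n div 2"
      have K: "n = 2 * K + 1" using False by (auto simp: K_def)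
      have "block_nonneg_herm K (\<lambda>j k. if j = K \<and> k = K then N - Y else - (\<alpha> *\<^sub>R hankel t j k) + hankel_shift t j k)"
        using L K nul False
        by (intro Y(4)) (auto simp: hankel_def hankel_shift_def N_def mult_2 matrix_vector_mult_diff_rdistrib scaleR_mat_vec)
      also have "?this \<longleftrightarrow> block_nonneg_herm K (\<lambda>j k. - (\<alpha> *\<^sub>R hankel t' j k) + hankel_shift t' j k)"
        using K False by (intro block_nonneg_herm_cong) (auto simp: hankel_def hankel_shift_def t'_def N_def mult_2)
      finally have "block_nonneg_herm K (\<lambda>j k. - (\<alpha> *\<^sub>R hankel t' j k) + hankel_shift t' j k)" .
      moreover have "block_nonneg_herm K (hankel t')"
        using H K by (subst block_nonneg_herm_cong[where C = "hankel t"]) (auto simp: hankel_def t'_def)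
      ultimately show ?thesis using K False by (simp add: K_class_def)
    qed
  qed
qed

section \<open>Herglotz representation on the disk\<close>

text \<open>The circle is parametrized by the real line so that boundary measures become measures on
  the reals, where tightness and weak convergence are available.\<close>

definition circ :: "real \<Rightarrow> complex" where
  "circ t = exp (2 * of_real pi * \<i> * of_real t)"

lemma norm_circ [simp]: "norm (circ t) = 1"
  by (simp add: circ_def norm_exp_eq_Re)

lemma circ_nonzero [simp]: "circ t \<noteq> 0"
  by (simp add: circ_def)

lemma cnj_circ: "cnj (circ t) = inverse (circ t)"
  by (simp add: circ_def exp_cnj flip: exp_minus)

lemma continuous_circ: "continuous_on S circ"
  unfolding circ_def by (intro continuous_intros)

lemma isCont_circ: "isCont circ t"
  unfolding circ_def by (intro continuous_intros)

lemma Cauchy_circ: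
  assumes "continuous_on (cball 0 1) h" "h holomorphic_on ball 0 1" "norm z < 1"
  shows "((\<lambda>t. h (circ t) * (circ t / (circ t - z))) has_integral h z) {0..1}"
proof -
  have "((\<lambda>u. h u/(u - z)) has_contour_integral (2 * of_real pi * \<i> * h z)) (circlepath 0 1)"
    using assms by (intro Cauchy_integral_circlepath) auto
  then have "((\<lambda>t. h (circ t) / (circ t - z) * (2 * of_real pi * \<i> * circ t)) has_integral
      (2 * of_real pi * \<i> * h z)) {0..1}"
    unfolding has_contour_integral_def
    by (rule has_integral_eq[rotated])
      (simp add: vector_derivative_circlepath01, simp add: circlepath circ_def)
  then have "((\<lambda>t. 1 / (2 * of_real pi * \<i>) * (h (circ t) / (circ t - z) * (2 * of_real pi * \<i> * circ t))) has_integral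
      1 / (2 * of_real pi * \<i>) * (2 * of_real pi * \<i> * h z)) {0..1}"
    by (rule has_integral_mult_right)
  then show ?thesis by (simp add: mult_ac)
qed

lemma circ_neq: "norm z < 1 \<Longrightarrow> circ t \<noteq> z"
  using norm_circ[of t] by auto

text \<open>Two Cauchy integrals are added, one for h and one for the conjugate of its boundary
  values; the second contributes only conj(h(0)). Subtracting the mean of Re h turns the kernel into
  2 circ / (circ - z) - 1, the Herglotz kernel.\<close>

lemma Schwarz_formula:
  assumes h: "continuous_on (cball 0 1) h" "h holomorphic_on ball 0 1" and z: "norm z < 1"
  shows "((\<lambda>t. of_real (Re (h (circ t))) * ((circ t + z) / (circ t - z))) has_integral
      h z - \<i> * of_real (Im (h 0))) {0..1}"
proof -
  have I1: "((\<lambda>t. h (circ t) * (circ t / (circ t - z))) has_integral h z) {0..1}"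
    by (rule Cauchy_circ[OF h z])
  have ne: "1 - cnj z * w \<noteq> 0" if "w \<in> cball 0 1" for w
  proof
    assume "1 - cnj z * w = 0"
    then have "1 = norm (cnj z * w)" by simp
    also have "\<dots> \<le> norm z * 1" unfolding norm_mult using that by (intro mult_mono) auto
    finally show False using z by simp
  qed
  \<comment> \<open>On the circle the conjugate of 1 / (1 - conj(z) circ) is circ / (circ - z). So
    the conjugated boundary values are handled by Cauchy's formula at 0 for the holomorphic function
    h(w) / (1 - conj(z) w).\<close>
  have I2: "((\<lambda>t. h (circ t) / (1 - cnj z * circ t) * (circ t / (circ t - 0))) has_integral h 0 / (1 - cnj z * 0)) {0..1}"
    using h ne by (intro Cauchy_circ) (auto intro!: continuous_intros holomorphic_intros)
  have I2': "((\<lambda>t. cnj (h (circ t)) * (circ t / (circ t - z))) has_integral cnj (h 0)) {0..1}"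
  proof -
    have "((\<lambda>t. cnj (h (circ t) / (1 - cnj z * circ t) * (circ t / (circ t - 0)))) has_integral cnj (h 0 / (1 - cnj z * 0))) {0..1}"
      by (rule has_integral_linear[OF I2 bounded_linear_cnj, unfolded o_def])
    moreover have "cnj (h (circ t) / (1 - cnj z * circ t) * (circ t / (circ t - 0)))
      = cnj (h (circ t)) * (circ t / (circ t - z))" for t
      using circ_neq[OF z, of t] by (simp add: cnj_circ field_simps)
    ultimately show ?thesis by simp
  qed
  have I3: "((\<lambda>t. h (circ t) * (circ t / (circ t - 0))) has_integral h 0) {0..1}"
    by (rule Cauchy_circ[OF h]) auto
  then have I3': "((\<lambda>t. h (circ t)) has_integral h 0) {0..1}" by simp
  then have I4: "((\<lambda>t. cnj (h (circ t))) has_integral cnj (h 0)) {0..1}"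
    by (rule has_integral_linear[OF _ bounded_linear_cnj, unfolded o_def])
  have "((\<lambda>t. h (circ t) * (circ t / (circ t - z)) + cnj (h (circ t)) * (circ t / (circ t - z))
      - (1/2) * (h (circ t) + cnj (h (circ t)))) has_integral
      h z + cnj (h 0) - (1/2) * (h 0 + cnj (h 0))) {0..1}"
    by (intro has_integral_diff has_integral_add I1 I2' has_integral_mult_right I3' I4)
  moreover have "h z + cnj (h 0) - (1/2) * (h 0 + cnj (h 0)) = h z - \<i> * of_real (Im (h 0))"
    by (simp add: complex_eq_iff)
  moreover have "h (circ t) * (circ t / (circ t - z)) + cnj (h (circ t)) * (circ t / (circ t - z))
      - (1/2) * (h (circ t) + cnj (h (circ t))) = of_real (Re (h (circ t))) * ((circ t + z) / (circ t - z))" for t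
  proof -
    have "(circ t + z) / (circ t - z) = 2 * (circ t / (circ t - z)) - 1"
      using circ_neq[OF z, of t] by (simp add: field_simps)
    moreover have "of_real (Re (h (circ t))) = (1/2) * (h (circ t) + cnj (h (circ t)))"
      by (simp add: complex_add_cnj)
    ultimately show ?thesis by (simp only:) (simp add: algebra_simps)
  qed
  ultimately show ?thesis by (simp only:)
qed

lemma norm_Herglotz_kernel_le:
  assumes "norm z < 1"
  shows "norm ((circ t + z) / (circ t - z)) \<le> 2 / (1 - norm z)"
proof -
  have "norm (circ t + z) \<le> 2" using norm_triangle_ineq[of "circ t" z] assms by simp
  moreover have "1 - norm z \<le> norm (circ t - z)" using norm_triangle_ineq2[of "circ t" z] by simp
  ultimately show ?thesis unfolding norm_divide using assms by (intro frac_le) auto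
qed

lemma isCont_Herglotz_kernel: "norm z < 1 \<Longrightarrow> isCont (\<lambda>t. (circ t + z) / (circ t - z)) t"
  using circ_neq[of z t] by (intro continuous_intros isCont_circ) auto

lemma Herglotz_kernel_measurable [measurable]:
  "norm z < 1 \<Longrightarrow> (\<lambda>t. (circ t + z) / (circ t - z)) \<in> borel_measurable borel"
  by (intro borel_measurable_continuous_onI continuous_at_imp_continuous_on ballI isCont_Herglotz_kernel)

text \<open>On circles of radius r_n < 1 the Schwarz formula holds with the density Re h_n \<ge> 0
  of total mass Re g(0). Normalized to probabilities on the unit interval these measures are tight;
  the kernel is bounded and continuous, so a weak limit along a subsequence represents g.\<close>

theorem Herglotz_representation:
  assumes g: "g holomorphic_on ball 0 1" and pos: "\<And>z. norm z < 1 \<Longrightarrow> 0 \<le> Re (g z)"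
  obtains \<nu> :: "real measure" where "finite_measure \<nu>" "sets \<nu> = sets borel"
    "\<And>z. norm z < 1 \<Longrightarrow> g z = \<i> * of_real (Im (g 0)) + (LINT t|\<nu>. (circ t + z) / (circ t - z))"
proof -
  define r where "r n = 1 - 1 / real (n + 2)" for n
  have r: "0 < r n" "r n < 1" for n by (auto simp: r_def field_simps)
  have r_lim: "r \<longlonglongrightarrow> 1" unfolding r_def by real_asymp
  define h where "h n w = g (of_real (r n) * w)" for n w
  have hol: "g holomorphic_on ball 0 1" by (rule g)
  have scale: "norm (of_real (r n) * w) < 1" if "norm w \<le> 1" for n and w :: complex
  proof -
    have "norm (of_real (r n) * w) = r n * norm w" using r[of n] by (simp add: norm_mult)
    also have "\<dots> \<le> r n * 1" using r[of n] that by (intro mult_left_mono) auto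
    finally show ?thesis using r[of n] by simp
  qed
  have hcont: "continuous_on (cball 0 1) (h n)" for n
    unfolding h_def
    by (rule continuous_on_compose2[OF holomorphic_on_imp_continuous_on[OF g]])
      (auto intro!: continuous_intros scale)
  have hhol: "h n holomorphic_on ball 0 1" for n
    unfolding h_def
    by (rule holomorphic_on_compose_gen[OF _ g, unfolded o_def])
      (auto intro!: holomorphic_intros scale)
  have h0: "h n 0 = g 0" for n by (simp add: h_def)
  have hpos: "0 \<le> Re (h n (circ t))" for n t
    unfolding h_def by (intro pos scale) simp
  have cont_Re: "continuous_on {0..1} (\<lambda>t. Re (h n (circ t)))" for n
    by (intro continuous_intros continuous_on_compose2[OF hcont] continuous_circ) auto
  have S: "((\<lambda>t. of_real (Re (h n (circ t))) * ((circ t + z) / (circ t - z))) has_integral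
      h n z - \<i> * of_real (Im (g 0))) {0..1}" if "norm z < 1" for n z
    using Schwarz_formula[OF hcont hhol that, of n] by (simp add: h0)
  have mass: "((\<lambda>t. Re (h n (circ t))) has_integral Re (g 0)) {0..1}" for n
    using has_integral_linear[OF S[of 0 n] bounded_linear_Re] by (simp add: o_def h0)
  have hlim: "(\<lambda>n. h n z) \<longlonglongrightarrow> g z" if "norm z < 1" for z
  proof -
    have "isCont g z" using holomorphic_on_imp_continuous_on[OF g] that
      by (simp add: continuous_on_eq_continuous_at)
    moreover have "(\<lambda>n. of_real (r n) * z) \<longlonglongrightarrow> 1 * z"
      using tendsto_of_real[OF r_lim, where 'a = complex] by (intro tendsto_intros) simp
    ultimately show ?thesis unfolding h_def by (intro isCont_tendsto_compose[of z g]) auto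
  qed
  show thesis
  proof (cases "Re (g 0) = 0")
    \<comment> \<open>With mass zero there is nothing to normalize; the kernel bound makes all
      integrals vanish and g is constant.\<close>
    case True
    have const: "g z = \<i> * of_real (Im (g 0))" if z: "norm z < 1" for z
    proof -
      have "h n z - \<i> * of_real (Im (g 0)) = 0" for n
      proof -
        let ?B = "2 / (1 - norm z)"
        have "norm (integral {0..1} (\<lambda>t. of_real (Re (h n (circ t))) * ((circ t + z) / (circ t - z))))
          \<le> integral {0..1} (\<lambda>t. Re (h n (circ t)) * ?B)"
        proof (rule integral_norm_bound_integral)
          show "(\<lambda>t. Re (h n (circ t)) * ?B) integrable_on {0..1}"
            using mass[of n] by (intro integrable_on_mult_left) auto
          show "norm (of_real (Re (h n (circ t))) * ((circ t + z) / (circ t - z))) \<le> Re (h n (circ t)) * ?B" for t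
            unfolding norm_mult using hpos[of n t] by (intro mult_mono norm_Herglotz_kernel_le z) auto
        qed (use S[OF z] in blast)
        also have "\<dots> = Re (g 0) * ?B" by (intro integral_unique has_integral_mult_left mass)
        also have "\<dots> = 0" using True by simp
        finally show ?thesis using S[OF z, of n] by (simp add: integral_unique)
      qed
      then have "(\<lambda>n. h n z) = (\<lambda>n. \<i> * of_real (Im (g 0)))" by auto
      then have "(\<lambda>n. h n z) \<longlonglongrightarrow> \<i> * of_real (Im (g 0))" by simp
      then show ?thesis by (rule LIMSEQ_unique[OF hlim[OF z]])
    qed
    show thesis
    proof (rule that[of "null_measure borel"])
      show "finite_measure (null_measure borel :: real measure)" by (rule finite_measureI) simp
      show "g z = \<i> * of_real (Im (g 0)) + (LINT t|null_measure borel. (circ t + z) / (circ t - z))"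
        if "norm z < 1" for z using const[OF that] by simp
    qed simp
  next
    case False
    define c where "c = Re (g 0)"
    have c: "c > 0" using False pos[of 0] by (simp add: c_def)
    define w where "w n t = indicator {0..1} t * Re (h n (circ t)) / c" for n and t :: real
    have w_nonneg: "0 \<le> w n t" for n t using hpos[of n t] c by (simp add: w_def)
    have w_meas [measurable]: "w n \<in> borel_measurable borel" for n
    proof -
      have "(\<lambda>t. indicator {0..1} t *\<^sub>R Re (h n (circ t))) \<in> borel_measurable borel"
        by (rule borel_measurable_continuous_on_indicator[OF _ cont_Re]) simp
      then show ?thesis unfolding w_def by simp
    qed
    define \<mu> where "\<mu> n = density lborel (\<lambda>t. ennreal (w n t))" for n
    have int_eq: "(LINT t|\<mu> n. f t) = (LBINT t:{0..1}. (Re (h n (circ t)) / c) *\<^sub>R f t)"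
      if "f \<in> borel_measurable borel" for f :: "real \<Rightarrow> complex" and n
      unfolding \<mu>_def set_lebesgue_integral_def using that w_nonneg
      by (subst integral_density) (auto simp: w_def mult_ac intro!: Bochner_Integration.integral_cong)
    have w_int: "(w n has_integral 1) {0..1}" for n
    proof -
      have "((\<lambda>t. Re (h n (circ t)) * (1 / c)) has_integral Re (g 0) * (1/c)) {0..1}"
        by (rule has_integral_mult_left[OF mass])
      then show ?thesis using c
        by (simp add: c_def[symmetric]) (rule has_integral_eq[rotated], auto simp: w_def)
    qed
    have "emeasure (\<mu> n) UNIV = 1" for n
    proof -
      have "(w n has_integral 1) UNIV"
        using has_integral_restrict_UNIV[of "{0..1}" "w n" 1] w_int[of n]
        by (rule_tac has_integral_eq[rotated, where f = "\<lambda>x. if x \<in> {0..1} then w n x else 0"]) (auto simp: w_def)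
      then have "(\<integral>\<^sup>+t. ennreal (w n t) \<partial>lborel) = ennreal 1"
        using w_nonneg by (intro nn_integral_has_integral_lborel) auto
      then show ?thesis by (simp add: \<mu>_def emeasure_density)
    qed
    then have prob: "real_distribution (\<mu> n)" for n
      unfolding real_distribution_def real_distribution_axioms_def
      by (auto simp: \<mu>_def intro!: prob_spaceI)
    \<comment> \<open>Tightness is formulated with half-open intervals, hence
      \<open>{-1<..1}\<close> around the closed unit interval.\<close>
    have m1: "measure (\<mu> n) {-1<..1} = 1" for n
    proof -
      interpret real_distribution "\<mu> n" by (rule prob)
      have "AE t in \<mu> n. t \<in> {-1<..1}"
      proof -
        have "AE t in lborel. 0 < ennreal (w n t) \<longrightarrow> t \<in> {-1<..1}"
          by (auto simp: w_def indicator_def)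
        then show ?thesis unfolding \<mu>_def by (subst AE_density) auto
      qed
      then show ?thesis using prob_eq_1[of "{-1<..1}"] by (simp add: \<mu>_def)
    qed
    have "tight \<mu>"
      unfolding tight_def by (intro conjI allI impI prob exI[of _ "-1"] exI[of _ 1]) (simp_all add: m1)
    then obtain \<phi> M where \<phi>: "strict_mono \<phi>" and M: "real_distribution M" and conv: "weak_conv_m (\<mu> \<circ> id \<circ> \<phi>) M"
      using tight_imp_convergent_subsubsequence[of \<mu> id] by (auto simp: strict_mono_def)
    interpret M: real_distribution M by (rule M)
    have intM: "(LINT t|M. (circ t + z) / (circ t - z)) = (g z - \<i> * of_real (Im (g 0))) / of_real c" if z: "norm z < 1" for z
    proof -
      let ?K = "\<lambda>t. (circ t + z) / (circ t - z)"
      have "(\<lambda>n. LINT t|(\<mu> \<circ> id \<circ> \<phi>) n. ?K t) \<longlonglongrightarrow> (LINT t|M. ?K t)"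
        by (rule weak_conv_imp_integral_bdd_continuous_conv[OF _ M conv isCont_Herglotz_kernel[OF z] norm_Herglotz_kernel_le[OF z]])
          (use prob in auto)
      moreover have "(LINT t|\<mu> n. ?K t) = (h n z - \<i> * of_real (Im (g 0))) / of_real c" for n
      proof -
        have "(LINT t|\<mu> n. ?K t) = (LBINT t:{0..1}. (Re (h n (circ t)) / c) *\<^sub>R ?K t)"
          using z by (intro int_eq) measurable
        also have "\<dots> = integral {0..1} (\<lambda>t. (Re (h n (circ t)) / c) *\<^sub>R ?K t)"
        proof (rule set_borel_integral_eq_integral(2))
          have "continuous_on {0..1} (\<lambda>t. (Re (h n (circ t)) / c) *\<^sub>R ?K t)"
            by (intro continuous_intros cont_Re continuous_at_imp_continuous_on ballI isCont_Herglotz_kernel[OF z]) (use c in auto)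
          then show "set_integrable lborel {0..1} (\<lambda>t. (Re (h n (circ t)) / c) *\<^sub>R ?K t)"
            unfolding set_integrable_def by (rule borel_integrable_compact[OF compact_Icc])
        qed
        also have "\<dots> = integral {0..1} (\<lambda>t. of_real (Re (h n (circ t))) * ?K t * (1 / of_real c))"
          by (simp add: scaleR_conv_of_real mult_ac)
        also have "\<dots> = (h n z - \<i> * of_real (Im (g 0))) * (1 / of_real c)"
          by (intro integral_unique has_integral_mult_left S z)
        finally show ?thesis by simp
      qed
      moreover have "(\<lambda>n. (h (\<phi> n) z - \<i> * of_real (Im (g 0))) / of_real c) \<longlonglongrightarrow> (g z - \<i> * of_real (Im (g 0))) / of_real c"
        using LIMSEQ_subseq_LIMSEQ[OF hlim[OF z] \<phi>] c by (intro tendsto_intros) (auto simp: o_def)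
      ultimately show ?thesis by (auto intro: LIMSEQ_unique)
    qed
    define \<nu> where "\<nu> = scale_measure (ennreal c) M"
    show thesis
    proof (rule that[of \<nu>])
      show "sets \<nu> = sets borel" by (simp add: \<nu>_def)
      show "finite_measure \<nu>"
        by (rule finite_measureI) (simp add: \<nu>_def M.emeasure_space_1 ennreal_mult_eq_top_iff)
      fix z :: complex assume z: "norm z < 1"
      have "\<nu> = density M (\<lambda>_. ennreal c)"
        by (rule measure_eqI) (simp_all add: \<nu>_def emeasure_density nn_integral_cmult_indicator)
      then have "(LINT t|\<nu>. (circ t + z) / (circ t - z)) = c *\<^sub>R (LINT t|M. (circ t + z) / (circ t - z))"
        using c z by (simp add: integral_density)
      also have "\<dots> = g z - \<i> * of_real (Im (g 0))"
        using c z by (simp add: intM scaleR_conv_of_real)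
      finally show "g z = \<i> * of_real (Im (g 0)) + (LINT t|\<nu>. (circ t + z) / (circ t - z))" by simp
    qed
  qed
qed

section \<open>Nevanlinna representation on the upper half-plane\<close>

lemma norm_resolvent_le:
  assumes "Im z \<noteq> 0"
  shows "norm (inverse (of_real t - z)) \<le> 1 / \<bar>Im z\<bar>"
proof -
  have "\<bar>Im z\<bar> \<le> norm (of_real t - z)" using abs_Im_le_cmod[of "of_real t - z"] by simp
  then have "inverse (norm (of_real t - z)) \<le> inverse \<bar>Im z\<bar>"
    using assms by (intro le_imp_inverse_le) auto
  then show ?thesis by (simp add: norm_inverse divide_inverse)
qed

lemma integrable_resolvent:
  assumes "finite_measure M" "sets M = sets borel" "Im z \<noteq> 0"
  shows "integrable M (\<lambda>t::real. inverse (of_real t - z))"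
proof (rule finite_measure.integrable_const_bound[OF assms(1), where B = "1 / \<bar>Im z\<bar>"])
  show "(\<lambda>t. inverse (of_real t - z)) \<in> borel_measurable M"
    by (subst measurable_cong_sets[OF assms(2) refl]) measurable
qed (simp add: norm_resolvent_le[OF assms(3)])

lemma norm_Stieltjes_le:
  assumes "finite_measure M" "sets M = sets borel" "Im z \<noteq> 0"
  shows "norm (LINT t|M. inverse (of_real t - z)) \<le> measure M (space M) / \<bar>Im z\<bar>"
proof -
  interpret finite_measure M by (rule assms(1))
  have "norm (LINT t|M. inverse (of_real t - z)) \<le> (LINT t|M. norm (inverse (of_real t - z)))"
    by (rule integral_norm_bound)
  also have "\<dots> \<le> (LINT t|M. 1 / \<bar>Im z\<bar>)"
    using integrable_resolvent[OF assms] norm_resolvent_le[OF assms(3)]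
    by (intro integral_mono integrable_norm) auto
  finally show ?thesis by simp
qed

text \<open>The Cayley transform \<open>\<zeta> \<mapsto> \<i> (1 + \<zeta>) / (1 - \<zeta>)\<close> carries the Herglotz kernel to
  \<open>(1 + t z) / (t - z)\<close>, where \<open>t\<close> is the boundary point; only the boundary point \<open>1\<close> is sent to infinity.\<close>
lemma Cayley_kernel:
  fixes t :: real and z :: complex
  assumes "Im z > 0" "c = (of_real t - \<i>) / (of_real t + \<i>)" "\<zeta> = (z - \<i>) / (z + \<i>)"
  shows "\<i> * ((c + \<zeta>) / (c - \<zeta>)) = (1 + of_real t * z) * inverse (of_real t - z)"
proof -
  have t: "of_real t + \<i> \<noteq> 0" by (simp add: complex_eq_iff)
  have z: "z + \<i> \<noteq> 0" using assms(1) by (auto simp: complex_eq_iff)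
  have tz: "of_real t - z \<noteq> 0" using assms(1) by (auto simp: complex_eq_iff)
  have "c + \<zeta> = 2 * (1 + of_real t * z) / ((of_real t + \<i>) * (z + \<i>))"
    unfolding assms(2,3) using t z by (simp add: divide_simps) (simp add: algebra_simps)
  moreover have "c - \<zeta> = 2 * \<i> * (of_real t - z) / ((of_real t + \<i>) * (z + \<i>))"
    unfolding assms(2,3) using t z by (simp add: divide_simps) (simp add: algebra_simps)
  ultimately have "(c + \<zeta>) / (c - \<zeta>) = (2 * (1 + of_real t * z)) / (2 * \<i> * (of_real t - z))"
    using t z by simp
  then show ?thesis using tz by (simp only:) (simp add: divide_simps, simp add: algebra_simps)
qed

text \<open>The Cayley preimage of a circle point other than 1 equals its own conjugate, so taking
  the real part in \<open>T\<close> loses nothing.\<close>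

lemma circ_eq_Cayley:
  assumes "circ t \<noteq> 1"
  defines "T \<equiv> Re (\<i> * (1 + circ t) / (1 - circ t))"
  shows "circ t = (of_real T - \<i>) / (of_real T + \<i>)"
proof -
  let ?w = "\<i> * (1 + circ t) / (1 - circ t)"
  have ne: "1 - circ t \<noteq> 0" using assms(1) by simp
  have "cnj ?w = ?w"
    using ne by (simp add: cnj_circ divide_simps) (simp add: algebra_simps)
  then have w: "of_real T = ?w" unfolding T_def by (metis Reals_cnj_iff of_real_Re)
  have "?w - \<i> = 2 * \<i> * circ t / (1 - circ t)" "?w + \<i> = 2 * \<i> / (1 - circ t)"
    using ne by (simp_all add: divide_simps) (simp_all add: algebra_simps)
  then show ?thesis unfolding w using ne by simp
qed

text \<open>Transported by the Cayley transform, the Herglotz formula represents f by a real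
  constant, a linear term from the mass at the boundary point 1, and the kernel (1 + T z) / (T - z).
  The growth bound on the imaginary axis excludes mass at 1, makes 1 + T^2 integrable, and finally
  forces the remaining constant to vanish.\<close>

theorem Nevanlinna_representation:
  assumes f: "f holomorphic_on {z. Im z > 0}" and pos: "\<And>z. Im z > 0 \<Longrightarrow> 0 \<le> Im (f z)"
    and bdd: "\<And>y. y \<ge> 1 \<Longrightarrow> y * norm (f (\<i> * of_real y)) \<le> C"
  obtains \<mu> :: "real measure" where "finite_measure \<mu>" "sets \<mu> = sets borel"
    "\<And>z. Im z > 0 \<Longrightarrow> f z = (LINT t|\<mu>. inverse (of_real t - z))"
proof -
  define \<psi> where "\<psi> \<zeta> = \<i> * (1 + \<zeta>) / (1 - \<zeta>)" for \<zeta> :: complex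
  have \<psi>_pos: "Im (\<psi> \<zeta>) > 0" if "norm \<zeta> < 1" for \<zeta>
  proof -
    have ne: "1 - \<zeta> \<noteq> 0" using that by auto
    have "Im (\<psi> \<zeta>) = Re ((1 + \<zeta>) / (1 - \<zeta>))"
      by (simp add: \<psi>_def flip: times_divide_eq_right)
    also have "\<dots> = Re ((1 + \<zeta>) * cnj (1 - \<zeta>)) / (norm (1 - \<zeta>))\<^sup>2"
      by (subst complex_div_cnj) (simp only: Re_divide_of_real flip: of_real_power)
    also have "Re ((1 + \<zeta>) * cnj (1 - \<zeta>)) = 1 - (norm \<zeta>)\<^sup>2"
      unfolding cmod_power2 by (simp add: algebra_simps power2_eq_square)
    finally show ?thesis using ne that by (simp add: power2_less_1_iff[symmetric] abs_square_less_1)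
  qed
  \<comment> \<open>The factor - i carries the closed upper half-plane to the closed right
    half-plane.\<close>
  define g where "g \<zeta> = - \<i> * f (\<psi> \<zeta>)" for \<zeta>
  have "\<psi> holomorphic_on ball 0 1" unfolding \<psi>_def by (intro holomorphic_intros) auto
  then have "(\<lambda>\<zeta>. f (\<psi> \<zeta>)) holomorphic_on ball 0 1"
    by (rule holomorphic_on_compose_gen[OF _ f, unfolded o_def]) (auto intro: \<psi>_pos)
  then have "g holomorphic_on ball 0 1" unfolding g_def by (intro holomorphic_intros)
  moreover have "0 \<le> Re (g \<zeta>)" if "norm \<zeta> < 1" for \<zeta>
    using pos[OF \<psi>_pos[OF that]] by (simp add: g_def)
  ultimately obtain \<nu> :: "real measure" where \<nu>: "finite_measure \<nu>" "sets \<nu> = sets borel"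
    and g_eq: "\<And>z. norm z < 1 \<Longrightarrow> g z = \<i> * of_real (Im (g 0)) + (LINT t|\<nu>. (circ t + z) / (circ t - z))"
    using Herglotz_representation[of g] by blast
  interpret \<nu>: finite_measure \<nu> by (rule \<nu>)
  note \<nu>(2)[measurable_cong]
  have [measurable]: "circ \<in> borel_measurable borel"
    by (intro borel_measurable_continuous_onI continuous_circ)
  \<comment> \<open>The parameters of the boundary point 1, that is, of infinity on the line. The
    kernel is z there, so mass on \<open>N\<close> would make f grow linearly.\<close>
  define N where "N = {t. circ t = 1}"
  have [measurable]: "N \<in> sets borel" unfolding N_def by measurable
  define T where "T t = Re (\<i> * (1 + circ t) / (1 - circ t))" for t
  have [measurable]: "T \<in> borel_measurable borel" unfolding T_def by measurable
  define k where "k z t = (if t \<in> N then z else (1 + of_real (T t) * z) * inverse (of_real (T t) - z))" for z :: complex and t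
  have [measurable]: "k z \<in> borel_measurable borel" for z unfolding k_def by measurable
  define b where "b = Im (g 0)"
  have Cayley: "norm ((z - \<i>) / (z + \<i>)) < 1" "\<psi> ((z - \<i>) / (z + \<i>)) = z" if "Im z > 0" for z
  proof -
    have z: "z + \<i> \<noteq> 0" using that by (auto simp: complex_eq_iff)
    have "(norm (z - \<i>))\<^sup>2 < (norm (z + \<i>))\<^sup>2"
      unfolding cmod_power2 using that by (simp add: power2_eq_square algebra_simps)
    then have "norm (z - \<i>) < norm (z + \<i>)" by (rule power2_less_imp_less) simp
    then show "norm ((z - \<i>) / (z + \<i>)) < 1" using z by (simp add: norm_divide)
    have "1 + (z - \<i>) / (z + \<i>) = 2 * z / (z + \<i>)" "1 - (z - \<i>) / (z + \<i>) = 2 * \<i> / (z + \<i>)"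
      using z by (simp_all add: field_simps)
    then show "\<psi> ((z - \<i>) / (z + \<i>)) = z" unfolding \<psi>_def using z by simp
  qed
  have kernel: "\<i> * ((circ t + (z - \<i>) / (z + \<i>)) / (circ t - (z - \<i>) / (z + \<i>))) = k z t"
    if z: "Im z > 0" for z t
  proof (cases "t \<in> N")
    case True
    then have "circ t = 1" by (simp add: N_def)
    then show ?thesis using True Cayley(2)[OF z] by (simp add: k_def \<psi>_def)
  next
    case False
    then have "circ t \<noteq> 1" by (simp add: N_def)
    from Cayley_kernel[OF z circ_eq_Cayley[OF this] refl] False show ?thesis
      by (simp add: k_def T_def)
  qed
  have k_int: "integrable \<nu> (k z)" if z: "Im z > 0" for z
  proof (rule \<nu>.integrable_const_bound)
    show "AE t in \<nu>. norm (k z t) \<le> 2 / (1 - norm ((z - \<i>) / (z + \<i>)))"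
      using norm_Herglotz_kernel_le[OF Cayley(1)[OF z]]
      by (simp add: kernel[OF z, symmetric] norm_mult del: times_divide_eq_right)
  qed simp
  have f_eq: "f z = - of_real b + (LINT t|\<nu>. k z t)" if z: "Im z > 0" for z
  proof -
    let ?\<zeta> = "(z - \<i>) / (z + \<i>)"
    have "f z = \<i> * g ?\<zeta>" by (simp add: g_def Cayley(2)[OF z])
    also have "\<dots> = - of_real b + \<i> * (LINT t|\<nu>. (circ t + ?\<zeta>) / (circ t - ?\<zeta>))"
      unfolding g_eq[OF Cayley(1)[OF z]] b_def by (simp add: algebra_simps)
    also have "\<i> * (LINT t|\<nu>. (circ t + ?\<zeta>) / (circ t - ?\<zeta>)) = (LINT t|\<nu>. \<i> * ((circ t + ?\<zeta>) / (circ t - ?\<zeta>)))"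
      by (rule Bochner_Integration.integral_mult_right_zero[symmetric])
    finally show ?thesis by (simp only: kernel[OF z])
  qed
  \<comment> \<open>y times the imaginary part of the kernel at i y; its integral is at most C. On
    \<open>N\<close> it is y^2 and off \<open>N\<close> it tends to 1 + T^2, so the bound yields
    \<nu>(N) = 0 and, by Fatou, the integrability of 1 + T^2.\<close>
  define \<phi> where "\<phi> y t = (if t \<in> N then y\<^sup>2 else y\<^sup>2 * (1 + (T t)\<^sup>2) / ((T t)\<^sup>2 + y\<^sup>2))" for y t
  have [measurable]: "\<phi> y \<in> borel_measurable borel" for y unfolding \<phi>_def by measurable
  have \<phi>_nonneg: "0 \<le> \<phi> y t" for y t by (simp add: \<phi>_def)
  have \<phi>_eq: "\<phi> y t = y * Im (k (\<i> * of_real y) t)" if "y > 0" for y t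
  proof -
    have "Im ((1 + of_real (T t) * (\<i> * of_real y)) * inverse (of_real (T t) - \<i> * of_real y))
       = y * (1 + (T t)\<^sup>2) / ((T t)\<^sup>2 + y\<^sup>2)"
      using that by (simp add: Im_divide field_simps power2_eq_square flip: divide_inverse)
    then show ?thesis by (simp add: \<phi>_def k_def power2_eq_square)
  qed
  have \<phi>_bound: "(\<integral>\<^sup>+t. ennreal (\<phi> y t) \<partial>\<nu>) \<le> ennreal C" if "y \<ge> 1" for y
  proof -
    have y: "Im (\<i> * of_real y) > 0" "y > 0" using that by auto
    have int: "integrable \<nu> (\<phi> y)"
      unfolding \<phi>_eq[OF y(2), abs_def] using k_int[OF y(1)] by simp
    have "(LINT t|\<nu>. \<phi> y t) = y * Im (f (\<i> * of_real y))"
      unfolding \<phi>_eq[OF y(2)] f_eq[OF y(1)] using k_int[OF y(1)] by simp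
    also have "\<dots> \<le> y * norm (f (\<i> * of_real y))"
      using y abs_Im_le_cmod[of "f (\<i> * of_real y)"] by (intro mult_left_mono) auto
    also have "\<dots> \<le> C" by (rule bdd[OF that])
    finally show ?thesis
      using nn_integral_eq_integral[OF int] \<phi>_nonneg by (simp add: ennreal_leI)
  qed
  have "emeasure \<nu> N = 0"
  proof -
    have "measure \<nu> N \<le> C / real n" if "n \<ge> 1" for n :: nat
    proof -
      have "ennreal ((real n)\<^sup>2) * emeasure \<nu> N = (\<integral>\<^sup>+t. ennreal ((real n)\<^sup>2) * indicator N t \<partial>\<nu>)"
        by (simp add: nn_integral_cmult_indicator)
      also have "\<dots> \<le> (\<integral>\<^sup>+t. ennreal (\<phi> (real n) t) \<partial>\<nu>)"
        by (intro nn_integral_mono) (auto simp: \<phi>_def indicator_def)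
      also have "\<dots> \<le> ennreal C" using that by (intro \<phi>_bound) auto
      finally have *: "ennreal ((real n)\<^sup>2 * measure \<nu> N) \<le> ennreal C"
        by (simp add: \<nu>.emeasure_eq_measure ennreal_mult)
      have "C \<ge> 0" using bdd[of 1] norm_ge_zero[of "f \<i>"] by (simp del: norm_ge_zero)
      then have "(real n)\<^sup>2 * measure \<nu> N \<le> C" using * by (simp add: ennreal_le_iff)
      moreover have "real n * measure \<nu> N \<le> (real n)\<^sup>2 * measure \<nu> N"
        using that by (intro mult_right_mono) (auto simp: power2_eq_square)
      ultimately show ?thesis using that by (simp add: field_simps)
    qed
    moreover have "(\<lambda>n. C / real n) \<longlonglongrightarrow> 0" by real_asymp
    ultimately have "measure \<nu> N \<le> 0" by (intro LIMSEQ_le_const) (auto intro!: exI[of _ 1])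
    then show ?thesis by (simp add: \<nu>.emeasure_eq_measure measure_le_0_iff)
  qed
  then have AE_N: "AE t in \<nu>. t \<notin> N"
    by (intro AE_I[of _ _ N]) auto
  have fin: "(\<integral>\<^sup>+t. ennreal (1 + (T t)\<^sup>2) \<partial>\<nu>) \<le> ennreal C"
  proof -
    have lim: "(\<lambda>n. \<phi> (real (Suc n)) t) \<longlonglongrightarrow> 1 + (T t)\<^sup>2" if "t \<notin> N" for t
    proof -
      have "(\<lambda>n. (real (Suc n))\<^sup>2 * (1 + (T t)\<^sup>2) / ((T t)\<^sup>2 + (real (Suc n))\<^sup>2)) \<longlonglongrightarrow> 1 + (T t)\<^sup>2"
        by real_asymp
      then show ?thesis using that by (simp add: \<phi>_def)
    qed
    have "(\<integral>\<^sup>+t. ennreal (1 + (T t)\<^sup>2) \<partial>\<nu>) = (\<integral>\<^sup>+t. liminf (\<lambda>n. ennreal (\<phi> (real (Suc n)) t)) \<partial>\<nu>)"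
    proof (rule nn_integral_cong_AE, use AE_N in eventually_elim)
      fix t assume "t \<notin> N"
      then have "(\<lambda>n. ennreal (\<phi> (real (Suc n)) t)) \<longlonglongrightarrow> ennreal (1 + (T t)\<^sup>2)"
        by (intro tendsto_ennrealI lim)
      then show "ennreal (1 + (T t)\<^sup>2) = liminf (\<lambda>n. ennreal (\<phi> (real (Suc n)) t))"
        by (simp add: lim_imp_Liminf)
    qed
    also have "\<dots> \<le> liminf (\<lambda>n. \<integral>\<^sup>+t. ennreal (\<phi> (real (Suc n)) t) \<partial>\<nu>)"
      by (rule nn_integral_liminf) simp
    also have "\<dots> \<le> liminf (\<lambda>n::nat. ennreal C)"
      by (intro Liminf_mono always_eventually allI \<phi>_bound) simp
    also have "\<dots> = ennreal C" by (simp add: Liminf_const)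
    finally show ?thesis .
  qed
  have int2: "integrable \<nu> (\<lambda>t. 1 + (T t)\<^sup>2)"
    using le_less_trans[OF fin ennreal_less_top] by (intro integrableI_nonneg) auto
  have intT: "integrable \<nu> T"
  proof (rule Bochner_Integration.integrable_bound[OF int2])
    have "\<bar>T t\<bar> \<le> 1 + (T t)\<^sup>2" for t
    proof -
      have "0 \<le> (\<bar>T t\<bar> - 1)\<^sup>2" by simp
      then show ?thesis by (simp add: power2_eq_square algebra_simps abs_mult_self_eq)
    qed
    then show "AE t in \<nu>. norm (T t) \<le> norm (1 + (T t)\<^sup>2)" by (auto simp: abs_of_nonneg)
  qed simp
  \<comment> \<open>Since (1 + T z) / (T - z) = (1 + T^2) / (T - z) - T, the weight 1 + T^2 is
    absorbed into the measure before T transports it to the line.\<close>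
  define \<mu> where "\<mu> = distr (density \<nu> (\<lambda>t. ennreal (1 + (T t)\<^sup>2))) borel T"
  have \<mu>_sets: "sets \<mu> = sets borel" by (simp add: \<mu>_def)
  have \<mu>_fin: "finite_measure \<mu>"
  proof (rule finite_measureI)
    have "emeasure \<mu> (space \<mu>) = (\<integral>\<^sup>+t. ennreal (1 + (T t)\<^sup>2) \<partial>\<nu>)"
      by (simp add: \<mu>_def emeasure_distr emeasure_density)
    then show "emeasure \<mu> (space \<mu>) \<noteq> \<infinity>" using fin by (auto simp: top_unique)
  qed
  interpret \<mu>: finite_measure \<mu> by (rule \<mu>_fin)
  define S where "S z = (LINT t|\<mu>. inverse (of_real t - z))" for z :: complex
  have S_eq: "S z = (LINT t|\<nu>. (1 + (T t)\<^sup>2) *\<^sub>R inverse (of_real (T t) - z))" for z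
    unfolding S_def \<mu>_def by (subst integral_distr, simp, simp, rule integral_density) auto
  have f_S: "f z = of_real (- b - (LINT t|\<nu>. T t)) + S z" if z: "Im z > 0" for z
  proof -
    have int1: "integrable \<nu> (\<lambda>t. (1 + (T t)\<^sup>2) *\<^sub>R inverse (of_real (T t) - z))"
    proof (rule Bochner_Integration.integrable_bound)
      show "integrable \<nu> (\<lambda>t. (1 + (T t)\<^sup>2) * (1 / \<bar>Im z\<bar>))" using int2 by (rule integrable_mult_left)
      show "AE t in \<nu>. norm ((1 + (T t)\<^sup>2) *\<^sub>R inverse (of_real (T t) - z)) \<le> norm ((1 + (T t)\<^sup>2) * (1 / \<bar>Im z\<bar>))"
      proof (rule AE_I2)
        fix t
        have "norm (inverse (complex_of_real (T t) - z)) \<le> 1 / \<bar>Im z\<bar>" using z by (intro norm_resolvent_le) auto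
        then show "norm ((1 + (T t)\<^sup>2) *\<^sub>R inverse (of_real (T t) - z)) \<le> norm ((1 + (T t)\<^sup>2) * (1 / \<bar>Im z\<bar>))"
          unfolding norm_scaleR norm_mult by (intro mult_mono) auto
      qed
    qed simp
    have "(LINT t|\<nu>. k z t) = (LINT t|\<nu>. (1 + (T t)\<^sup>2) *\<^sub>R inverse (of_real (T t) - z) - of_real (T t))"
    proof (rule integral_cong_AE, use AE_N in \<open>simp, simp\<close>, use AE_N in eventually_elim)
      fix t assume "t \<notin> N"
      have "of_real (T t) - z \<noteq> 0" using z by (auto simp: complex_eq_iff)
      then have "(1 + of_real (T t) * z) / (of_real (T t) - z) =
          (1 + (of_real (T t))\<^sup>2) / (of_real (T t) - z) - of_real (T t)"
        by (simp add: divide_simps) (simp add: algebra_simps power2_eq_square)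
      then show "k z t = (1 + (T t)\<^sup>2) *\<^sub>R inverse (of_real (T t) - z) - of_real (T t)"
        using \<open>t \<notin> N\<close> by (simp add: k_def scaleR_conv_of_real divide_inverse)
    qed
    also have "\<dots> = S z - of_real (LINT t|\<nu>. T t)"
      unfolding S_eq using int1 intT by (subst Bochner_Integration.integral_diff) auto
    finally show ?thesis by (simp add: f_eq[OF z])
  qed
  \<comment> \<open>Along the imaginary axis both f and the Stieltjes transform are O(1 / y), and so
    is their constant difference.\<close>
  have "- b - (LINT t|\<nu>. T t) = 0"
  proof -
    define a where "a = - b - (LINT t|\<nu>. T t)"
    have "norm (complex_of_real a) \<le> (C + measure \<mu> (space \<mu>)) / real n" if "n \<ge> 1" for n :: nat
    proof -
      let ?z = "\<i> * of_real (real n)"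
      have z: "Im ?z > 0" using that by auto
      have "norm (S ?z) \<le> measure \<mu> (space \<mu>) / real n"
        using norm_Stieltjes_le[OF \<mu>_fin \<mu>_sets, of ?z] z by (simp add: S_def)
      moreover have "norm (f ?z) \<le> C / real n"
        using bdd[of "real n"] that by (simp add: field_simps)
      moreover have "complex_of_real a = f ?z - S ?z" using f_S[OF z] by (simp add: a_def)
      ultimately have "norm (complex_of_real a) \<le> C / real n + measure \<mu> (space \<mu>) / real n"
        using norm_triangle_ineq4[of "f ?z" "S ?z"] by simp
      then show ?thesis by (simp add: add_divide_distrib)
    qed
    moreover have "(\<lambda>n. (C + measure \<mu> (space \<mu>)) / real n) \<longlonglongrightarrow> 0" by real_asymp
    ultimately have "norm (complex_of_real a) \<le> 0" by (intro LIMSEQ_le_const) (auto intro!: exI[of _ 1])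
    then show ?thesis by (simp add: a_def)
  qed
  then have "\<And>z. Im z > 0 \<Longrightarrow> f z = S z" using f_S by simp
  then show thesis using that[OF \<mu>_fin \<mu>_sets] by (simp add: S_def)
qed

section \<open>Stieltjes functions on the slit plane\<close>

lemma slit_plane_iff: "z \<in> slit_plane \<alpha> \<longleftrightarrow> Im z \<noteq> 0 \<or> Re z < \<alpha>"
  by (auto simp: slit_plane_def image_iff complex_eq_iff not_le)

lemma open_slit_plane: "open (slit_plane \<alpha>)"
proof -
  have "slit_plane \<alpha> = {z. Im z \<noteq> 0} \<union> {z. Re z < \<alpha>}"
    by (auto simp: slit_plane_iff)
  then show ?thesis
    by (auto intro!: open_Collect_neq open_halfspace_Re_lt continuous_intros)
qed

lemma connected_slit_plane: "connected (slit_plane \<alpha>)"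
proof (rule starlike_imp_connected)
  have "closed_segment (of_real (\<alpha> - 1)) z \<subseteq> slit_plane \<alpha>" if z: "z \<in> slit_plane \<alpha>" for z
  proof
    fix w assume "w \<in> closed_segment (of_real (\<alpha> - 1)) z"
    then obtain u where u: "0 \<le> u" "u \<le> 1" "w = (1 - u) *\<^sub>R of_real (\<alpha> - 1) + u *\<^sub>R z"
      by (auto simp: closed_segment_def)
    have Im: "Im w = u * Im z" and Re: "Re w = (1 - u) * (\<alpha> - 1) + u * Re z"
      by (simp_all add: u)
    show "w \<in> slit_plane \<alpha>"
    proof (cases "Im w = 0")
      case True
      have "Re w < \<alpha>"
      proof (cases "u = 0")
        case False
        then have "Re z < \<alpha>" using True z Im by (auto simp: slit_plane_iff)
        then have "u * Re z < u * \<alpha>" using False u by simp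
        moreover have "(1 - u) * (\<alpha> - 1) \<le> (1 - u) * \<alpha>" using u by (intro mult_left_mono) auto
        ultimately show ?thesis unfolding Re by (simp add: algebra_simps)
      qed (simp add: Re)
      then show ?thesis by (simp add: slit_plane_iff)
    qed (simp add: slit_plane_iff)
  qed
  then show "starlike (slit_plane \<alpha>)"
    unfolding starlike_def by (intro bexI[of _ "of_real (\<alpha> - 1)"]) (auto simp: slit_plane_iff)
qed

text \<open>Supplies the uniform bound 1 / d on the resolvents near z that serves as dominating
  constant.\<close>

lemma slit_plane_dist:
  assumes "z \<in> slit_plane \<alpha>"
  obtains d where "d > 0" "\<And>w t. w \<in> ball z d \<Longrightarrow> t \<ge> \<alpha> \<Longrightarrow> d \<le> norm (of_real t - w)"
proof -
  obtain e where e: "e > 0" "ball z e \<subseteq> slit_plane \<alpha>"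
    using open_slit_plane assms open_contains_ball by blast
  show thesis
  proof (rule that[of "e / 2"])
    show "e / 2 > 0" using e by simp
    fix w t assume w: "w \<in> ball z (e / 2)" and t: "t \<ge> \<alpha>"
    have "of_real t \<notin> ball z e" using e t by (auto simp: slit_plane_def)
    then have "e \<le> dist z (of_real t)" by simp
    also have "\<dots> \<le> dist z w + dist w (of_real t)" by (rule dist_triangle)
    finally show "e / 2 \<le> norm (of_real t - w)" using w by (simp add: dist_norm norm_minus_commute)
  qed
qed

text \<open>The measure lives on all Borel sets of the line and is merely concentrated on the
  half-line. In this form the representation on the half-plane and the inversion on the line apply
  to it directly.\<close>

locale half_line_measure = finite_measure \<mu> for \<mu> :: "real measure" +
  fixes \<alpha> :: real
  assumes sets_eq: "sets \<mu> = sets borel" and AE_ge: "AE t in \<mu>. t \<ge> \<alpha>"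
begin

lemmas sets_eq[measurable_cong]

definition "S z = (LINT t|\<mu>. inverse (complex_of_real t - z))"

lemma integrable_bounded:
  assumes "f \<in> borel_measurable borel" "\<And>t. t \<ge> \<alpha> \<Longrightarrow> norm (f t) \<le> B"
  shows "integrable \<mu> (f :: real \<Rightarrow> complex)"
proof (rule integrable_const_bound)
  show "AE t in \<mu>. norm (f t) \<le> B" using AE_ge by eventually_elim (rule assms)
  show "f \<in> borel_measurable \<mu>" using assms(1) by simp
qed

lemma integrable_slit_resolvent:
  assumes "z \<in> slit_plane \<alpha>"
  shows "integrable \<mu> (\<lambda>t. inverse (complex_of_real t - z))"
proof -
  obtain d where d: "d > 0" "\<And>w t. w \<in> ball z d \<Longrightarrow> t \<ge> \<alpha> \<Longrightarrow> d \<le> norm (of_real t - w)"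
    using slit_plane_dist[OF assms] by blast
  show ?thesis
  proof (rule integrable_bounded)
    fix t assume "t \<ge> \<alpha>"
    then have "d \<le> norm (of_real t - z)" using d by simp
    then show "norm (inverse (complex_of_real t - z)) \<le> inverse d"
      unfolding norm_inverse using d by (intro le_imp_inverse_le) auto
  qed measurable
qed

text \<open>The difference quotient of the resolvent is a product of two resolvents, which is
  bounded by d^(-2) near z; dominated convergence along sequences does the rest.\<close>

lemma S_has_field_derivative:
  assumes "z \<in> slit_plane \<alpha>"
  shows "(S has_field_derivative (LINT t|\<mu>. inverse ((complex_of_real t - z)\<^sup>2))) (at z)"
  unfolding has_field_derivative_iff tendsto_at_iff_sequentially
proof (intro allI impI)
  obtain d where d: "d > 0" "\<And>w t. w \<in> ball z d \<Longrightarrow> t \<ge> \<alpha> \<Longrightarrow> d \<le> norm (of_real t - w)"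
    using slit_plane_dist[OF assms] by blast
  obtain e where e: "e > 0" "ball z e \<subseteq> slit_plane \<alpha>"
    using open_slit_plane assms open_contains_ball by blast
  fix X :: "nat \<Rightarrow> complex" assume X: "\<forall>i. X i \<in> UNIV - {z}" "X \<longlonglongrightarrow> z"
  have ev: "\<forall>\<^sub>F i in sequentially. X i \<in> ball z (min d e)"
    using X(2) d e by (intro topological_tendstoD) auto
  then obtain i0 where i0: "\<And>i. i \<ge> i0 \<Longrightarrow> X i \<in> ball z (min d e)"
    by (auto simp: eventually_sequentially)
  \<comment> \<open>Dropping an initial segment puts every term into the balls where the bounds
    hold.\<close>
  define Y where "Y i = X (i + i0)" for i
  have Y: "Y i \<in> ball z d" "Y i \<in> slit_plane \<alpha>" "Y i \<noteq> z" for i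
    using i0[of "i + i0"] e X(1) by (auto simp: Y_def)
  have Ylim: "Y \<longlonglongrightarrow> z" unfolding Y_def using X(2) by (rule LIMSEQ_ignore_initial_segment)
  have zb: "z \<in> ball z d" using d by simp
  have "(\<lambda>i. LINT t|\<mu>. inverse ((complex_of_real t - Y i) * (of_real t - z))) \<longlonglongrightarrow>
      (LINT t|\<mu>. inverse ((complex_of_real t - z)\<^sup>2))"
  proof (rule integral_dominated_convergence[where w = "\<lambda>_. inverse (d * d)"])
    show "AE t in \<mu>. (\<lambda>i. inverse ((complex_of_real t - Y i) * (of_real t - z))) \<longlonglongrightarrow> inverse ((complex_of_real t - z)\<^sup>2)"
      using AE_ge
    proof eventually_elim
      fix t assume "t \<ge> \<alpha>"
      then have "of_real t \<noteq> z" using d(2)[OF zb] d(1) by fastforce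
      then show "(\<lambda>i. inverse ((complex_of_real t - Y i) * (of_real t - z))) \<longlonglongrightarrow> inverse ((complex_of_real t - z)\<^sup>2)"
        unfolding power2_eq_square by (intro tendsto_intros Ylim) auto
    qed
    show "AE t in \<mu>. norm (inverse ((complex_of_real t - Y i) * (of_real t - z))) \<le> inverse (d * d)" for i
      using AE_ge
    proof eventually_elim
      fix t assume "t \<ge> \<alpha>"
      then have "d * d \<le> norm (of_real t - Y i) * norm (of_real t - z)"
        using d Y zb by (intro mult_mono) auto
      then show "norm (inverse ((complex_of_real t - Y i) * (of_real t - z))) \<le> inverse (d * d)"
        unfolding norm_inverse norm_mult using d by (intro le_imp_inverse_le) auto
    qed
  qed auto
  also have "(\<lambda>i. LINT t|\<mu>. inverse ((complex_of_real t - Y i) * (of_real t - z)))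
    = (\<lambda>i. (S (Y i) - S z) / (Y i - z))"
  proof
    fix i
    have "(LINT t|\<mu>. inverse ((complex_of_real t - Y i) * (of_real t - z)))
      = (LINT t|\<mu>. (inverse (complex_of_real t - Y i) - inverse (of_real t - z)) / (Y i - z))"
    proof (rule integral_cong_AE)
      show "AE t in \<mu>. inverse ((complex_of_real t - Y i) * (of_real t - z)) =
        (inverse (complex_of_real t - Y i) - inverse (of_real t - z)) / (Y i - z)"
        using AE_ge
      proof eventually_elim
        fix t assume "t \<ge> \<alpha>"
        then have "d \<le> norm (of_real t - z)" "d \<le> norm (of_real t - Y i)"
          using d(2)[OF zb] d(2)[OF Y(1)] by auto
        then have "of_real t - z \<noteq> 0" "of_real t - Y i \<noteq> 0" using d(1) by auto
        then show "inverse ((complex_of_real t - Y i) * (of_real t - z)) =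
          (inverse (complex_of_real t - Y i) - inverse (of_real t - z)) / (Y i - z)"
          using Y(3)[of i] by (simp add: divide_simps)
      qed
    qed auto
    also have "\<dots> = (S (Y i) - S z) / (Y i - z)"
      unfolding S_def using integrable_slit_resolvent[OF Y(2)] integrable_slit_resolvent[OF assms]
      by simp
    finally show "(LINT t|\<mu>. inverse ((complex_of_real t - Y i) * (of_real t - z))) = (S (Y i) - S z) / (Y i - z)" .
  qed
  finally have "(\<lambda>i. (S (Y i) - S z) / (Y i - z)) \<longlonglongrightarrow> (LINT t|\<mu>. inverse ((complex_of_real t - z)\<^sup>2))" .
  then show "((\<lambda>y. (S y - S z) / (y - z)) \<circ> X) \<longlonglongrightarrow> (LINT t|\<mu>. inverse ((complex_of_real t - z)\<^sup>2))"
    unfolding Y_def o_def by (rule LIMSEQ_offset)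
qed

lemma S_holomorphic: "S holomorphic_on slit_plane \<alpha>"
  using S_has_field_derivative holomorphic_on_open[OF open_slit_plane] by blast

end

text \<open>Support: each interval of length \<open>2 \<epsilon>\<close> around \<open>x < \<alpha>\<close> has measure at most
  \<open>2 \<epsilon> Im f(x + i \<epsilon>) = O(\<epsilon>\<^sup>2)\<close>, because \<open>f\<close> is real to the left of \<open>\<alpha>\<close>; summing over a partition gives \<open>O(\<epsilon>)\<close>.\<close>
lemma Stieltjes_support:
  assumes \<mu>: "finite_measure \<mu>" "sets \<mu> = sets borel"
    and f: "f holomorphic_on slit_plane \<alpha>" and real: "\<And>x::real. x < \<alpha> \<Longrightarrow> Im (f (of_real x)) = 0"
    and rep: "\<And>z. Im z > 0 \<Longrightarrow> f z = (LINT t|\<mu>. inverse (of_real t - z))"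
  shows "AE t in \<mu>. t \<ge> \<alpha>"
proof -
  interpret finite_measure \<mu> by (rule \<mu>)
  note \<mu>(2)[measurable_cong]
  have small: "measure \<mu> {x-e..x+e} \<le> 2 * e * Im (f (Complex x e))" if e: "e > 0" for x e
  proof -
    have z: "Im (Complex x e) > 0" "Im (Complex x e) \<noteq> 0" using e by auto
    have "1 / (2 * e) * measure \<mu> {x-e..x+e} = (LINT t|\<mu>. 1 / (2 * e) * indicator {x-e..x+e} t)"
      by simp
    also have "\<dots> \<le> (LINT t|\<mu>. Im (inverse (of_real t - Complex x e)))"
    proof (rule integral_mono)
      show "integrable \<mu> (\<lambda>t. Im (inverse (of_real t - Complex x e)))"
        by (rule integrable_Im[OF integrable_resolvent[OF \<mu> z(2)]])
      show "integrable \<mu> (\<lambda>t. 1 / (2 * e) * indicator {x-e..x+e} t)"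
        by (intro integrable_mult_right integrable_real_indicator) (simp_all add: less_top[symmetric])
      fix t
      have Im: "Im (inverse (of_real t - Complex x e)) = e / ((t - x)\<^sup>2 + e\<^sup>2)"
        by (simp add: complex_of_real_def)
      show "1 / (2 * e) * indicator {x-e..x+e} t \<le> Im (inverse (of_real t - Complex x e))"
      proof (cases "t \<in> {x-e..x+e}")
        case True
        then have "(t - x)\<^sup>2 \<le> e\<^sup>2" using e by (intro abs_le_square_iff[THEN iffD1]) auto
        then have "e / (2 * e\<^sup>2) \<le> e / ((t - x)\<^sup>2 + e\<^sup>2)" using e
          by (intro divide_left_mono) (auto intro!: mult_pos_pos add_nonneg_pos)
        then show ?thesis using True e unfolding Im by (simp add: power2_eq_square)
      next
        case False
        then show ?thesis unfolding Im using e by simp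
      qed
    qed
    also have "\<dots> = Im (f (Complex x e))"
      unfolding rep[OF z(1)] by (rule integral_Im[OF integrable_resolvent[OF \<mu> z(2)]])
    finally show ?thesis using e by (simp add: field_simps)
  qed
  have zero: "emeasure \<mu> {a..b} = 0" if ab: "a < b" "b < \<alpha>" for a b
  proof -
    \<comment> \<open>A rectangle of height 1 above [a, b]; since b < \<alpha> it stays in the slit
      plane, so the derivative of f is bounded on it and Im f(x + i e) \<le> M e.\<close>
    define K where "K = cbox (Complex a 0) (Complex b 1)"
    have K: "compact K" "convex K" "K \<subseteq> slit_plane \<alpha>"
      using ab by (auto simp: K_def in_cbox_complex_iff slit_plane_iff)
    have "deriv f holomorphic_on slit_plane \<alpha>" by (rule holomorphic_deriv[OF f open_slit_plane])
    then have "continuous_on K (deriv f)"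
      using K(3) holomorphic_on_imp_continuous_on continuous_on_subset by blast
    then have "bounded (deriv f ` K)" using K(1) compact_continuous_image compact_imp_bounded by blast
    then obtain M where M: "\<And>z. z \<in> K \<Longrightarrow> norm (deriv f z) \<le> M" by (auto simp: bounded_iff)
    have Im_le: "Im (f (Complex x e)) \<le> M * e" if "a \<le> x" "x \<le> b" "0 < e" "e \<le> 1" for x e
    proof -
      have xK: "Complex x e \<in> K" "Complex x 0 \<in> K" using that by (auto simp: K_def in_cbox_complex_iff)
      have "norm (f (Complex x e) - f (Complex x 0)) \<le> M * norm (Complex x e - Complex x 0)"
      proof (rule field_differentiable_bound[OF K(2) _ M])
        show "(f has_field_derivative deriv f z) (at z within K)" if "z \<in> K" for z
          using holomorphic_derivI[OF f open_slit_plane] K(3) that by blast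
      qed (use xK in auto)
      also have "Complex x e - Complex x 0 = \<i> * of_real e" by (simp add: complex_eq_iff)
      also have "norm (\<i> * complex_of_real e) = e" using that by (simp add: norm_mult)
      finally have "norm (f (Complex x e) - f (Complex x 0)) \<le> M * e" .
      moreover have "Im (f (Complex x 0)) = 0" using real[of x] that ab by (simp add: complex_of_real_def)
      ultimately show ?thesis using abs_Im_le_cmod[of "f (Complex x e) - f (Complex x 0)"] by simp
    qed
    \<comment> \<open>Each of n intervals of half-length e = (b - a) / (2 n) contributes at most 2 e
      M e. The condition n \<ge> b - a keeps the points x + i e inside the rectangle.\<close>
    have bound: "measure \<mu> {a..b} \<le> M * (b - a)\<^sup>2 / 2 / real n" if n: "real n \<ge> b - a" "n \<ge> 1" for n :: nat
    proof -
      define h where "h = (b - a) / real n"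
      define e where "e = h / 2"
      define x where "x k = a + real k * h + e" for k :: nat
      have h: "0 < h" "h \<le> 1" "real n * h = b - a" using ab n by (auto simp: h_def field_simps)
      have cover: "{a..b} \<subseteq> (\<Union>k<n. {x k - e..x k + e})"
      proof
        fix t assume t: "t \<in> {a..b}"
        show "t \<in> (\<Union>k<n. {x k - e..x k + e})"
        proof (cases "t = b")
          case True
          have "real (n - 1) = real n - 1" using n by simp
          then have "b \<in> {x (n-1) - e..x (n-1) + e}" using h by (simp add: x_def e_def algebra_simps)
          then show ?thesis using n True by (intro UN_I[of "n - 1"]) auto
        next
          case False
          define k where "k = nat \<lfloor>(t - a) / h\<rfloor>"
          have q: "0 \<le> (t - a) / h" using t h by simp
          have k: "real k \<le> (t - a) / h" "(t - a) / h < real k + 1"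
            using q by (auto simp: k_def)
          have "(t - a) / h < real n" using t False h by (simp add: pos_divide_less_eq)
          then have "k < n" using k by linarith
          moreover have "t \<in> {x k - e..x k + e}" using k h by (simp add: x_def e_def field_simps)
          ultimately show ?thesis by blast
        qed
      qed
      have "measure \<mu> {a..b} \<le> measure \<mu> (\<Union>k<n. {x k - e..x k + e})"
        using cover by (intro finite_measure_mono) auto
      also have "\<dots> \<le> (\<Sum>k<n. measure \<mu> {x k - e..x k + e})"
        by (rule finite_measure_subadditive_finite) auto
      also have "\<dots> \<le> (\<Sum>k<n. 2 * e * (M * e))"
      proof (rule sum_mono)
        fix k assume "k \<in> {..<n}"
        then have "real (Suc k) * h \<le> real n * h" using h by (intro mult_right_mono) auto
        then have "x k \<le> b" using h by (simp add: x_def e_def algebra_simps)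
        moreover have "a \<le> x k" using h by (simp add: x_def e_def)
        ultimately have "Im (f (Complex (x k) e)) \<le> M * e" using h by (intro Im_le) (auto simp: e_def)
        then have "2 * e * Im (f (Complex (x k) e)) \<le> 2 * e * (M * e)" using h by (intro mult_left_mono) (auto simp: e_def)
        moreover have "measure \<mu> {x k - e..x k + e} \<le> 2 * e * Im (f (Complex (x k) e))"
          using h by (intro small) (simp add: e_def)
        ultimately show "measure \<mu> {x k - e..x k + e} \<le> 2 * e * (M * e)" by linarith
      qed
      also have "\<dots> = M * (real n * h)\<^sup>2 / 2 / real n" using n by (simp add: e_def power2_eq_square)
      finally show ?thesis by (simp add: h)
    qed
    obtain n0 :: nat where n0: "real n0 \<ge> b - a" using real_arch_simple by blast
    have "(\<lambda>n. M * (b - a)\<^sup>2 / 2 / real n) \<longlonglongrightarrow> 0" by real_asymp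
    then have "measure \<mu> {a..b} \<le> 0"
    proof (rule LIMSEQ_le_const)
      show "\<exists>N. \<forall>n\<ge>N. measure \<mu> {a..b} \<le> M * (b - a)\<^sup>2 / 2 / real n"
        using n0 by (intro exI[of _ "max n0 1"] allI impI bound) auto
    qed
    then show ?thesis by (simp add: emeasure_eq_measure measure_le_0_iff)
  qed
  have "{..<\<alpha>} = (\<Union>n. {\<alpha> - real n - 2..\<alpha> - 1 / real (Suc n)})"
  proof safe
    fix t assume t: "t < \<alpha>"
    obtain n1 where n1: "1 / real (Suc n1) < \<alpha> - t" using nat_approx_posE[of "\<alpha> - t"] t by auto
    obtain n2 :: nat where n2: "real n2 \<ge> \<alpha> - t" using real_arch_simple by blast
    have "1 / real (Suc (max n1 n2)) \<le> 1 / real (Suc n1)" by (intro divide_left_mono) auto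
    then have "t \<in> {\<alpha> - real (max n1 n2) - 2..\<alpha> - 1 / real (Suc (max n1 n2))}" using n1 n2 by auto
    then show "t \<in> (\<Union>n. {\<alpha> - real n - 2..\<alpha> - 1 / real (Suc n)})" by blast
  next
    fix t n assume "t \<in> {\<alpha> - real n - 2..\<alpha> - 1 / real (Suc n)}"
    moreover have "1 / real (Suc n) > 0" by simp
    ultimately show "t < \<alpha>" unfolding atLeastAtMost_iff by linarith
  qed
  moreover have "emeasure \<mu> {\<alpha> - real n - 2..\<alpha> - 1 / real (Suc n)} = 0" for n
  proof (rule zero)
    have "1 / real (Suc n) \<le> 1" by simp
    then show "\<alpha> - real n - 2 < \<alpha> - 1 / real (Suc n)" by linarith
  qed simp
  ultimately have "{..<\<alpha>} \<in> null_sets \<mu>" by (simp add: null_sets_UN null_setsI)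
  then show ?thesis by (intro AE_I'[of "{..<\<alpha>}"]) auto
qed

text \<open>Once the measure from \<open>Nevanlinna_representation\<close> is known to sit on the
  half-line, both sides of the formula are holomorphic on the connected slit plane and agree on the
  upper half-plane.\<close>

theorem Stieltjes_representation:
  assumes f: "f holomorphic_on slit_plane \<alpha>" and pos: "\<And>z. Im z > 0 \<Longrightarrow> 0 \<le> Im (f z)"
    and real: "\<And>x::real. x < \<alpha> \<Longrightarrow> Im (f (of_real x)) = 0"
    and bdd: "\<And>y. y \<ge> 1 \<Longrightarrow> y * norm (f (\<i> * of_real y)) \<le> C"
  obtains \<mu> where "half_line_measure \<mu> \<alpha>"
    "\<And>z. z \<in> slit_plane \<alpha> \<Longrightarrow> f z = (LINT t|\<mu>. inverse (of_real t - z))"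
proof -
  have f': "f holomorphic_on {z. Im z > 0}"
    by (rule holomorphic_on_subset[OF f]) (auto simp: slit_plane_iff)
  obtain \<mu> :: "real measure" where \<mu>: "finite_measure \<mu>" "sets \<mu> = sets borel"
    and rep: "\<And>z. Im z > 0 \<Longrightarrow> f z = (LINT t|\<mu>. inverse (of_real t - z))"
    using Nevanlinna_representation[OF f' pos bdd] by blast
  have AE: "AE t in \<mu>. t \<ge> \<alpha>" by (rule Stieltjes_support[OF \<mu> f real rep])
  interpret finite_measure \<mu> by (rule \<mu>)
  interpret half_line_measure \<mu> \<alpha> by unfold_locales (use \<mu> AE in auto)
  show thesis
  proof (rule that[of \<mu>])
    show "half_line_measure \<mu> \<alpha>" by unfold_locales
    fix z assume z: "z \<in> slit_plane \<alpha>"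
    have "f z - S z = 0"
    proof (rule analytic_continuation[where f = "\<lambda>z. f z - S z" and U = "{z. Im z > 0}" and \<xi> = \<i>, OF _ open_slit_plane connected_slit_plane])
      show "(\<lambda>z. f z - S z) holomorphic_on slit_plane \<alpha>" by (intro holomorphic_intros f S_holomorphic)
      show "{z. Im z > 0} \<subseteq> slit_plane \<alpha>" by (auto simp: slit_plane_iff)
      show "\<i> \<in> slit_plane \<alpha>" by (simp add: slit_plane_iff)
      show "\<i> islimpt {z. Im z > 0}" by (rule interior_limit_point) (simp add: interior_open open_halfspace_Im_gt)
      show "f w - S w = 0" if "w \<in> {z. Im z > 0}" for w using rep that by (simp add: S_def)
    qed (rule z)
    then show "f z = (LINT t|\<mu>. inverse (of_real t - z))" by (simp add: S_def)
  qed
qed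

section \<open>Uniqueness of the measure by Stieltjes inversion\<close>

lemma integrable_arctan:
  assumes "finite_measure M" "sets M = sets borel"
  shows "integrable M (\<lambda>t. arctan ((x - t) / y))"
proof (rule finite_measure.integrable_const_bound[OF assms(1) AE_I2, where B = "pi / 2"])
  show "norm (arctan ((x - t) / y)) \<le> pi / 2" for t
    using arctan_bounded[of "(x - t) / y"] unfolding real_norm_def by linarith
  show "(\<lambda>t. arctan ((x - t) / y)) \<in> borel_measurable M"
    by (subst measurable_cong_sets[OF assms(2) refl]) measurable
qed

text \<open>Inversion: up to the factor \<open>2 \<i>\<close>, the difference of the Stieltjes transform at \<open>x + \<i> y\<close> and
  \<open>x - \<i> y\<close> is the \<open>x\<close>-derivative of the integral of \<open>arctan ((x - t) / y)\<close>, and the limit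
  \<open>y \<rightarrow> 0\<close> of the increments of the latter yields the distribution function.\<close>
lemma arctan_integral_derivative:
  assumes M: "finite_measure M" "sets M = sets borel" and y: "y > 0"
  shows "((\<lambda>x. LINT t|M. arctan ((x - t) / y)) has_real_derivative
    (LINT t|M. y / ((x - t)\<^sup>2 + y\<^sup>2))) (at x)"
  unfolding has_field_derivative_iff tendsto_at_iff_sequentially
proof (intro allI impI)
  interpret finite_measure M by (rule M)
  note M(2)[measurable_cong]
  fix X :: "nat \<Rightarrow> real" assume X: "\<forall>i. X i \<in> UNIV - {x}" "X \<longlonglongrightarrow> x"
  have int: "integrable M (\<lambda>t. arctan ((x - t) / y))" for x
    by (rule integrable_arctan[OF M])
  have deriv: "((\<lambda>x. arctan ((x - t) / y)) has_real_derivative y / ((x - t)\<^sup>2 + y\<^sup>2)) (at x)" for t x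
    by (rule derivative_eq_intros refl | use y in \<open>simp add: field_simps power2_eq_square add_nonneg_eq_0_iff\<close>)+
  have deriv_bound: "norm (y / ((x - t)\<^sup>2 + y\<^sup>2)) \<le> 1 / y" for t x
  proof -
    have "y * y \<le> (x - t)\<^sup>2 + y\<^sup>2" by (simp add: power2_eq_square)
    then show ?thesis using y by (simp add: divide_simps add_nonneg_pos)
  qed
  have "(\<lambda>i. LINT t|M. (arctan ((X i - t) / y) - arctan ((x - t) / y)) / (X i - x)) \<longlonglongrightarrow>
     (LINT t|M. y / ((x - t)\<^sup>2 + y\<^sup>2))"
  proof (rule integral_dominated_convergence[where w = "\<lambda>_. 1 / y"])
    show "AE t in M. (\<lambda>i. (arctan ((X i - t) / y) - arctan ((x - t) / y)) / (X i - x)) \<longlonglongrightarrow> y / ((x - t)\<^sup>2 + y\<^sup>2)"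
    proof (rule AE_I2)
      fix t
      show "(\<lambda>i. (arctan ((X i - t) / y) - arctan ((x - t) / y)) / (X i - x)) \<longlonglongrightarrow> y / ((x - t)\<^sup>2 + y\<^sup>2)"
        using deriv[of t x] X unfolding has_field_derivative_iff tendsto_at_iff_sequentially
        by (auto simp: o_def)
    qed
    show "AE t in M. norm ((arctan ((X i - t) / y) - arctan ((x - t) / y)) / (X i - x)) \<le> 1 / y" for i
    proof (rule AE_I2)
      fix t
      have "norm (arctan ((X i - t) / y) - arctan ((x - t) / y)) \<le> 1 / y * norm (X i - x)"
        by (rule field_differentiable_bound[where S = UNIV, OF _ deriv deriv_bound]) auto
      moreover have "norm (X i - x) > 0" using X by simp
      ultimately show "norm ((arctan ((X i - t) / y) - arctan ((x - t) / y)) / (X i - x)) \<le> 1 / y"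
        unfolding norm_divide by (simp add: pos_divide_le_eq)
    qed
  qed auto
  then show "((\<lambda>z. ((LINT t|M. arctan ((z - t) / y)) - (LINT t|M. arctan ((x - t) / y))) / (z - x)) \<circ> X)
     \<longlonglongrightarrow> (LINT t|M. y / ((x - t)\<^sup>2 + y\<^sup>2))"
    using int by (simp add: o_def)
qed

text \<open>The height y = 1 / n^2 is negligible against the shift 1 / n of the right endpoint. The
  point t = b is therefore counted in full, without the half weight an endpoint usually gets, and
  the limit is the indicator of the closed half-line.\<close>

lemma arctan_step_tendsto:
  fixes b t :: real
  shows "(\<lambda>n. arctan ((b + 1 / real n - t) / (1 / (real n)\<^sup>2)) - arctan ((- real n - t) / (1 / (real n)\<^sup>2)))
    \<longlonglongrightarrow> pi * indicator {..b} t"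
proof -
  have "(\<lambda>n. arctan ((- real n - t) / (1 / (real n)\<^sup>2))) \<longlonglongrightarrow> - (pi / 2)"
    by real_asymp
  moreover have "(\<lambda>n. arctan ((b + 1 / real n - t) / (1 / (real n)\<^sup>2))) \<longlonglongrightarrow> pi * indicator {..b} t - pi / 2"
  proof -
    consider "t < b" | "t = b" | "t > b" by linarith
    then show ?thesis
    proof cases
      case 1
      define c where "c = b - t"
      have c: "c > 0" using 1 by (simp add: c_def)
      have "(\<lambda>n. arctan ((c + 1 / real n) / (1 / (real n)\<^sup>2))) \<longlonglongrightarrow> pi / 2" using c by real_asymp
      then show ?thesis using 1 by (simp add: c_def algebra_simps)
    next
      case 2
      have "(\<lambda>n. arctan ((1 / real n) / (1 / (real n)\<^sup>2))) \<longlonglongrightarrow> pi / 2" by real_asymp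
      then show ?thesis using 2 by simp
    next
      case 3
      define c where "c = b - t"
      have c: "c < 0" using 3 by (simp add: c_def)
      have "(\<lambda>n. arctan ((c + 1 / real n) / (1 / (real n)\<^sup>2))) \<longlonglongrightarrow> - (pi / 2)" using c by real_asymp
      then show ?thesis using 3 by (simp add: c_def algebra_simps)
    qed
  qed
  ultimately have "(\<lambda>n. arctan ((b + 1 / real n - t) / (1 / (real n)\<^sup>2)) - arctan ((- real n - t) / (1 / (real n)\<^sup>2)))
    \<longlonglongrightarrow> pi * indicator {..b} t - pi / 2 - - (pi / 2)" by (intro tendsto_diff)
  then show ?thesis by simp
qed

text \<open>Stated for complex combinations rather than for two measures, since polarization
  produces such combinations. The hypothesis at conjugate points gives a vanishing Poisson integral,
  hence a constant integral of arctan, hence vanishing distribution functions; half-lines generate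
  the Borel sets.\<close>

theorem Stieltjes_uniqueness:
  fixes M :: "'i \<Rightarrow> real measure" and c :: "'i \<Rightarrow> complex"
  assumes I: "finite I" and M: "\<And>i. i \<in> I \<Longrightarrow> finite_measure (M i)" "\<And>i. i \<in> I \<Longrightarrow> sets (M i) = sets borel"
    and eq: "\<And>z. Im z \<noteq> 0 \<Longrightarrow> (\<Sum>i\<in>I. c i * (LINT t|M i. inverse (of_real t - z))) = 0"
    and B: "B \<in> sets borel"
  shows "(\<Sum>i\<in>I. c i * of_real (measure (M i) B)) = 0"
proof -
  have space: "space (M i) = UNIV" if "i \<in> I" for i using sets_eq_imp_space_eq[OF M(2)[OF that]] by simp
  \<comment> \<open>The resolvents at x + i y and x - i y differ by 2 i y / ((x - t)^2 +
    y^2).\<close>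
  have poisson: "(\<Sum>i\<in>I. c i * of_real (LINT t|M i. y / ((x - t)\<^sup>2 + y\<^sup>2))) = 0" if y: "y > 0" for x y :: real
  proof -
    let ?z = "Complex x y"
    have z: "Im ?z \<noteq> 0" "Im (cnj ?z) \<noteq> 0" using y by auto
    have "2 * \<i> * of_real (LINT t|M i. y / ((x - t)\<^sup>2 + y\<^sup>2)) =
      (LINT t|M i. inverse (of_real t - ?z)) - (LINT t|M i. inverse (of_real t - cnj ?z))" if i: "i \<in> I" for i
    proof -
      have ptw: "inverse (of_real t - ?z) - inverse (of_real t - cnj ?z) = 2 * \<i> * of_real (y / ((x - t)\<^sup>2 + y\<^sup>2))" for t
      proof -
        have "of_real t - cnj ?z = cnj (of_real t - ?z)" by simp
        then have "inverse (of_real t - ?z) - inverse (of_real t - cnj ?z) = 2 * \<i> * of_real (Im (inverse (of_real t - ?z)))"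
          by (simp add: complex_eq_iff del: complex_cnj_diff)
        also have "Im (inverse (of_real t - ?z)) = y / ((x - t)\<^sup>2 + y\<^sup>2)"
          by (simp add: complex_of_real_def power2_commute[of t x])
        finally show ?thesis .
      qed
      have "(LINT t|M i. inverse (of_real t - ?z)) - (LINT t|M i. inverse (of_real t - cnj ?z))
        = (LINT t|M i. inverse (of_real t - ?z) - inverse (of_real t - cnj ?z))"
        using z by (intro Bochner_Integration.integral_diff[symmetric] integrable_resolvent M i)
      also have "\<dots> = 2 * \<i> * (LINT t|M i. of_real (y / ((x - t)\<^sup>2 + y\<^sup>2)))"
        unfolding ptw by (rule Bochner_Integration.integral_mult_right_zero)
      finally show ?thesis by (simp only: integral_complex_of_real)
    qed
    then have "(\<Sum>i\<in>I. c i * (2 * \<i> * of_real (LINT t|M i. y / ((x - t)\<^sup>2 + y\<^sup>2)))) =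
      (\<Sum>i\<in>I. c i * (LINT t|M i. inverse (of_real t - ?z))) - (\<Sum>i\<in>I. c i * (LINT t|M i. inverse (of_real t - cnj ?z)))"
      by (simp add: right_diff_distrib sum_subtractf)
    also have "\<dots> = 0" by (simp only: eq[OF z(1)] eq[OF z(2)] diff_self)
    finally have "2 * \<i> * (\<Sum>i\<in>I. c i * of_real (LINT t|M i. y / ((x - t)\<^sup>2 + y\<^sup>2))) = 0"
      by (simp add: sum_distrib_left mult_ac)
    then show ?thesis by simp
  qed
  have const: "(\<Sum>i\<in>I. c i * of_real (LINT t|M i. arctan ((a - t) / y))) = (\<Sum>i\<in>I. c i * of_real (LINT t|M i. arctan ((b - t) / y)))"
    if y: "y > 0" for a b y :: real
  proof -
    let ?\<Phi> = "\<lambda>x. \<Sum>i\<in>I. c i * of_real (LINT t|M i. arctan ((x - t) / y))"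
    have "(?\<Phi> has_vector_derivative (\<Sum>i\<in>I. c i * of_real (LINT t|M i. y / ((x - t)\<^sup>2 + y\<^sup>2)))) (at x)" for x
      using y by (intro has_vector_derivative_sum has_vector_derivative_mult_right has_vector_derivative_of_real
          arctan_integral_derivative M)
    then have "(?\<Phi> has_vector_derivative 0) (at x within UNIV)" for x using poisson[OF y] by simp
    then obtain k where "\<And>x. ?\<Phi> x = k"
      using has_vector_derivative_zero_constant[of UNIV ?\<Phi>] by auto
    then show ?thesis by simp
  qed
  have cdf: "(\<Sum>i\<in>I. c i * of_real (measure (M i) {..b})) = 0" for b
  proof -
    let ?g = "\<lambda>n t. arctan ((b + 1 / real n - t) / (1 / (real n)\<^sup>2)) - arctan ((- real n - t) / (1 / (real n)\<^sup>2))"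
    have "(\<lambda>n. \<Sum>i\<in>I. c i * of_real (LINT t|M i. ?g n t)) \<longlonglongrightarrow> (\<Sum>i\<in>I. c i * of_real (LINT t|M i. pi * indicator {..b} t))"
    proof (intro tendsto_intros)
      fix i assume i: "i \<in> I"
      interpret finite_measure "M i" by (rule M[OF i])
      note M(2)[OF i, measurable_cong]
      show "(\<lambda>n. LINT t|M i. ?g n t) \<longlonglongrightarrow> (LINT t|M i. pi * indicator {..b} t)"
      proof (rule integral_dominated_convergence[where w = "\<lambda>_. 2 * pi"])
        show "AE t in M i. (\<lambda>n. ?g n t) \<longlonglongrightarrow> pi * indicator {..b} t" using arctan_step_tendsto by simp
        have "\<bar>arctan u - arctan v\<bar> \<le> 2 * pi" for u v
          using arctan_bounded[of u] arctan_bounded[of v] by linarith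
        then show "AE t in M i. norm (?g n t) \<le> 2 * pi" for n by simp
      qed auto
    qed
    moreover have "(\<Sum>i\<in>I. c i * of_real (LINT t|M i. ?g n t)) = 0" if "n \<ge> 1" for n
    proof -
      have y: "1 / (real n)\<^sup>2 > 0" using that by simp
      have "(\<Sum>i\<in>I. c i * of_real (LINT t|M i. ?g n t)) =
        (\<Sum>i\<in>I. c i * of_real (LINT t|M i. arctan ((b + 1 / real n - t) / (1 / (real n)\<^sup>2)))
         - c i * of_real (LINT t|M i. arctan ((- real n - t) / (1 / (real n)\<^sup>2))))"
      proof (rule sum.cong)
        fix i assume i: "i \<in> I"
        interpret finite_measure "M i" by (rule M[OF i])
        note M(2)[OF i, measurable_cong]
        have "integrable (M i) (\<lambda>t. arctan ((x - t) / y))" for x y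
          by (rule integrable_arctan[OF M[OF i]])
        from Bochner_Integration.integral_diff[OF this this] show "c i * of_real (LINT t|M i. ?g n t) = c i * of_real (LINT t|M i. arctan ((b + 1 / real n - t) / (1 / (real n)\<^sup>2)))
         - c i * of_real (LINT t|M i. arctan ((- real n - t) / (1 / (real n)\<^sup>2)))"
          by (simp only: of_real_diff right_diff_distrib)
      qed simp
      also have "\<dots> = 0" unfolding sum_subtractf using const[OF y] by simp
      finally show ?thesis .
    qed
    then have "(\<lambda>n. \<Sum>i\<in>I. c i * of_real (LINT t|M i. ?g n t)) \<longlonglongrightarrow> 0"
      by (intro tendsto_eventually) (auto simp: eventually_sequentially)
    ultimately have "(\<Sum>i\<in>I. c i * of_real (LINT t|M i. pi * indicator {..b} t)) = 0"
      using LIMSEQ_unique by blast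
    then have "of_real pi * (\<Sum>i\<in>I. c i * of_real (measure (M i) {..b})) = 0"
      by (simp add: space sum_distrib_left mult_ac)
    then show ?thesis by simp
  qed
  have incr: "(\<lambda>n. \<Sum>i\<in>I. c i * of_real (measure (M i) (A n))) \<longlonglongrightarrow> (\<Sum>i\<in>I. c i * of_real (measure (M i) (\<Union>n. A n)))"
    if A: "incseq A" "range A \<subseteq> sets borel" for A :: "nat \<Rightarrow> real set"
  proof (intro tendsto_intros)
    fix i assume i: "i \<in> I"
    interpret finite_measure "M i" by (rule M[OF i])
    show "(\<lambda>n. measure (M i) (A n)) \<longlonglongrightarrow> measure (M i) (\<Union>n. A n)"
      using A M(2)[OF i] by (intro finite_Lim_measure_incseq) auto
  qed
  have total: "(\<Sum>i\<in>I. c i * of_real (measure (M i) UNIV)) = 0"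
  proof -
    have "(\<Union>n. {..real n}) = UNIV" using real_arch_simple by auto
    then have "(\<lambda>n::nat. 0::complex) \<longlonglongrightarrow> (\<Sum>i\<in>I. c i * of_real (measure (M i) UNIV))"
      using incr[of "\<lambda>n. {..real n}"] by (simp add: cdf incseq_def image_subset_iff)
    then show ?thesis by (simp add: LIMSEQ_const_iff)
  qed
  have borel: "sets borel = sigma_sets UNIV (range (\<lambda>a::real. {..a}))"
    by (simp add: borel_eq_atMost)
  have "Int_stable (range (\<lambda>a::real. {..a}))"
    by (auto simp: Int_stable_def)
  moreover have "range (\<lambda>a::real. {..a}) \<subseteq> Pow UNIV" by simp
  moreover have "B \<in> sigma_sets UNIV (range (\<lambda>a::real. {..a}))" using B borel by simp
  ultimately show ?thesis
  proof (induction rule: sigma_sets_induct_disjoint)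
    case (basic A)
    then show ?case using cdf by auto
  next
    case empty
    then show ?case by simp
  next
    case (compl A)
    have "measure (M i) (UNIV - A) = measure (M i) UNIV - measure (M i) A" if i: "i \<in> I" for i
    proof -
      interpret finite_measure "M i" by (rule M[OF i])
      show ?thesis using finite_measure_compl[of A] compl.hyps M(2)[OF i] by (simp add: borel space[OF i])
    qed
    then have "(\<Sum>i\<in>I. c i * of_real (measure (M i) (UNIV - A))) =
      (\<Sum>i\<in>I. c i * of_real (measure (M i) UNIV)) - (\<Sum>i\<in>I. c i * of_real (measure (M i) A))"
      by (simp add: right_diff_distrib sum_subtractf)
    then show ?case using compl.IH total by simp
  next
    case (union A)
    have "(\<lambda>n. \<Sum>i\<in>I. c i * of_real (measure (M i) (A n))) sums (\<Sum>i\<in>I. c i * of_real (measure (M i) (\<Union>n. A n)))"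
    proof (intro sums_sum sums_mult sums_of_real)
      fix i assume i: "i \<in> I"
      interpret finite_measure "M i" by (rule M[OF i])
      show "(\<lambda>n. measure (M i) (A n)) sums measure (M i) (\<Union>n. A n)"
        using union.hyps M(2)[OF i] by (intro finite_measure_UNION) (auto simp: borel)
    qed
    then show ?case unfolding union.IH by (rule sums_unique2[OF _ sums_zero])
  qed
qed

section \<open>The matrix measure of a Stieltjes function\<close>

lemma sums_matrix:
  fixes f :: "nat \<Rightarrow> complex^'n^'m"
  assumes "\<And>i j. (\<lambda>k. f k $ i $ j) sums (s $ i $ j)"
  shows "f sums s"
  using assms unfolding sums_def by (auto intro!: vec_tendstoI simp: sum_component)

lemma sets_borel_from_iff: "B \<in> sets (borel_from \<alpha>) \<longleftrightarrow> B \<in> sets borel \<and> B \<subseteq> {\<alpha>..}"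
  by (subst sets_restrict_space_iff) auto

lemma bounded_linear_Re_qf: "bounded_linear (\<lambda>A :: complex^'n^'n. Re (qf A x))"
proof (rule linear_conv_bounded_linear[THEN iffD1], rule linearI)
  show "Re (qf (A + B) x) = Re (qf A x) + Re (qf B x)" for A B :: "complex^'n^'n"
    by (simp add: matrix_vector_mult_add_rdistrib cdot_add_right)
  show "Re (qf (r *\<^sub>R A) x) = r *\<^sub>R Re (qf A x)" for r and A :: "complex^'n^'n"
    by (simp add: scaleR_mat_vec cdot_scale_right)
qed

text \<open>The extension of the scalar measure by zero to the Borel sets of the line, which makes
  it a \<open>half_line_measure\<close>.\<close>

definition ext_measure :: "real \<Rightarrow> (real set \<Rightarrow> complex^'q^'q) \<Rightarrow> complex^'q \<Rightarrow> real measure" where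
  "ext_measure \<alpha> \<sigma> x = distr (quad_measure \<alpha> \<sigma> x) borel (\<lambda>t. t)"

context
  fixes \<alpha> :: real and \<sigma> :: "real set \<Rightarrow> complex^'q^'q"
  assumes \<sigma>: "nonneg_herm_measure \<alpha> \<sigma>"
begin

lemma herm_measure_nonneg: "B \<in> sets (borel_from \<alpha>) \<Longrightarrow> nonneg_herm (\<sigma> B)"
  using \<sigma> by (simp add: nonneg_herm_measure_def)

lemma herm_measure_sums:
  "range A \<subseteq> sets (borel_from \<alpha>) \<Longrightarrow> disjoint_family A \<Longrightarrow> (\<lambda>n. \<sigma> (A n)) sums \<sigma> (\<Union>n. A n)"
  using \<sigma> by (simp add: nonneg_herm_measure_def)

lemma herm_measure_outside: "B \<notin> sets (borel_from \<alpha>) \<Longrightarrow> \<sigma> B = 0"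
  using \<sigma> by (simp add: nonneg_herm_measure_def)

lemma herm_measure_empty: "\<sigma> {} = 0"
proof -
  have "(\<lambda>n::nat. \<sigma> {}) sums \<sigma> (\<Union>n::nat. {})"
    by (rule herm_measure_sums) (auto simp: disjoint_family_on_def)
  then have "(\<lambda>n::nat. \<sigma> {}) \<longlonglongrightarrow> 0" by (intro summable_LIMSEQ_zero) (rule sums_summable)
  then show ?thesis by (simp add: LIMSEQ_const_iff)
qed

lemma sets_quad_measure: "sets (quad_measure \<alpha> \<sigma> x) = sets (borel_from \<alpha>)"
  and space_quad_measure: "space (quad_measure \<alpha> \<sigma> x) = {\<alpha>..}"
proof -
  have sub: "sets (borel_from \<alpha>) \<subseteq> Pow {\<alpha>..}" by (auto simp: sets_borel_from_iff)
  have "sigma_sets {\<alpha>..} (sets (borel_from \<alpha>)) = sets (borel_from \<alpha>)"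
    using sets.sigma_sets_eq[of "borel_from \<alpha>"] by (simp add: space_restrict_space)
  then show "sets (quad_measure \<alpha> \<sigma> x) = sets (borel_from \<alpha>)"
    unfolding quad_measure_def using sub by (simp add: sets_measure_of)
  show "space (quad_measure \<alpha> \<sigma> x) = {\<alpha>..}"
    unfolding quad_measure_def using sub by (simp add: space_measure_of)
qed

lemma emeasure_quad_measure:
  assumes B: "B \<in> sets (borel_from \<alpha>)"
  shows "emeasure (quad_measure \<alpha> \<sigma> x) B = ennreal (Re (qf (\<sigma> B) x))"
proof (rule emeasure_measure_of[OF quad_measure_def])
  show "sets (borel_from \<alpha>) \<subseteq> Pow {\<alpha>..}" by (auto simp: sets_borel_from_iff)
  show "B \<in> sets (quad_measure \<alpha> \<sigma> x)" using B by (simp add: sets_quad_measure)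
  show "positive (sets (quad_measure \<alpha> \<sigma> x)) (\<lambda>B. ennreal (Re (qf (\<sigma> B) x)))"
    by (simp add: positive_def herm_measure_empty)
  show "countably_additive (sets (quad_measure \<alpha> \<sigma> x)) (\<lambda>B. ennreal (Re (qf (\<sigma> B) x)))"
    unfolding countably_additive_def sets_quad_measure
  proof (intro allI impI)
    fix A :: "nat \<Rightarrow> real set"
    assume A: "range A \<subseteq> sets (borel_from \<alpha>)" "disjoint_family A"
    have "(\<lambda>n. Re (qf (\<sigma> (A n)) x)) sums Re (qf (\<sigma> (\<Union>n. A n)) x)"
      by (rule bounded_linear.sums[OF bounded_linear_Re_qf herm_measure_sums[OF A]])
    moreover have "0 \<le> Re (qf (\<sigma> (A n)) x)" for n
      using A by (intro nonneg_hermD herm_measure_nonneg) auto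
    ultimately show "(\<Sum>i. ennreal (Re (qf (\<sigma> (A i)) x))) = ennreal (Re (qf (\<sigma> (\<Union> (range A))) x))"
      by (intro suminf_ennreal_eq)
  qed
qed

lemma id_measurable_quad: "(\<lambda>t. t) \<in> measurable (quad_measure \<alpha> \<sigma> x) borel"
  by (subst measurable_cong_sets[OF sets_quad_measure refl]) (rule measurable_restrict_space1, simp)

lemma sets_ext_measure: "sets (ext_measure \<alpha> \<sigma> x) = sets borel"
  by (simp add: ext_measure_def)

lemma emeasure_ext_measure:
  assumes "B \<in> sets borel"
  shows "emeasure (ext_measure \<alpha> \<sigma> x) B = ennreal (Re (qf (\<sigma> (B \<inter> {\<alpha>..})) x))"
  unfolding ext_measure_def using assms
  by (subst emeasure_distr[OF id_measurable_quad])
    (auto simp: space_quad_measure sets_borel_from_iff intro!: emeasure_quad_measure)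

lemma measure_ext_measure:
  assumes "B \<in> sets borel"
  shows "measure (ext_measure \<alpha> \<sigma> x) B = Re (qf (\<sigma> (B \<inter> {\<alpha>..})) x)"
  unfolding measure_def emeasure_ext_measure[OF assms] using assms
  by (intro enn2real_ennreal nonneg_hermD herm_measure_nonneg) (auto simp: sets_borel_from_iff)

lemma half_line_ext_measure: "half_line_measure (ext_measure \<alpha> \<sigma> x) \<alpha>"
proof -
  have "finite_measure (ext_measure \<alpha> \<sigma> x)"
    by (rule finite_measureI) (simp add: emeasure_ext_measure sets_eq_imp_space_eq[OF sets_ext_measure])
  then interpret finite_measure "ext_measure \<alpha> \<sigma> x" .
  show ?thesis
  proof unfold_locales
    have "emeasure (ext_measure \<alpha> \<sigma> x) {..<\<alpha>} = 0"
      by (subst emeasure_ext_measure) (auto simp: herm_measure_empty Int_def not_le[symmetric])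
    then show "AE t in ext_measure \<alpha> \<sigma> x. t \<ge> \<alpha>"
      by (intro AE_I[of _ _ "{..<\<alpha>}"]) (auto simp: sets_ext_measure)
  qed (rule sets_ext_measure)
qed

lemma has_mm_integral_iff:
  assumes "f \<in> borel_measurable borel"
  shows "has_mm_integral \<alpha> \<sigma> f M \<longleftrightarrow> (\<forall>x. has_bochner_integral (ext_measure \<alpha> \<sigma> x) f (qf M x))"
  unfolding has_mm_integral_def ext_measure_def has_bochner_integral_iff
  by (simp add: integrable_distr_eq[OF id_measurable_quad assms] integral_distr[OF id_measurable_quad assms])

end

text \<open>The entries of the matrix measure are forced by polarization. What has to be shown is
  that the scalar measures really depend on x as a quadratic form: their Stieltjes transforms do,
  being forms of F(z), and \<open>Stieltjes_uniqueness\<close> carries this linear relation over to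
  the measures.\<close>

lemma matrix_measure_exists:
  fixes \<mu> :: "complex^'q \<Rightarrow> real measure" and F :: "complex \<Rightarrow> complex^'q^'q"
  assumes \<mu>: "\<And>x. half_line_measure (\<mu> x) \<alpha>"
    and rep: "\<And>x z. z \<in> slit_plane \<alpha> \<Longrightarrow> qf (F z) x = (LINT t|\<mu> x. inverse (of_real t - z))"
  obtains \<sigma> where "nonneg_herm_measure \<alpha> \<sigma>" "\<And>x. ext_measure \<alpha> \<sigma> x = \<mu> x"
proof -
  interpret \<mu>: half_line_measure "\<mu> x" \<alpha> for x by (rule \<mu>)
  define v :: "'q \<Rightarrow> 'q \<Rightarrow> nat \<Rightarrow> complex^'q" where "v i j p = axis i 1 + \<i>^p *s axis j 1" for i j p
  define \<sigma> :: "real set \<Rightarrow> complex^'q^'q" where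
    "\<sigma> B = (if B \<in> sets (borel_from \<alpha>)
       then \<chi> i j. \<Sum>p<4. (-\<i>)^p / 4 * of_real (measure (\<mu> (v i j p)) B) else 0)" for B
  have qf: "qf (\<sigma> B) x = of_real (measure (\<mu> x) B)" if B: "B \<in> sets (borel_from \<alpha>)" for B x
  proof -
    \<comment> \<open>\<open>None\<close> stands for the measure in the direction x, with
      coefficient - 1, and \<open>Some (i, j, p)\<close> for the polarization vectors. The sum
      vanishes exactly when the form of the assembled matrix at x is the given measure.\<close>
    define I :: "('q \<times> 'q \<times> nat) option set" where "I = insert None (Some ` (UNIV \<times> UNIV \<times> {..<4}))"
    define M where "M k = (case k of None \<Rightarrow> \<mu> x | Some (i, j, p) \<Rightarrow> \<mu> (v i j p))" for k
    define c where "c k = (case k of None \<Rightarrow> - 1 | Some (i, j, p) \<Rightarrow> cnj (x $ i) * x $ j * ((-\<i>)^p / 4))" for k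
    have sum_I: "(\<Sum>k\<in>I. c k * g (M k)) =
      (\<Sum>i\<in>UNIV. \<Sum>j\<in>UNIV. cnj (x $ i) * x $ j * (\<Sum>p<4. (-\<i>)^p / 4 * g (\<mu> (v i j p)))) - g (\<mu> x)" for g :: "real measure \<Rightarrow> complex"
    proof -
      have "(\<Sum>k\<in>I. c k * g (M k)) = - g (\<mu> x) + (\<Sum>k\<in>UNIV \<times> UNIV \<times> {..<4}. c (Some k) * g (M (Some k)))"
        unfolding I_def by (subst sum.insert) (auto simp: sum.reindex c_def M_def)
      also have "(\<Sum>k\<in>UNIV \<times> UNIV \<times> {..<4}. c (Some k) * g (M (Some k))) =
         (\<Sum>i\<in>UNIV. \<Sum>j\<in>UNIV. \<Sum>p<4. cnj (x $ i) * x $ j * ((-\<i>)^p / 4) * g (\<mu> (v i j p)))"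
        by (simp add: sum.cartesian_product' c_def M_def)
      finally show ?thesis by (simp add: sum_distrib_left mult_ac)
    qed
    have "(\<Sum>k\<in>I. c k * of_real (measure (M k) B)) = 0"
    proof (rule Stieltjes_uniqueness)
      show "finite I" by (simp add: I_def)
      show "finite_measure (M k)" "sets (M k) = sets borel" for k
        using \<mu>.finite_measure_axioms \<mu>.sets_eq by (auto simp: M_def split: option.split prod.split)
      show "B \<in> sets borel" using B by (simp add: sets_borel_from_iff)
      fix z :: complex assume "Im z \<noteq> 0"
      then have z: "z \<in> slit_plane \<alpha>" by (simp add: slit_plane_iff)
      have entry: "(\<Sum>p<4. (-\<i>)^p / 4 * qf (F z) (v i j p)) = F z $ i $ j" for i j
        unfolding v_def by (rule entry_polarization[symmetric])
      have "(\<Sum>k\<in>I. c k * (LINT t|M k. inverse (of_real t - z))) =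
        (\<Sum>i\<in>UNIV. \<Sum>j\<in>UNIV. cnj (x $ i) * x $ j * (\<Sum>p<4. (-\<i>)^p / 4 * qf (F z) (v i j p))) - qf (F z) x"
        by (simp add: sum_I[of "\<lambda>M. LINT t|M. inverse (of_real t - z)"] rep[OF z])
      also have "\<dots> = 0"
        unfolding entry by (simp add: qf_entries[where A = "F z" and x = x])
      finally show "(\<Sum>k\<in>I. c k * (LINT t|M k. inverse (of_real t - z))) = 0" .
    qed
    then have "(\<Sum>i\<in>UNIV. \<Sum>j\<in>UNIV. cnj (x $ i) * x $ j * (\<Sum>p<4. (-\<i>)^p / 4 * of_real (measure (\<mu> (v i j p)) B)))
        = of_real (measure (\<mu> x) B)"
      by (simp add: sum_I[of "\<lambda>M. of_real (measure M B)"])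
    then show ?thesis unfolding qf_entries using B by (simp add: \<sigma>_def)
  qed
  have \<sigma>: "nonneg_herm_measure \<alpha> \<sigma>"
    unfolding nonneg_herm_measure_def
  proof (intro conjI ballI allI impI)
    show "nonneg_herm (\<sigma> B)" if "B \<in> sets (borel_from \<alpha>)" for B
      by (simp add: nonneg_herm_iff qf[OF that])
    show "\<sigma> B = 0" if "B \<notin> sets (borel_from \<alpha>)" for B using that by (simp add: \<sigma>_def)
    fix A :: "nat \<Rightarrow> real set" assume A: "range A \<subseteq> sets (borel_from \<alpha>)" "disjoint_family A"
    then have UA: "(\<Union>n. A n) \<in> sets (borel_from \<alpha>)" and An: "\<And>n. A n \<in> sets (borel_from \<alpha>)" by auto
    show "(\<lambda>n. \<sigma> (A n)) sums \<sigma> (\<Union>n. A n)"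
    proof (rule sums_matrix)
      fix i j
      have "(\<lambda>n. \<Sum>p<4. (-\<i>)^p / 4 * of_real (measure (\<mu> (v i j p)) (A n))) sums
         (\<Sum>p<4. (-\<i>)^p / 4 * of_real (measure (\<mu> (v i j p)) (\<Union>n. A n)))"
      proof (intro sums_sum sums_mult sums_of_real)
        show "(\<lambda>n. measure (\<mu> (v i j p)) (A n)) sums measure (\<mu> (v i j p)) (\<Union>n. A n)" for p
          using A An by (intro \<mu>.finite_measure_UNION) (auto simp: \<mu>.sets_eq sets_borel_from_iff)
      qed
      then show "(\<lambda>n. \<sigma> (A n) $ i $ j) sums (\<sigma> (\<Union>n. A n) $ i $ j)"
        using UA An by (simp add: \<sigma>_def)
    qed
  qed
  show thesis
  proof (rule that[OF \<sigma>], rule measure_eqI)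
    fix x
    show "sets (ext_measure \<alpha> \<sigma> x) = sets (\<mu> x)" by (simp add: sets_ext_measure[OF \<sigma>] \<mu>.sets_eq)
    fix B assume "B \<in> sets (ext_measure \<alpha> \<sigma> x)"
    then have B: "B \<in> sets borel" by (simp add: sets_ext_measure[OF \<sigma>])
    have "emeasure (ext_measure \<alpha> \<sigma> x) B = ennreal (measure (\<mu> x) (B \<inter> {\<alpha>..}))"
      using B by (simp add: emeasure_ext_measure[OF \<sigma> B] qf sets_borel_from_iff)
    also have "\<dots> = emeasure (\<mu> x) (B \<inter> {\<alpha>..})" by (simp add: \<mu>.emeasure_eq_measure)
    also have "\<dots> = emeasure (\<mu> x) B"
      using \<mu>.AE_ge[of x] B by (intro emeasure_eq_AE) (auto simp: \<mu>.sets_eq)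
    finally show "emeasure (ext_measure \<alpha> \<sigma> x) B = emeasure (\<mu> x) B" .
  qed
qed

text \<open>In each direction the two scalar measures have the same Stieltjes transform, so
  \<open>Stieltjes_uniqueness\<close> applies with coefficients 1 and - 1. Off the Borel subsets of
  the half-line both set functions are zero.\<close>

lemma herm_measure_unique:
  assumes "nonneg_herm_measure \<alpha> \<sigma>" "nonneg_herm_measure \<alpha> \<sigma>'"
    and "\<And>z. z \<in> slit_plane \<alpha> \<Longrightarrow> has_mm_integral \<alpha> \<sigma> (\<lambda>t. inverse (of_real t - z)) (F z)"
    and "\<And>z. z \<in> slit_plane \<alpha> \<Longrightarrow> has_mm_integral \<alpha> \<sigma>' (\<lambda>t. inverse (of_real t - z)) (F z)"
  shows "\<sigma> = \<sigma>'"
proof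
  fix B
  show "\<sigma> B = \<sigma>' B"
  proof (cases "B \<in> sets (borel_from \<alpha>)")
    case True
    show ?thesis
    proof (rule matrix_eq_if_qf_eq)
      fix x
      define M where "M b = ext_measure \<alpha> (if b then \<sigma> else \<sigma>') x" for b
      define c :: "bool \<Rightarrow> complex" where "c b = (if b then 1 else -1)" for b
      have "(\<Sum>b\<in>{True, False}. c b * of_real (measure (M b) B)) = 0"
      proof (rule Stieltjes_uniqueness)
        have "half_line_measure (M b) \<alpha>" for b
          using half_line_ext_measure[OF assms(1)] half_line_ext_measure[OF assms(2)] by (simp add: M_def)
        then show "finite_measure (M b)" "sets (M b) = sets borel" for b
          by (auto simp: half_line_measure_def half_line_measure_axioms_def)
        show "B \<in> sets borel" using True by (simp add: sets_borel_from_iff)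
        fix z :: complex assume "Im z \<noteq> 0"
        then have z: "z \<in> slit_plane \<alpha>" by (simp add: slit_plane_iff)
        have "(LINT t|M b. inverse (of_real t - z)) = qf (F z) x" for b
          using assms(3)[OF z] assms(4)[OF z]
          by (auto simp: M_def has_mm_integral_iff[OF assms(1)] has_mm_integral_iff[OF assms(2)]
              intro!: has_bochner_integral_integral_eq)
        then show "(\<Sum>b\<in>{True, False}. c b * (LINT t|M b. inverse (of_real t - z))) = 0" by (simp add: c_def)
      qed simp
      then have "measure (M True) B = measure (M False) B" by (simp add: c_def)
      then have "Re (qf (\<sigma> B) x) = Re (qf (\<sigma>' B) x)"
        using True by (simp add: M_def measure_ext_measure[OF assms(1)] measure_ext_measure[OF assms(2)]
            sets_borel_from_iff Int_absorb2)
      then show "qf (\<sigma> B) x = qf (\<sigma>' B) x"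
        using herm_measure_nonneg[OF assms(1) True] herm_measure_nonneg[OF assms(2) True] by (simp add: complex_eq_iff nonneg_hermD)
    qed
  qed (simp add: herm_measure_outside[OF assms(1)] herm_measure_outside[OF assms(2)])
qed

lemma stieltjes_measure_eqI:
  assumes "nonneg_herm_measure \<alpha> \<sigma>"
    and "\<And>z. z \<in> slit_plane \<alpha> \<Longrightarrow> has_mm_integral \<alpha> \<sigma> (\<lambda>t. inverse (of_real t - z)) (F z)"
  shows "stieltjes_measure \<alpha> F = \<sigma>"
  unfolding stieltjes_measure_def
  using assms herm_measure_unique[OF _ assms(1) _ assms(2)] by (intro the_equality) blast+

lemma norm_qf_le: "norm (qf A x) \<le> op_norm A * (norm x)\<^sup>2"
proof -
  have cs: "norm (cdot x y) \<le> norm x * norm y" for x y :: "complex^'n"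
  proof (cases "cdot x y = 0")
    case False
    \<comment> \<open>A phase that makes \<open>cdot x (w *s y)\<close> real and nonnegative, so
      that the real Cauchy-Schwarz inequality applies.\<close>
    define w where "w = cnj (cdot x y) / norm (cdot x y)"
    have "norm w = 1" using False by (simp add: w_def norm_divide)
    have "complex_of_real (norm (cdot x y)) = cdot x (w *s y)"
      using False by (simp add: cdot_scale_right w_def complex_norm_square[symmetric] mult.commute power2_eq_square)
    then have "norm (cdot x y) = inner x (w *s y)" by (metis Re_cdot_eq_inner Re_complex_of_real)
    also have "\<dots> \<le> norm x * norm (w *s y)" by (rule norm_cauchy_schwarz)
    also have "norm (w *s y) = norm y"
      using \<open>norm w = 1\<close> by (simp add: norm_vec_def norm_mult)
    finally show ?thesis .
  qed simp
  have "norm (qf A x) \<le> norm x * norm (A *v x)" by (rule cs)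
  also have "\<dots> \<le> norm x * (op_norm A * norm x)"
    unfolding op_norm_def by (intro mult_left_mono onorm[OF matrix_vector_mul_bounded_linear]) simp
  finally show ?thesis by (simp add: power2_eq_square mult_ac)
qed

text \<open>Makes the definite description of the measure of F meaningful: every form of F is a
  scalar Stieltjes function with its own measure, and these are assembled into a matrix
  measure.\<close>

theorem stieltjes_measure:
  assumes F: "F \<in> S0_class \<alpha>"
  shows "nonneg_herm_measure \<alpha> (stieltjes_measure \<alpha> F)"
    and "\<And>z. z \<in> slit_plane \<alpha> \<Longrightarrow>
      has_mm_integral \<alpha> (stieltjes_measure \<alpha> F) (\<lambda>t. inverse (of_real t - z)) (F z)"
proof -
  have S: "F \<in> S_class \<alpha>" and "bdd_above ((\<lambda>y. y * op_norm (F (\<i> * complex_of_real y))) ` {1..})"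
    using F by (auto simp: S0_class_def)
  then obtain C where C: "\<And>y. y \<ge> 1 \<Longrightarrow> y * op_norm (F (\<i> * complex_of_real y)) \<le> C"
    by (auto simp: bdd_above_def)
  have "\<exists>\<mu>. half_line_measure \<mu> \<alpha> \<and> (\<forall>z\<in>slit_plane \<alpha>. qf (F z) x = (LINT t|\<mu>. inverse (of_real t - z)))" for x
  proof -
    have "(\<lambda>z. qf (F z) x) holomorphic_on slit_plane \<alpha>"
      unfolding qf_entries using S by (intro holomorphic_intros) (auto simp: S_class_def)
    moreover have "0 \<le> Im (qf (F z) x)" if "Im z > 0" for z
      using S that by (simp add: S_class_def nonneg_herm_im_part_iff)
    moreover have "Im (qf (F (of_real w)) x) = 0" if "w < \<alpha>" for w
    proof -
      have "nonneg_herm (F (of_real w))" using S that by (simp add: S_class_def)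
      then show ?thesis by (rule nonneg_hermD(3))
    qed
    moreover have "y * norm (qf (F (\<i> * of_real y)) x) \<le> C * (norm x)\<^sup>2" if "y \<ge> 1" for y
    proof -
      have "y * norm (qf (F (\<i> * of_real y)) x) \<le> y * (op_norm (F (\<i> * of_real y)) * (norm x)\<^sup>2)"
        using that by (intro mult_left_mono norm_qf_le) auto
      also have "\<dots> \<le> C * (norm x)\<^sup>2"
        using mult_right_mono[OF C[OF that], of "(norm x)\<^sup>2"] by (simp add: mult_ac)
      finally show ?thesis .
    qed
    ultimately obtain \<mu> where "half_line_measure \<mu> \<alpha>"
        "\<And>z. z \<in> slit_plane \<alpha> \<Longrightarrow> qf (F z) x = (LINT t|\<mu>. inverse (of_real t - z))"
      using Stieltjes_representation[of "\<lambda>z. qf (F z) x" \<alpha> "C * (norm x)\<^sup>2"] by blast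
    then show ?thesis by blast
  qed
  then obtain \<mu> where \<mu>: "\<And>x. half_line_measure (\<mu> x) \<alpha>"
    "\<And>x z. z \<in> slit_plane \<alpha> \<Longrightarrow> qf (F z) x = (LINT t|\<mu> x. inverse (of_real t - z))" by metis
  obtain \<sigma> where \<sigma>: "nonneg_herm_measure \<alpha> \<sigma>" "\<And>x. ext_measure \<alpha> \<sigma> x = \<mu> x"
    using matrix_measure_exists[of \<mu>, OF \<mu>] by blast
  have rep: "has_mm_integral \<alpha> \<sigma> (\<lambda>t. inverse (of_real t - z)) (F z)" if "z \<in> slit_plane \<alpha>" for z
    using half_line_measure.integrable_slit_resolvent[OF \<mu>(1) that]
    by (simp add: has_mm_integral_iff[OF \<sigma>(1)] \<sigma>(2) has_bochner_integral_iff \<mu>(2)[OF that])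
  have "stieltjes_measure \<alpha> F = \<sigma>" by (rule stieltjes_measure_eqI[OF \<sigma>(1) rep])
  then show "nonneg_herm_measure \<alpha> (stieltjes_measure \<alpha> F)"
    "\<And>z. z \<in> slit_plane \<alpha> \<Longrightarrow>
      has_mm_integral \<alpha> (stieltjes_measure \<alpha> F) (\<lambda>t. inverse (of_real t - z)) (F z)"
    using \<sigma>(1) rep by auto
qed

section \<open>Moments and asymptotic expansions\<close>

text \<open>An expansion f = - sum c_j z^(-j-1) + o(z^(-n-1)) along the imaginary axis. The sign is
  that of 1 / (t - z) = - sum t^j z^(-j-1), so c_j plays the part of the j-th moment.\<close>

definition expands_at_infinity :: "(complex \<Rightarrow> complex) \<Rightarrow> (nat \<Rightarrow> complex) \<Rightarrow> nat \<Rightarrow> bool" where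
  "expands_at_infinity f c n \<longleftrightarrow>
     ((\<lambda>y. (\<i> * of_real y)^(n + 1) * (f (\<i> * of_real y) + (\<Sum>j\<le>n. c j * inverse (\<i> * of_real y)^(j + 1)))) \<longlongrightarrow> 0) at_top"

lemma inverse_i_tendsto: "((\<lambda>y. inverse (\<i> * complex_of_real y)) \<longlongrightarrow> 0) at_top"
proof -
  have "((\<lambda>y. norm (inverse (\<i> * complex_of_real y))) \<longlongrightarrow> 0) at_top"
    by (simp add: norm_inverse norm_mult) real_asymp
  then show ?thesis by (rule tendsto_norm_zero_cancel)
qed

lemma sum_atMost_split: "(\<Sum>j\<le>k. f j) = (\<Sum>j<k. f j) + f (k :: nat)" for f :: "nat \<Rightarrow> 'a :: comm_monoid_add"
  by (simp flip: lessThan_Suc_atMost)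

lemma power_mult_inverse_power: "z \<noteq> 0 \<Longrightarrow> z ^ n * inverse z ^ n = (1 :: 'a :: field)"
  by (simp flip: power_mult_distrib)

lemma expands_at_infinity_less:
  assumes "expands_at_infinity f c n" "k \<le> n"
  shows "expands_at_infinity f c k"
  using assms(2,1)
proof (induction rule: inc_induct)
  case (step k)
  let ?z = "\<lambda>y::real. \<i> * complex_of_real y"
  let ?F = "\<lambda>y. inverse (?z y) * (?z y^(Suc k + 1) * (f (?z y) + (\<Sum>j\<le>Suc k. c j * inverse (?z y)^(j + 1)))) - c (Suc k) * inverse (?z y)"
  have "(?F \<longlongrightarrow> 0 * 0 - c (Suc k) * 0) at_top"
    using step.IH[OF step.prems] unfolding expands_at_infinity_def
    by (intro tendsto_intros inverse_i_tendsto)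
  then have "(?F \<longlongrightarrow> 0) at_top" by (simp only: mult_zero_right diff_zero)
  then have "((\<lambda>y. ?z y^(k + 1) * (f (?z y) + (\<Sum>j\<le>k. c j * inverse (?z y)^(j + 1)))) \<longlongrightarrow> 0) at_top"
  proof (rule Lim_transform_eventually)
    show "\<forall>\<^sub>F y in at_top. inverse (?z y) * (?z y^(Suc k + 1) * (f (?z y) + (\<Sum>j\<le>Suc k. c j * inverse (?z y)^(j + 1)))) - c (Suc k) * inverse (?z y)
       = ?z y^(k + 1) * (f (?z y) + (\<Sum>j\<le>k. c j * inverse (?z y)^(j + 1)))"
      using eventually_gt_at_top[of 0]
    proof eventually_elim
      fix y :: real assume "y > 0"
      then have z: "?z y \<noteq> 0" by simp
      define z where "z = ?z y"
      define R where "R = f z + (\<Sum>j\<le>k. c j * inverse z^(j + 1))"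
      have "z^(Suc k + 1) * inverse z^(Suc k + 1) = 1"
        using z unfolding z_def by (rule power_mult_inverse_power)
      then have "inverse z * (z^(Suc k + 1) * (R + c (Suc k) * inverse z^(Suc k + 1))) - c (Suc k) * inverse z
        = inverse z * z * z^(k + 1) * R"
        by (simp only: distrib_left mult.left_commute[of "z^(Suc k + 1)" "c (Suc k)"]) (simp add: mult_ac)
      also have "inverse z * z = 1" using z unfolding z_def by (rule left_inverse)
      also have "1 * z^(k + 1) * R = z^(k + 1) * R" by simp
      finally show "inverse (?z y) * (?z y^(Suc k + 1) * (f (?z y) + (\<Sum>j\<le>Suc k. c j * inverse (?z y)^(j + 1)))) - c (Suc k) * inverse (?z y)
       = ?z y^(k + 1) * (f (?z y) + (\<Sum>j\<le>k. c j * inverse (?z y)^(j + 1)))"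
        by (simp add: R_def z_def[symmetric] add.assoc)
    qed
  qed
  then show ?case by (simp add: expands_at_infinity_def)
qed

lemma resolvent_geometric:
  fixes t z :: complex
  assumes "z \<noteq> 0" "t \<noteq> z"
  shows "z^n * (inverse (t - z) + (\<Sum>j<n. t^j * inverse z^(j + 1))) = t^n * inverse (t - z)"
proof (induction n)
  case (Suc n)
  have "z^Suc n * (inverse (t - z) + (\<Sum>j<Suc n. t^j * inverse z^(j + 1)))
     = z * (z^n * (inverse (t - z) + (\<Sum>j<n. t^j * inverse z^(j + 1)))) + (z^(n + 1) * inverse z^(n + 1)) * t^n"
    by (simp add: algebra_simps)
  also have "z^(n + 1) * inverse z^(n + 1) = 1" using assms(1) by (rule power_mult_inverse_power)
  also have "z * (z^n * (inverse (t - z) + (\<Sum>j<n. t^j * inverse z^(j + 1)))) + 1 * t^n = t^Suc n * inverse (t - z)"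
    unfolding Suc using assms(2) by (simp add: field_simps)
  finally show ?case .
qed simp

context half_line_measure
begin

definition "mom j = (LINT t|\<mu>. complex_of_real t ^ j)"

lemma norm_ratio_le: "norm (of_real t * inverse (of_real t - \<i> * of_real y)) \<le> 1"
proof -
  have "\<bar>t\<bar> \<le> norm (of_real t - \<i> * of_real y)"
    using abs_Re_le_cmod[of "of_real t - \<i> * of_real y"] by simp
  then show ?thesis unfolding norm_mult norm_inverse
    by (cases "of_real t - \<i> * of_real y = 0") (auto simp: field_simps norm_of_real)
qed

text \<open>Only moments below n are assumed; t^n / (t - z) is integrable all the same, being a
  combination of the resolvent and lower powers.\<close>

lemma remainder:
  assumes int: "\<And>j. j < n \<Longrightarrow> integrable \<mu> (\<lambda>t. complex_of_real t ^ j)" and y: "y > 0"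
  defines "z \<equiv> \<i> * of_real y"
  shows "z^n * (S z + (\<Sum>j<n. mom j * inverse z^(j + 1))) = (LINT t|\<mu>. of_real t ^ n * inverse (of_real t - z))"
    and "integrable \<mu> (\<lambda>t. of_real t ^ n * inverse (of_real t - z))"
proof -
  have z: "z \<noteq> 0" "z \<in> slit_plane \<alpha>" using y by (auto simp: z_def slit_plane_iff)
  have tz: "complex_of_real t \<noteq> z" for t using y by (auto simp: z_def complex_eq_iff)
  have eq: "of_real t ^ n * inverse (of_real t - z) =
      z^n * (inverse (of_real t - z) + (\<Sum>j<n. of_real t^j * inverse z^(j + 1)))" for t :: real
    using resolvent_geometric[OF z(1) tz, of n] by simp
  have int': "integrable \<mu> (\<lambda>t. inverse (of_real t - z) + (\<Sum>j<n. of_real t^j * inverse z^(j + 1)))"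
    using integrable_slit_resolvent[OF z(2)] int by (intro Bochner_Integration.integrable_add Bochner_Integration.integrable_sum) auto
  then show "integrable \<mu> (\<lambda>t. of_real t ^ n * inverse (of_real t - z))" unfolding eq by simp
  have "(LINT t|\<mu>. of_real t ^ n * inverse (of_real t - z)) =
     z^n * (LINT t|\<mu>. inverse (of_real t - z) + (\<Sum>j<n. of_real t^j * inverse z^(j + 1)))"
    unfolding eq by (rule Bochner_Integration.integral_mult_right_zero)
  also have "(LINT t|\<mu>. inverse (of_real t - z) + (\<Sum>j<n. of_real t^j * inverse z^(j + 1)))
     = S z + (\<Sum>j<n. mom j * inverse z^(j + 1))"
  proof -
    have i: "integrable \<mu> (\<lambda>t. of_real t^j * inverse z^(j + 1))" if "j < n" for j
      using int[OF that] by (rule integrable_mult_left)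
    then have "integrable \<mu> (\<lambda>t. \<Sum>j<n. of_real t^j * inverse z^(j + 1))"
      by (intro Bochner_Integration.integrable_sum) auto
    moreover have "(LINT t|\<mu>. (\<Sum>j<n. of_real t^j * inverse z^(j + 1))) = (\<Sum>j<n. mom j * inverse z^(j + 1))"
      unfolding mom_def using i
      by (subst Bochner_Integration.integral_sum) (auto simp del: power_Suc)
    ultimately show ?thesis
      using integrable_slit_resolvent[OF z(2)] by (simp only: S_def Bochner_Integration.integral_add)
  qed
  finally show "z^n * (S z + (\<Sum>j<n. mom j * inverse z^(j + 1))) = (LINT t|\<mu>. of_real t ^ n * inverse (of_real t - z))" by simp
qed

text \<open>The remainder is the integral of t^(n+1) / (t - i y), which is dominated by |t|^n
  because |t / (t - i y)| \<le> 1.\<close>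

lemma S_expands_at_infinity:
  assumes int: "\<And>j. j \<le> n \<Longrightarrow> integrable \<mu> (\<lambda>t. complex_of_real t ^ j)"
  shows "expands_at_infinity S mom n"
proof -
  have "((\<lambda>y. LINT t|\<mu>. of_real t ^ Suc n * inverse (of_real t - \<i> * of_real y)) \<longlongrightarrow> (LINT t|\<mu>. (0::complex))) at_top"
  proof (rule integral_dominated_convergence_at_top[where w = "\<lambda>t. norm (complex_of_real t ^ n)"])
    show "integrable \<mu> (\<lambda>t. norm (complex_of_real t ^ n))" using int[of n] by (intro integrable_norm) simp
    show "\<forall>\<^sub>F y in at_top. AE t in \<mu>. norm (of_real t ^ Suc n * inverse (of_real t - \<i> * of_real y)) \<le> norm (complex_of_real t ^ n)"
    proof (intro always_eventually allI AE_I2)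
      fix y t :: real
      have "norm (complex_of_real t ^ Suc n * inverse (of_real t - \<i> * of_real y))
        = norm (complex_of_real t ^ n) * norm (of_real t * inverse (of_real t - \<i> * of_real y))"
        by (simp add: norm_mult mult_ac)
      also have "\<dots> \<le> norm (complex_of_real t ^ n) * 1" by (intro mult_left_mono norm_ratio_le) auto
      finally show "norm (complex_of_real t ^ Suc n * inverse (of_real t - \<i> * of_real y)) \<le> norm (complex_of_real t ^ n)" by simp
    qed
    show "AE t in \<mu>. ((\<lambda>y. of_real t ^ Suc n * inverse (of_real t - \<i> * of_real y)) \<longlongrightarrow> (0::complex)) at_top"
    proof (rule AE_I2)
      fix t :: real
      have "((\<lambda>y. inverse (sqrt (t\<^sup>2 + y\<^sup>2))) \<longlongrightarrow> 0) at_top" by real_asymp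
      then have "((\<lambda>y. norm (inverse (of_real t - \<i> * complex_of_real y))) \<longlongrightarrow> 0) at_top"
        unfolding norm_inverse unfolding cmod_def by simp
      then have "((\<lambda>y. inverse (of_real t - \<i> * complex_of_real y)) \<longlongrightarrow> 0) at_top" by (rule tendsto_norm_zero_cancel)
      from tendsto_mult_left[OF this, of "of_real t ^ Suc n"]
      show "((\<lambda>y. of_real t ^ Suc n * inverse (of_real t - \<i> * of_real y)) \<longlongrightarrow> (0::complex)) at_top" by simp
    qed
  qed auto
  then have "((\<lambda>y. LINT t|\<mu>. of_real t ^ Suc n * inverse (of_real t - \<i> * of_real y)) \<longlongrightarrow> (0::complex)) at_top"
    by (simp only: Bochner_Integration.integral_zero)
  then show ?thesis unfolding expands_at_infinity_def
  proof (rule Lim_transform_eventually)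
    show "\<forall>\<^sub>F y in at_top. (LINT t|\<mu>. of_real t ^ Suc n * inverse (of_real t - \<i> * of_real y)) =
      (\<i> * of_real y)^(n + 1) * (S (\<i> * of_real y) + (\<Sum>j\<le>n. mom j * inverse (\<i> * of_real y)^(j + 1)))"
      using eventually_gt_at_top[of 0]
    proof eventually_elim
      fix y :: real assume y: "y > 0"
      have "integrable \<mu> (\<lambda>t. complex_of_real t ^ j)" if "j < Suc n" for j using int that by simp
      from remainder(1)[of "Suc n" y, OF this y, symmetric, unfolded lessThan_Suc_atMost] show "(LINT t|\<mu>. of_real t ^ Suc n * inverse (of_real t - \<i> * of_real y)) =
        (\<i> * of_real y)^(n + 1) * (S (\<i> * of_real y) + (\<Sum>j\<le>n. mom j * inverse (\<i> * of_real y)^(j + 1)))"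
        by (simp only: Suc_eq_plus1)
    qed
  qed
qed

text \<open>The real part of - i y t^k / (t - i y) is t^k times the weight y^2 / (t^2 + y^2), which
  increases to 1, and the integrals converge by the expansion. On a half-line t^k has a fixed sign
  off a bounded set, so Fatou bounds the integral of |t|^k; on the whole line, odd powers could
  cancel.\<close>

lemma expands_imp_integrable:
  assumes int: "\<And>j. j < k \<Longrightarrow> integrable \<mu> (\<lambda>t. complex_of_real t ^ j)"
    and eq: "\<And>j. j < k \<Longrightarrow> mom j = c j" and exp: "expands_at_infinity S c k"
  shows "integrable \<mu> (\<lambda>t. complex_of_real t ^ k)"
proof -
  let ?z = "\<lambda>y::real. \<i> * complex_of_real y"
  define L where "L y = (LINT t|\<mu>. t^k * (y\<^sup>2 / (t\<^sup>2 + y\<^sup>2)))" for y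
  have L: "L y = Re (- ?z y * (LINT t|\<mu>. of_real t ^ k * inverse (of_real t - ?z y)))"
    and Lint: "integrable \<mu> (\<lambda>t. t^k * (y\<^sup>2 / (t\<^sup>2 + y\<^sup>2)))" if y: "y > 0" for y
  proof -
    note rem = remainder(2)[OF int y]
    have Re: "Re (- ?z y * (of_real t ^ k * inverse (of_real t - ?z y))) = t^k * (y\<^sup>2 / (t\<^sup>2 + y\<^sup>2))" for t
    proof -
      have "Re (- ?z y * inverse (of_real t - ?z y)) = y\<^sup>2 / (t\<^sup>2 + y\<^sup>2)"
        by (simp add: power2_eq_square)
      moreover have "- ?z y * (of_real t ^ k * inverse (of_real t - ?z y)) = of_real (t ^ k) * (- ?z y * inverse (of_real t - ?z y))"
        by simp
      moreover have "Re (of_real (t ^ k) * w) = t ^ k * Re w" for w by simp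
      ultimately show ?thesis by (simp only:)
    qed
    have rem': "integrable \<mu> (\<lambda>t. - ?z y * (of_real t ^ k * inverse (of_real t - ?z y)))"
      using rem by (intro integrable_mult_right) auto
    show "integrable \<mu> (\<lambda>t. t^k * (y\<^sup>2 / (t\<^sup>2 + y\<^sup>2)))"
      using integrable_Re[OF rem'] by (simp only: Re)
    show "L y = Re (- ?z y * (LINT t|\<mu>. of_real t ^ k * inverse (of_real t - ?z y)))"
      unfolding L_def Re[symmetric] integral_Re[OF rem']
      by (simp only: Bochner_Integration.integral_mult_right_zero)
  qed
  have lim: "((\<lambda>y. - ?z y * (LINT t|\<mu>. of_real t ^ k * inverse (of_real t - ?z y))) \<longlongrightarrow> c k) at_top"
  proof -
    have "((\<lambda>y. c k - (?z y)^(k + 1) * (S (?z y) + (\<Sum>j\<le>k. c j * inverse (?z y)^(j + 1)))) \<longlongrightarrow> c k - 0) at_top"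
      using exp unfolding expands_at_infinity_def by (intro tendsto_intros)
    then have "((\<lambda>y. c k - (?z y)^(k + 1) * (S (?z y) + (\<Sum>j\<le>k. c j * inverse (?z y)^(j + 1)))) \<longlongrightarrow> c k) at_top" by simp
    then show ?thesis
    proof (rule Lim_transform_eventually)
      show "\<forall>\<^sub>F y in at_top. c k - (?z y)^(k + 1) * (S (?z y) + (\<Sum>j\<le>k. c j * inverse (?z y)^(j + 1))) =
        - ?z y * (LINT t|\<mu>. of_real t ^ k * inverse (of_real t - ?z y))"
        using eventually_gt_at_top[of 0]
      proof eventually_elim
        fix y :: real assume y: "y > 0"
        define z where "z = ?z y"
        have z: "z \<noteq> 0" using y by (simp add: z_def)
        have "z^(k + 1) * (S z + (\<Sum>j\<le>k. c j * inverse z^(j + 1))) =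
           z * (z^k * (S z + (\<Sum>j<k. mom j * inverse z^(j + 1)))) + (z^(k + 1) * inverse z^(k + 1)) * c k"
          by (simp add: sum_atMost_split eq algebra_simps)
        also have "z^(k + 1) * inverse z^(k + 1) = 1" using z by (rule power_mult_inverse_power)
        also have "z^k * (S z + (\<Sum>j<k. mom j * inverse z^(j + 1))) = (LINT t|\<mu>. of_real t ^ k * inverse (of_real t - z))"
          using remainder(1)[OF int y] by (simp add: z_def)
        finally show "c k - (?z y)^(k + 1) * (S (?z y) + (\<Sum>j\<le>k. c j * inverse (?z y)^(j + 1))) =
        - ?z y * (LINT t|\<mu>. of_real t ^ k * inverse (of_real t - ?z y))" by (simp add: z_def)
      qed
    qed
  qed
  have "(L \<longlongrightarrow> Re (c k)) at_top"
    using tendsto_Re[OF lim]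
    by (rule Lim_transform_eventually) (use eventually_gt_at_top[of 0] in eventually_elim, simp only: L)
  then have Lseq: "(\<lambda>n. L (real (Suc n))) \<longlonglongrightarrow> Re (c k)"
    by (rule filterlim_compose) (rule filterlim_compose[OF filterlim_real_sequentially filterlim_Suc])
  text \<open>Only the part of \<open>\<mu>\<close> on the bounded interval from \<open>\<alpha>\<close> to \<open>0\<close> contributes a sign, which is absorbed by a constant.\<close>
  define B where "B = \<bar>\<alpha>\<bar>^k"
  have ptw: "\<bar>t^k\<bar> * w \<le> t^k * w + 2 * B" if "t \<ge> \<alpha>" "0 \<le> w" "w \<le> 1" for t w
  proof (cases "t \<ge> 0")
    case True
    then show ?thesis by (simp add: B_def)
  next
    case False
    then have "\<bar>t^k\<bar> \<le> B" unfolding B_def power_abs using that by (intro power_mono) auto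
    moreover have "\<bar>t^k\<bar> * w \<le> \<bar>t^k\<bar>" "- (t^k * w) \<le> \<bar>t^k\<bar>"
      using that mult_left_le[of w "\<bar>t^k\<bar>"] abs_ge_minus_self[of "t^k * w"] by (auto simp: abs_mult)
    ultimately show ?thesis by linarith
  qed
  let ?w = "\<lambda>n t. (real (Suc n))\<^sup>2 / (t\<^sup>2 + (real (Suc n))\<^sup>2)"
  have w: "0 \<le> ?w n t" "?w n t \<le> 1" for n t
    by (auto intro!: divide_le_eq_1_pos[THEN iffD2] add_nonneg_pos)
  have nn: "(\<integral>\<^sup>+t. ennreal (\<bar>t^k\<bar> * ?w n t) \<partial>\<mu>) \<le> ennreal (L (real (Suc n)) + 2 * B * measure \<mu> (space \<mu>))" for n
  proof -
    have int': "integrable \<mu> (\<lambda>t. t^k * ?w n t + 2 * B)"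
      by (intro Bochner_Integration.integrable_add Lint integrable_const) simp
    have "(\<integral>\<^sup>+t. ennreal (\<bar>t^k\<bar> * ?w n t) \<partial>\<mu>) \<le> (\<integral>\<^sup>+t. ennreal (t^k * ?w n t + 2 * B) \<partial>\<mu>)"
      using AE_ge by (intro nn_integral_mono_AE, eventually_elim) (rule ennreal_leI, rule ptw, assumption, rule w, rule w)
    also have "\<dots> = ennreal (LINT t|\<mu>. t^k * ?w n t + 2 * B)"
    proof (rule nn_integral_eq_integral[OF int'])
      show "AE t in \<mu>. 0 \<le> t^k * ?w n t + 2 * B"
        using AE_ge
      proof eventually_elim
        fix t assume "t \<ge> \<alpha>"
        then have "\<bar>t^k\<bar> * ?w n t \<le> t^k * ?w n t + 2 * B" using w by (rule ptw)
        moreover have "0 \<le> \<bar>t^k\<bar> * ?w n t" using w by (intro mult_nonneg_nonneg) auto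
        ultimately show "0 \<le> t^k * ?w n t + 2 * B" by linarith
      qed
    qed
    also have "(LINT t|\<mu>. t^k * ?w n t + 2 * B) = L (real (Suc n)) + 2 * B * measure \<mu> (space \<mu>)"
      using Lint[of "real (Suc n)"] by (subst Bochner_Integration.integral_add) (auto simp: L_def)
    finally show ?thesis .
  qed
  have "(\<integral>\<^sup>+t. ennreal \<bar>t^k\<bar> \<partial>\<mu>) = (\<integral>\<^sup>+t. liminf (\<lambda>n. ennreal (\<bar>t^k\<bar> * ?w n t)) \<partial>\<mu>)"
  proof (rule nn_integral_cong)
    fix t
    have "(\<lambda>n. ?w n t) \<longlonglongrightarrow> 1" by real_asymp
    then have "(\<lambda>n. ennreal (\<bar>t^k\<bar> * ?w n t)) \<longlonglongrightarrow> ennreal (\<bar>t^k\<bar> * 1)" by (intro tendsto_ennrealI tendsto_mult_left)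
    then have "(\<lambda>n. ennreal (\<bar>t^k\<bar> * ?w n t)) \<longlonglongrightarrow> ennreal \<bar>t^k\<bar>" by (simp only: mult_1_right)
    then show "ennreal \<bar>t^k\<bar> = liminf (\<lambda>n. ennreal (\<bar>t^k\<bar> * ?w n t))"
      by (rule lim_imp_Liminf[OF sequentially_bot, symmetric])
  qed
  also have "\<dots> \<le> liminf (\<lambda>n. \<integral>\<^sup>+t. ennreal (\<bar>t^k\<bar> * ?w n t) \<partial>\<mu>)"
    by (rule nn_integral_liminf) simp
  also have "\<dots> \<le> liminf (\<lambda>n. ennreal (L (real (Suc n)) + 2 * B * measure \<mu> (space \<mu>)))"
    by (intro Liminf_mono always_eventually allI nn)
  also have "\<dots> = ennreal (Re (c k) + 2 * B * measure \<mu> (space \<mu>))"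
    by (intro lim_imp_Liminf tendsto_ennrealI tendsto_add Lseq tendsto_const) simp
  also have "\<dots> < \<infinity>" by simp
  finally have "(\<integral>\<^sup>+t. ennreal (norm (complex_of_real t ^ k)) \<partial>\<mu>) < \<infinity>"
    by (simp add: norm_power power_abs)
  then show ?thesis by (intro integrableI_bounded) auto
qed

text \<open>Once t^k is integrable, S has a second expansion with its true moments, and the
  coefficients of an expansion are unique.\<close>

theorem Hamburger_Nevanlinna:
  assumes exp: "expands_at_infinity S c n" and "k \<le> n"
  shows "has_bochner_integral \<mu> (\<lambda>t. complex_of_real t ^ k) (c k)"
  using \<open>k \<le> n\<close>
proof (induction k rule: less_induct)
  case (less k)
  have exp_k: "expands_at_infinity S c k" by (rule expands_at_infinity_less[OF exp less.prems])
  have IH: "integrable \<mu> (\<lambda>t. complex_of_real t ^ j)" "mom j = c j" if "j < k" for j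
    using less that by (auto simp: has_bochner_integral_iff mom_def)
  have int: "integrable \<mu> (\<lambda>t. complex_of_real t ^ k)"
    using IH exp_k by (rule expands_imp_integrable)
  then have "expands_at_infinity S mom k"
    using IH by (intro S_expands_at_infinity) (auto simp: le_less)
  then have "((\<lambda>y. (\<i> * of_real y)^(k + 1) * (S (\<i> * of_real y) + (\<Sum>j\<le>k. mom j * inverse (\<i> * of_real y)^(j + 1)))
     - (\<i> * of_real y)^(k + 1) * (S (\<i> * of_real y) + (\<Sum>j\<le>k. c j * inverse (\<i> * of_real y)^(j + 1)))) \<longlongrightarrow> 0 - 0) at_top"
    using exp_k unfolding expands_at_infinity_def by (rule tendsto_diff)
  then have "((\<lambda>y::real. mom k - c k) \<longlongrightarrow> 0 - 0) at_top"
  proof (rule Lim_transform_eventually)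
    show "\<forall>\<^sub>F y in at_top. (\<i> * of_real y)^(k + 1) * (S (\<i> * of_real y) + (\<Sum>j\<le>k. mom j * inverse (\<i> * of_real y)^(j + 1)))
     - (\<i> * of_real y)^(k + 1) * (S (\<i> * of_real y) + (\<Sum>j\<le>k. c j * inverse (\<i> * of_real y)^(j + 1))) = mom k - c k"
      using eventually_gt_at_top[of 0]
    proof eventually_elim
      fix y :: real assume y: "y > 0"
      define z where "z = \<i> * complex_of_real y"
      have z: "z \<noteq> 0" using y by (simp add: z_def)
      define R where "R = S z + (\<Sum>j<k. c j * inverse z^(j + 1))"
      have 1: "S z + (\<Sum>j\<le>k. mom j * inverse z^(j + 1)) = R + mom k * inverse z^(k + 1)"
        "S z + (\<Sum>j\<le>k. c j * inverse z^(j + 1)) = R + c k * inverse z^(k + 1)"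
        by (simp_all add: R_def sum_atMost_split IH(2))
      have 2: "z^(k + 1) * inverse z^(k + 1) = 1" using z by (rule power_mult_inverse_power)
      have "a * (R + mom k * b) - a * (R + c k * b) = (mom k - c k) * (a * b)" for a b
        by (simp add: algebra_simps)
      from this[of "z^(k + 1)" "inverse z^(k + 1)"] show "(\<i> * of_real y)^(k + 1) * (S (\<i> * of_real y) + (\<Sum>j\<le>k. mom j * inverse (\<i> * of_real y)^(j + 1)))
     - (\<i> * of_real y)^(k + 1) * (S (\<i> * of_real y) + (\<Sum>j\<le>k. c j * inverse (\<i> * of_real y)^(j + 1))) = mom k - c k"
        by (simp only: z_def[symmetric] 1 2 mult_1_right)
    qed
  qed
  then have "mom k = c k" by (simp add: tendsto_const_iff)
  then show ?case using int by (simp add: has_bochner_integral_iff mom_def)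
qed

end

section \<open>Matrix integrals and directions of zero mass\<close>

lemma has_mm_integral_unique:
  assumes "has_mm_integral \<alpha> \<sigma> f M" "has_mm_integral \<alpha> \<sigma> f M'"
  shows "M = M'"
  using assms unfolding has_mm_integral_def
  by (intro matrix_eq_if_qf_eq) (blast intro: has_bochner_integral_eq)

lemma moment_eqI: "has_mm_integral \<alpha> \<sigma> (\<lambda>t. of_real t ^ j) M \<Longrightarrow> moment \<alpha> \<sigma> j = M"
  unfolding moment_def using has_mm_integral_unique by (intro the_equality)

lemma has_mm_integral_moment:
  "moment_exists \<alpha> \<sigma> j \<Longrightarrow> has_mm_integral \<alpha> \<sigma> (\<lambda>t. of_real t ^ j) (moment \<alpha> \<sigma> j)"
  unfolding moment_exists_def using moment_eqI by blast

text \<open>In the polarization formula with x as one of the two vectors, all four values of the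
  form equal the one at y, and the weights sum to zero. Both sides are treated because N, as an
  integral of a complex function, need not be Hermitian.\<close>

lemma qf_invariant_nul:
  assumes inv: "\<And>y c. qf N (y + c *s x) = qf N y"
  shows "N *v x = 0" "cdot x (N *v y) = 0"
proof -
  show "N *v x = 0"
  proof (rule eq_if_cdot_eq)
    fix y
    have "4 * cdot y (N *v x) = (\<Sum>p<4. (-\<i>)^p * qf N y)"
      by (simp only: polarization inv)
    also have "\<dots> = 0" by (simp add: eval_nat_numeral)
    finally show "cdot y (N *v x) = cdot y 0" by simp
  qed
  have "qf N (x + \<i>^p *s y) = qf N y" for p
  proof -
    have "qf N (x + \<i>^p *s y) = qf N (\<i>^p *s y + 1 *s x)" by (simp add: add.commute)
    also have "\<dots> = cnj (\<i>^p) * \<i>^p * qf N y"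
      by (simp only: inv mat_vec_scale cdot_scale_left cdot_scale_right) (simp only: mult_ac)
    also have "cnj (\<i>^p) * \<i>^p = 1"
      by (simp add: power_mult_distrib[symmetric])
    finally show ?thesis by simp
  qed
  then have "4 * cdot x (N *v y) = (\<Sum>p<4. (-\<i>)^p * qf N y)"
    by (simp only: polarization)
  also have "\<dots> = 0" by (simp add: eval_nat_numeral)
  finally show "cdot x (N *v y) = 0" by simp
qed

text \<open>If the total mass vanishes in the direction x, every \<sigma>(B) has zero form at x and
  hence kills x. The direction x is then invisible to all scalar measures, and so to every
  integral.\<close>

lemma ext_measure_null_direction:
  assumes \<sigma>: "nonneg_herm_measure \<alpha> \<sigma>" and M: "has_mm_integral \<alpha> \<sigma> (\<lambda>t. of_real t ^ 0) M" and 0: "qf M x = 0"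
  shows "ext_measure \<alpha> \<sigma> (y + c *s x) = ext_measure \<alpha> \<sigma> y"
proof -
  interpret half_line_measure "ext_measure \<alpha> \<sigma> x" \<alpha> by (rule half_line_ext_measure[OF \<sigma>])
  have "has_bochner_integral (ext_measure \<alpha> \<sigma> x) (\<lambda>t. of_real t ^ 0) (qf M x)"
    using M by (subst (asm) has_mm_integral_iff[OF \<sigma>]) auto
  then have "(LINT t|ext_measure \<alpha> \<sigma> x. (1 :: complex)) = 0"
    using 0 by (auto dest: has_bochner_integral_integral_eq)
  then have tot: "measure (ext_measure \<alpha> \<sigma> x) (space (ext_measure \<alpha> \<sigma> x)) = 0" by simp
  have \<sigma>x: "\<sigma> B *v x = 0" if B: "B \<in> sets (borel_from \<alpha>)" for B
  proof -
    have "measure (ext_measure \<alpha> \<sigma> x) B = 0"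
      using bounded_measure[of B] tot by (simp add: measure_le_0_iff)
    then have "Re (qf (\<sigma> B) x) = 0"
      using B measure_ext_measure[OF \<sigma>, of B x] by (simp add: sets_borel_from_iff Int_absorb2)
    then have "qf (\<sigma> B) x = 0" by (subst qf_nonneg_herm[OF herm_measure_nonneg[OF \<sigma> B]]) simp
    then show ?thesis by (rule nonneg_herm_qf_eq_0[OF herm_measure_nonneg[OF \<sigma> B]])
  qed
  show ?thesis
  proof (rule measure_eqI)
    show "sets (ext_measure \<alpha> \<sigma> (y + c *s x)) = sets (ext_measure \<alpha> \<sigma> y)"
      by (simp add: sets_ext_measure[OF \<sigma>])
    fix B assume "B \<in> sets (ext_measure \<alpha> \<sigma> (y + c *s x))"
    then have B: "B \<in> sets borel" by (simp add: sets_ext_measure[OF \<sigma>])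
    let ?B = "B \<inter> {\<alpha>..}"
    have B': "?B \<in> sets (borel_from \<alpha>)" using B by (simp add: sets_borel_from_iff)
    note h = nonneg_hermD(1)[OF herm_measure_nonneg[OF \<sigma> B']]
    have "\<sigma> ?B *v (y + c *s x) = \<sigma> ?B *v y"
      by (simp add: matrix_vector_right_distrib mat_vec_scale \<sigma>x[OF B'])
    moreover have "cdot x (\<sigma> ?B *v y) = 0"
      using \<sigma>x[OF B'] hermitian_cdot[OF h, of x y] by simp
    ultimately have "qf (\<sigma> ?B) (y + c *s x) = qf (\<sigma> ?B) y"
      by (simp add: cdot_add_left cdot_scale_left)
    then show "emeasure (ext_measure \<alpha> \<sigma> (y + c *s x)) B = emeasure (ext_measure \<alpha> \<sigma> y) B"
      by (simp add: emeasure_ext_measure[OF \<sigma> B])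
  qed
qed

section \<open>Sign properties of Stieltjes transforms\<close>

context half_line_measure
begin

text \<open>The identity (z - \<alpha>) / (t - z) = (t - \<alpha>) / (t - z) - 1 and t \<ge>
  \<alpha> give the sign. This second positivity, typical of a half-line, governs both the
  invertibility of I + X F(z) and the positivity of the transform.\<close>

lemma S_mult_Im_nonneg:
  assumes "Im z > 0"
  shows "0 \<le> Im ((z - of_real \<alpha>) * S z)"
proof -
  have z: "z \<in> slit_plane \<alpha>" using assms by (simp add: slit_plane_iff)
  have i: "integrable \<mu> (\<lambda>t. (z - of_real \<alpha>) * inverse (of_real t - z))"
    by (intro integrable_mult_right integrable_slit_resolvent z)
  have "(z - of_real \<alpha>) * S z = (LINT t|\<mu>. (z - of_real \<alpha>) * inverse (of_real t - z))"
    unfolding S_def by (rule Bochner_Integration.integral_mult_right_zero[symmetric])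
  then have "Im ((z - of_real \<alpha>) * S z) = (LINT t|\<mu>. Im ((z - of_real \<alpha>) * inverse (of_real t - z)))"
    by (simp only: integral_Im[OF i])
  also have "0 \<le> \<dots>"
  proof (rule integral_nonneg_AE)
    show "AE t in \<mu>. 0 \<le> Im ((z - of_real \<alpha>) * inverse (of_real t - z))"
      using AE_ge
    proof eventually_elim
      fix t assume t: "\<alpha> \<le> t"
      have ne: "of_real t - z \<noteq> 0" using assms by (auto simp: complex_eq_iff)
      then have "(z - of_real \<alpha>) * inverse (of_real t - z) = of_real (t - \<alpha>) * inverse (of_real t - z) - 1"
        by (simp add: field_simps)
      then have "Im ((z - of_real \<alpha>) * inverse (of_real t - z)) = (t - \<alpha>) * Im (inverse (of_real t - z))" by simp
      moreover have "0 \<le> (t - \<alpha>) * Im (inverse (of_real t - z))"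
        using assms t by (intro mult_nonneg_nonneg) auto
      ultimately show "0 \<le> Im ((z - of_real \<alpha>) * inverse (of_real t - z))" by (simp only:)
    qed
  qed
  finally show ?thesis .
qed

lemma S_cnj: "S (cnj z) = cnj (S z)"
proof -
  have "inverse (of_real t - cnj z) = cnj (inverse (of_real t - z))" for t :: real by simp
  then show ?thesis unfolding S_def by (simp only: Bochner_Integration.integral_cnj)
qed

end

text \<open>After multiplication by z - \<alpha> both summands have nonnegative imaginary part in
  the upper half-plane, so a Im z = 0. The lower half-plane is reduced to it by conjugation; left of
  \<alpha> both summands have nonnegative real part.\<close>

lemma add_Stieltjes_eq_0:
  assumes z: "z \<in> slit_plane \<alpha>" and \<mu>: "half_line_measure \<mu> \<alpha>"
    and eq: "a + half_line_measure.S \<mu> z = 0" and a: "a \<in> \<real>\<^sub>\<ge>\<^sub>0"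
    and real: "\<And>w::real. w < \<alpha> \<Longrightarrow> 0 \<le> Re (half_line_measure.S \<mu> (of_real w))"
  shows "a = 0"
proof -
  interpret half_line_measure \<mu> \<alpha> by (rule \<mu>)
  obtain b where b: "a = of_real b" "b \<ge> 0" using a by (auto elim: nonneg_Reals_cases)
  consider "Im z > 0" | "Im z < 0" | "Im z = 0" "Re z < \<alpha>"
    using z unfolding slit_plane_iff by linarith
  then show ?thesis
  proof cases
    case 1
    have "0 = Im ((z - of_real \<alpha>) * (of_real b + S z))" using eq b by simp
    also have "\<dots> = b * Im z + Im ((z - of_real \<alpha>) * S z)" by (simp add: algebra_simps)
    finally have "b * Im z \<le> 0" using S_mult_Im_nonneg[OF 1] by linarith
    then show ?thesis using 1 b by (simp add: mult_le_0_iff)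
  next
    case 2
    let ?w = "cnj z"
    have w: "Im ?w > 0" using 2 by simp
    have "cnj (a + S z) = 0" using eq by (simp only: complex_cnj_zero)
    then have "of_real b + S ?w = 0" by (simp add: S_cnj b)
    then have "0 = Im ((?w - of_real \<alpha>) * (of_real b + S ?w))" by simp
    also have "\<dots> = b * Im ?w + Im ((?w - of_real \<alpha>) * S ?w)" by (simp add: algebra_simps)
    finally have "b * Im ?w \<le> 0" using S_mult_Im_nonneg[OF w] by linarith
    then have "b \<le> 0" using w by (auto simp only: mult_le_0_iff)
    then show ?thesis using b by simp
  next
    case 3
    then have "z = of_real (Re z)" by (simp add: complex_eq_iff)
    then have "0 \<le> Re (S z)" using real[OF 3(2)] by simp
    moreover have "Re (of_real b + S z) = 0" using eq b by simp
    ultimately show ?thesis using b by simp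
  qed
qed

text \<open>Ordinary expansions in powers of 1 / (i y) with a constant term, for which products
  correspond to Cauchy products of the coefficients. Passing from \<open>expands_at_infinity\<close>
  shifts the index by one and changes the sign.\<close>

definition expands :: "(real \<Rightarrow> complex) \<Rightarrow> (nat \<Rightarrow> complex) \<Rightarrow> nat \<Rightarrow> bool" where
  "expands f a m \<longleftrightarrow>
     ((\<lambda>y. (\<i> * of_real y)^m * (f y - (\<Sum>l\<le>m. a l * inverse (\<i> * of_real y)^l))) \<longlongrightarrow> 0) at_top"

lemma expands_at_infinity_iff:
  "expands_at_infinity f c n \<longleftrightarrow>
    expands (\<lambda>y. f (\<i> * of_real y)) (\<lambda>l. if l = 0 then 0 else - c (l - 1)) (n + 1)"
proof -
  have "(\<Sum>l\<le>n+1. (if l = 0 then 0 else - c (l - 1)) * w^l) = - (\<Sum>j\<le>n. c j * w^(j + 1))" for w :: complex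
    unfolding Suc_eq_plus1[symmetric] sum.atMost_Suc_shift by (simp add: sum_negf)
  then show ?thesis
    unfolding expands_at_infinity_def expands_def by (simp only: diff_minus_eq_add)
qed

lemma expands_sum:
  assumes "\<And>i. i \<in> I \<Longrightarrow> expands (f i) (a i) m"
  shows "expands (\<lambda>y. \<Sum>i\<in>I. k i * f i y) (\<lambda>l. \<Sum>i\<in>I. k i * a i l) m"
proof -
  let ?z = "\<lambda>y::real. \<i> * complex_of_real y"
  have "((\<lambda>y. \<Sum>i\<in>I. k i * (?z y^m * (f i y - (\<Sum>l\<le>m. a i l * inverse (?z y)^l)))) \<longlongrightarrow> (\<Sum>i\<in>I. k i * 0)) at_top"
    using assms unfolding expands_def by (intro tendsto_sum tendsto_mult_left)
  moreover have "(\<Sum>i\<in>I. k i * (z^m * (f i y - (\<Sum>l\<le>m. a i l * w^l)))) =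
    z^m * ((\<Sum>i\<in>I. k i * f i y) - (\<Sum>l\<le>m. (\<Sum>i\<in>I. k i * a i l) * w^l))" for z w y
  proof -
    have "(\<Sum>l\<le>m. (\<Sum>i\<in>I. k i * a i l) * w^l) = (\<Sum>i\<in>I. k i * (\<Sum>l\<le>m. a i l * w^l))"
      by (simp add: sum_distrib_left sum_distrib_right mult.assoc) (rule sum.swap)
    then show ?thesis
      by (simp add: sum_distrib_left sum_subtractf right_diff_distrib mult.left_commute)
  qed
  ultimately show ?thesis unfolding expands_def by simp
qed

lemma expands_add:
  assumes "expands f a m" "expands g b m"
  shows "expands (\<lambda>y. f y + g y) (\<lambda>l. a l + b l) m"
  using expands_sum[of "{True, False}" "\<lambda>i. if i then f else g" "\<lambda>i. if i then a else b" m "\<lambda>_. 1"] assms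
  by simp

lemma expands_polynomial: "expands (\<lambda>y. \<Sum>l\<le>m. a l * inverse (\<i> * of_real y)^l) a m"
  unfolding expands_def by simp

lemma expands_const: "expands (\<lambda>y. c) (\<lambda>l. if l = 0 then c else 0) m"
proof -
  have "(\<Sum>l\<le>m. (if l = 0 then c else 0) * w^l) = c" for w :: complex
    by (subst sum.atMost_shift) simp
  then show ?thesis using expands_polynomial[where m = m and a = "\<lambda>l. if l = 0 then c else 0"] by simp
qed

lemma expands_cong:
  "expands f a m \<Longrightarrow> (\<And>l. l \<le> m \<Longrightarrow> a l = b l) \<Longrightarrow> expands f b m"
  by (simp add: expands_def)

lemma expands_tendsto:
  assumes "expands f a m"
  shows "(f \<longlongrightarrow> a 0) at_top"
proof -
  let ?w = "\<lambda>y. inverse (\<i> * complex_of_real y)"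
  have "((\<lambda>y. ?w y^m * ((\<i> * of_real y)^m * (f y - (\<Sum>l\<le>m. a l * ?w y^l))) + (\<Sum>l\<le>m. a l * ?w y^l))
     \<longlongrightarrow> 0^m * 0 + (\<Sum>l\<le>m. a l * 0^l)) at_top"
    using assms unfolding expands_def by (intro tendsto_intros inverse_i_tendsto)
  moreover have "(\<Sum>l\<le>m. a l * 0^l) = a 0" by (subst sum.atMost_shift) simp
  ultimately have "((\<lambda>y. ?w y^m * ((\<i> * of_real y)^m * (f y - (\<Sum>l\<le>m. a l * ?w y^l))) + (\<Sum>l\<le>m. a l * ?w y^l))
     \<longlongrightarrow> a 0) at_top" by simp
  then show ?thesis
  proof (rule Lim_transform_eventually)
    show "\<forall>\<^sub>F y in at_top. ?w y^m * ((\<i> * of_real y)^m * (f y - (\<Sum>l\<le>m. a l * ?w y^l))) + (\<Sum>l\<le>m. a l * ?w y^l) = f y"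
      using eventually_gt_at_top[of 0]
    proof eventually_elim
      fix y :: real assume "y > 0"
      then have "\<i> * complex_of_real y \<noteq> 0" by simp
      then have 1: "?w y^m * (\<i> * of_real y)^m = 1" using power_mult_inverse_power by (simp only: mult.commute)
      have "?w y^m * ((\<i> * of_real y)^m * b) = b" for b by (simp only: mult.assoc[symmetric] 1 mult_1_left)
      then show "?w y^m * ((\<i> * of_real y)^m * (f y - (\<Sum>l\<le>m. a l * ?w y^l))) + (\<Sum>l\<le>m. a l * ?w y^l) = f y"
        by (simp only: diff_add_cancel)
    qed
  qed
qed

lemma expands_mult:
  assumes f: "expands f a m" and g: "expands g b m"
  shows "expands (\<lambda>y. f y * g y) (\<lambda>k. \<Sum>i\<le>k. a i * b (k - i)) m"
proof -
  let ?z = "\<lambda>y::real. \<i> * complex_of_real y"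
  let ?w = "\<lambda>y::real. inverse (?z y)"
  \<comment> \<open>The pairs of degrees whose product lies beyond the truncation; after
    multiplication by z^m each still carries a positive power of 1 / z and vanishes in the
    limit.\<close>
  define D where "D = {(j, l). j \<le> m \<and> l \<le> m \<and> j + l > m}"
  have fin: "finite D" by (rule finite_subset[of _ "{..m} \<times> {..m}"]) (auto simp: D_def)
  have prod: "(\<Sum>l\<le>m. a l * w^l) * (\<Sum>l\<le>m. b l * w^l) =
    (\<Sum>k\<le>m. (\<Sum>i\<le>k. a i * b (k - i)) * w^k) + (\<Sum>(j, l)\<in>D. a j * b l * w^(j + l))" for w :: complex
  proof -
    have "(\<Sum>l\<le>m. a l * w^l) * (\<Sum>l\<le>m. b l * w^l) = (\<Sum>(j, l)\<in>{..m} \<times> {..m}. a j * b l * w^(j + l))"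
      by (simp add: sum_product sum.cartesian_product power_add mult_ac)
    also have "{..m} \<times> {..m} = {(j, l). j + l \<le> m} \<union> D" by (auto simp: D_def)
    also have "(\<Sum>(j, l)\<in>{(j, l). j + l \<le> m} \<union> D. a j * b l * w^(j + l)) =
       (\<Sum>(j, l)\<in>{(j, l). j + l \<le> m}. a j * b l * w^(j + l)) + (\<Sum>(j, l)\<in>D. a j * b l * w^(j + l))"
      by (intro sum.union_disjoint fin finite_subset[of "{(j, l). j + l \<le> m}" "{..m} \<times> {..m}"]) (auto simp: D_def)
    also have "(\<Sum>(j, l)\<in>{(j, l). j + l \<le> m}. a j * b l * w^(j + l)) = (\<Sum>k\<le>m. \<Sum>i\<le>k. a i * b (k - i) * w^(i + (k - i)))"
      by (rule sum.triangle_reindex_eq)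
    finally show ?thesis by (simp add: sum_distrib_right)
  qed
  let ?a = "\<lambda>y. \<Sum>l\<le>m. a l * ?w y^l" and ?b = "\<lambda>y. \<Sum>l\<le>m. b l * ?w y^l"
  have "((\<lambda>y. (?z y^m * (f y - ?a y)) * g y + ?a y * (?z y^m * (g y - ?b y)) + (\<Sum>(j, l)\<in>D. a j * b l * ?w y^(j + l - m)))
    \<longlongrightarrow> 0 * b 0 + a 0 * 0 + (\<Sum>(j, l)\<in>D. a j * b l * 0^(j + l - m))) at_top"
  proof (intro tendsto_add tendsto_mult)
    show "((\<lambda>y. ?z y^m * (f y - ?a y)) \<longlongrightarrow> 0) at_top" "((\<lambda>y. ?z y^m * (g y - ?b y)) \<longlongrightarrow> 0) at_top"
      using f g by (auto simp only: expands_def)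
    show "(g \<longlongrightarrow> b 0) at_top" by (rule expands_tendsto[OF g])
    show "(?a \<longlongrightarrow> a 0) at_top" by (rule expands_tendsto[OF expands_polynomial])
    show "((\<lambda>y. \<Sum>(j, l)\<in>D. a j * b l * ?w y^(j + l - m)) \<longlongrightarrow> (\<Sum>(j, l)\<in>D. a j * b l * 0^(j + l - m))) at_top"
      unfolding split_def by (intro tendsto_intros inverse_i_tendsto)
  qed
  moreover have "(\<Sum>(j, l)\<in>D. a j * b l * 0^(j + l - m)) = 0" by (rule sum.neutral) (auto simp: D_def)
  ultimately have "((\<lambda>y. (?z y^m * (f y - ?a y)) * g y + ?a y * (?z y^m * (g y - ?b y)) + (\<Sum>(j, l)\<in>D. a j * b l * ?w y^(j + l - m)))
    \<longlongrightarrow> 0) at_top" by (simp only: mult_zero_left mult_zero_right add_0)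
  then show ?thesis unfolding expands_def
  proof (rule Lim_transform_eventually)
    show "\<forall>\<^sub>F y in at_top. (?z y^m * (f y - ?a y)) * g y + ?a y * (?z y^m * (g y - ?b y)) + (\<Sum>(j, l)\<in>D. a j * b l * ?w y^(j + l - m))
      = ?z y^m * (f y * g y - (\<Sum>k\<le>m. (\<Sum>i\<le>k. a i * b (k - i)) * ?w y^k))"
      using eventually_gt_at_top[of 0]
    proof eventually_elim
      fix y :: real assume "y > 0"
      then have z: "?z y \<noteq> 0" by simp
      have D: "(\<Sum>(j, l)\<in>D. a j * b l * ?w y^(j + l - m)) = ?z y^m * (\<Sum>(j, l)\<in>D. a j * b l * ?w y^(j + l))"
        unfolding sum_distrib_left
      proof (intro sum.cong refl, clarify)
        fix j l assume "(j, l) \<in> D"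
        then have "?w y^(j + l) = ?w y^m * ?w y^(j + l - m)" by (simp add: D_def flip: power_add)
        then have "?z y^m * (a j * b l * ?w y^(j + l)) = (?z y^m * ?w y^m) * (a j * b l * ?w y^(j + l - m))"
          by (simp only: mult_ac)
        then show "a j * b l * ?w y^(j + l - m) = ?z y^m * (a j * b l * ?w y^(j + l))"
          by (simp only: power_mult_inverse_power[OF z] mult_1_left)
      qed
      have alg: "Z * (F - A) * G + A * (Z * (G - B)) + Z * E = Z * (F * G - (A * B - E))" for Z F A G B E :: complex
        by (simp add: algebra_simps)
      show "(?z y^m * (f y - ?a y)) * g y + ?a y * (?z y^m * (g y - ?b y)) + (\<Sum>(j, l)\<in>D. a j * b l * ?w y^(j + l - m))
      = ?z y^m * (f y * g y - (\<Sum>k\<le>m. (\<Sum>i\<le>k. a i * b (k - i)) * ?w y^k))"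
        unfolding D alg prod by simp
    qed
  qed
qed

lemma expands_matrix_mult:
  fixes f g :: "real \<Rightarrow> complex^'n^'n" and a b :: "nat \<Rightarrow> complex^'n^'n"
  assumes "\<And>i j. expands (\<lambda>y. f y $ i $ j) (\<lambda>l. a l $ i $ j) m"
    and "\<And>i j. expands (\<lambda>y. g y $ i $ j) (\<lambda>l. b l $ i $ j) m"
  shows "expands (\<lambda>y. (f y ** g y) $ i $ j) (\<lambda>l. conv a b l $ i $ j) m"
proof -
  have "expands (\<lambda>y. \<Sum>k\<in>UNIV. 1 * (f y $ i $ k * g y $ k $ j))
    (\<lambda>l. \<Sum>k\<in>UNIV. 1 * (\<Sum>p\<le>l. a p $ i $ k * b (l - p) $ k $ j)) m"
    by (intro expands_sum expands_mult assms)
  moreover have "conv a b l $ i $ j = (\<Sum>k\<in>UNIV. 1 * (\<Sum>p\<le>l. a p $ i $ k * b (l - p) $ k $ j))" for l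
    unfolding conv_def by (simp add: matrix_matrix_mult_def atLeast0AtMost) (rule sum.swap)
  ultimately show ?thesis by (simp add: matrix_matrix_mult_def)
qed

section \<open>The transform of functions\<close>

lemma expands_cong_eventually:
  assumes "expands f a m" "\<forall>\<^sub>F y in at_top. f y = g y"
  shows "expands g a m"
  using assms(1) unfolding expands_def
  by (rule Lim_transform_eventually) (use assms(2) in eventually_elim, simp)

text \<open>Division by z - \<alpha> gains one order, since z^(m+1) / (z - \<alpha>) behaves like
  z^m. The recursion for N undoes the passage from a sequence to its shifted sequence.\<close>

lemma expands_resolvent_mult:
  assumes g: "expands g u m" and N0: "N 0 = u 0"
    and N: "\<And>l. l < m \<Longrightarrow> N (Suc l) = u (Suc l) + of_real \<alpha> * N l"
  shows "((\<lambda>y. (\<i> * of_real y)^(m + 1) * (- inverse (\<i> * of_real y - of_real \<alpha>) * g y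
     + (\<Sum>j\<le>m. N j * inverse (\<i> * of_real y)^(j + 1)))) \<longlongrightarrow> 0) at_top"
proof -
  let ?z = "\<lambda>y::real. \<i> * complex_of_real y"
  let ?w = "\<lambda>y::real. inverse (?z y)"
  \<comment> \<open>Telescoping leaves the single boundary term with z^(-k-1), one order beyond the
    powers kept in the sum.\<close>
  have tele: "k \<le> m \<Longrightarrow> (z - of_real \<alpha>) * (\<Sum>j\<le>k. N j * inverse z^(j + 1)) =
    (\<Sum>l\<le>k. u l * inverse z^l) - of_real \<alpha> * N k * inverse z^(k + 1)" if z: "z \<noteq> 0" for k z
  proof (induction k)
    case 0
    then show ?case using z by (simp add: N0 algebra_simps)
  next
    case (Suc k)
    have "(z - of_real \<alpha>) * (N (Suc k) * inverse z^(Suc k + 1)) =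
      N (Suc k) * inverse z^Suc k - of_real \<alpha> * N (Suc k) * inverse z^(Suc k + 1)"
      using z by (simp add: algebra_simps)
    also have "N (Suc k) * inverse z^Suc k = u (Suc k) * inverse z^Suc k + of_real \<alpha> * N k * inverse z^(k + 1)"
      using Suc.prems by (simp add: N algebra_simps)
    finally show ?case using Suc
      by (simp add: distrib_left del: power_Suc)
  qed
  have "((\<lambda>y. - inverse (1 - of_real \<alpha> * ?w y) * (?z y^m * (g y - (\<Sum>l\<le>m. u l * ?w y^l)) + of_real \<alpha> * N m * ?w y))
     \<longlongrightarrow> - inverse (1 - of_real \<alpha> * 0) * (0 + of_real \<alpha> * N m * 0)) at_top"
    using g unfolding expands_def by (intro tendsto_intros inverse_i_tendsto) auto
  then have "((\<lambda>y. - inverse (1 - of_real \<alpha> * ?w y) * (?z y^m * (g y - (\<Sum>l\<le>m. u l * ?w y^l)) + of_real \<alpha> * N m * ?w y))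
     \<longlongrightarrow> 0) at_top" by (simp only: mult_zero_right add_0_left)
  then show ?thesis
  proof (rule Lim_transform_eventually)
    show "\<forall>\<^sub>F y in at_top. - inverse (1 - of_real \<alpha> * ?w y) * (?z y^m * (g y - (\<Sum>l\<le>m. u l * ?w y^l)) + of_real \<alpha> * N m * ?w y)
      = ?z y^(m + 1) * (- inverse (?z y - of_real \<alpha>) * g y + (\<Sum>j\<le>m. N j * ?w y^(j + 1)))"
      using eventually_gt_at_top[of 0]
    proof eventually_elim
      fix y :: real assume y: "y > 0"
      define z where "z = ?z y"
      have z: "z \<noteq> 0" "z - of_real \<alpha> \<noteq> 0" using y by (auto simp: z_def complex_eq_iff)
      define \<Sigma> where "\<Sigma> = (\<Sum>l\<le>m. u l * inverse z^l)"
      have 1: "(\<Sum>j\<le>m. N j * inverse z^(j + 1)) = inverse (z - of_real \<alpha>) * (\<Sigma> - of_real \<alpha> * N m * inverse z^(m + 1))"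
        using tele[OF z(1), of m] z(2) by (simp add: \<Sigma>_def field_simps)
      have 2: "inverse (1 - of_real \<alpha> * inverse z) = z * inverse (z - of_real \<alpha>)"
        using z by (simp add: field_simps)
      have 3: "z^(m + 1) * inverse z^(m + 1) = 1" by (rule power_mult_inverse_power[OF z(1)])
      have "z^(m + 1) * (- inverse (z - of_real \<alpha>) * g y + inverse (z - of_real \<alpha>) * (\<Sigma> - of_real \<alpha> * N m * inverse z^(m + 1)))
        = - inverse (z - of_real \<alpha>) * (z * (z^m * (g y - \<Sigma>)) + of_real \<alpha> * N m * (z^(m + 1) * inverse z^(m + 1)))"
        by (simp add: algebra_simps)
      also have "\<dots> = - inverse (z - of_real \<alpha>) * (z * (z^m * (g y - \<Sigma>)) + of_real \<alpha> * N m * (z * inverse z))"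
        by (simp only: 3 right_inverse[OF z(1)])
      also have "\<dots> = - (z * inverse (z - of_real \<alpha>)) * (z^m * (g y - \<Sigma>) + of_real \<alpha> * N m * inverse z)"
        by (simp add: algebra_simps)
      finally show "- inverse (1 - of_real \<alpha> * ?w y) * (?z y^m * (g y - (\<Sum>l\<le>m. u l * ?w y^l)) + of_real \<alpha> * N m * ?w y)
        = ?z y^(m + 1) * (- inverse (?z y - of_real \<alpha>) * g y + (\<Sum>j\<le>m. N j * ?w y^(j + 1)))"
        by (simp only: z_def[symmetric] 1 2 \<Sigma>_def[symmetric])
    qed
  qed
qed

section \<open>Entries of inverse matrices, and norm bounds\<close>

lemma holomorphic_on_det:
  fixes f :: "complex \<Rightarrow> complex^'n^'n"
  assumes "\<And>i j. (\<lambda>z. f z $ i $ j) holomorphic_on S"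
  shows "(\<lambda>z. det (f z)) holomorphic_on S"
  unfolding det_def by (intro holomorphic_intros assms)

lemma tendsto_det:
  fixes f :: "'a \<Rightarrow> complex^'n^'n"
  assumes "\<And>i j. ((\<lambda>z. f z $ i $ j) \<longlongrightarrow> l $ i $ j) F"
  shows "((\<lambda>z. det (f z)) \<longlongrightarrow> det l) F"
  unfolding det_def by (intro tendsto_intros assms)

text \<open>Writing the inverse entrywise as a quotient of determinants reduces its holomorphy and
  its limits to the entries of C.\<close>

lemma inverse_entry_Cramer:
  fixes C B :: "complex^'n^'n"
  assumes "C ** B = mat 1"
  shows "det C \<noteq> 0" "B $ k $ j = det (\<chi> i l. if l = k then axis j 1 $ i else C $ i $ l) / det C"
proof -
  show d: "det C \<noteq> 0"
    using assms by (metis det_I det_mul mult_zero_left zero_neq_one)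
  have "C *v (B *v axis j 1) = axis j 1" by (simp add: matrix_vector_mul_assoc assms)
  then have "B *v axis j 1 = (\<chi> k. det (\<chi> i l. if l = k then axis j 1 $ i else C $ i $ l) / det C)"
    using cramer[OF d] by blast
  then show "B $ k $ j = det (\<chi> i l. if l = k then axis j 1 $ i else C $ i $ l) / det C"
    by (metis (no_types, lifting) mat_vec_axis vec_lambda_beta)
qed

lemma op_norm_le_sum_entries: "op_norm A \<le> (\<Sum>i\<in>UNIV. \<Sum>j\<in>UNIV. norm (A $ i $ j))"
  unfolding op_norm_def
proof (rule onorm_bound)
  fix x
  have "norm (A *v x) \<le> (\<Sum>i\<in>UNIV. norm ((A *v x) $ i))"
    unfolding norm_vec_def by (rule L2_set_le_sum) simp
  also have "\<dots> \<le> (\<Sum>i\<in>UNIV. \<Sum>j\<in>UNIV. norm (A $ i $ j) * norm x)"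
  proof (rule sum_mono)
    fix i
    have "norm ((A *v x) $ i) \<le> (\<Sum>j\<in>UNIV. norm (A $ i $ j * x $ j))"
      unfolding matrix_vector_mult_def by (simp add: norm_sum)
    also have "\<dots> \<le> (\<Sum>j\<in>UNIV. norm (A $ i $ j) * norm x)"
      unfolding norm_mult by (intro sum_mono mult_left_mono Finite_Cartesian_Product.norm_nth_le) auto
    finally show "norm ((A *v x) $ i) \<le> (\<Sum>j\<in>UNIV. norm (A $ i $ j) * norm x)" .
  qed
  finally show "norm (A *v x) \<le> (\<Sum>i\<in>UNIV. \<Sum>j\<in>UNIV. norm (A $ i $ j)) * norm x"
    by (simp add: sum_distrib_right)
qed (simp add: sum_nonneg)

lemma bounded_on_ray:
  fixes h :: "real \<Rightarrow> complex"
  assumes cont: "continuous_on {1..} h" and lim: "(h \<longlongrightarrow> l) at_top"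
  obtains K where "\<And>y. y \<ge> 1 \<Longrightarrow> norm (h y) \<le> K"
proof -
  have "\<forall>\<^sub>F y in at_top. dist (h y) l < 1" using lim by (rule tendstoD) simp
  then obtain Y where Y: "\<And>y. y \<ge> Y \<Longrightarrow> dist (h y) l < 1" by (auto simp: eventually_at_top_linorder)
  have "compact (h ` {1..Y})"
    by (intro compact_continuous_image continuous_on_subset[OF cont]) auto
  then obtain K where K: "\<And>y. y \<in> {1..Y} \<Longrightarrow> norm (h y) \<le> K"
    using compact_imp_bounded bounded_iff by (metis (no_types, lifting) imageI)
  show thesis
  proof (rule that[of "max K (norm l + 1)"])
    fix y :: real assume y: "y \<ge> 1"
    show "norm (h y) \<le> max K (norm l + 1)"
    proof (cases "y \<le> Y")
      case True
      then show ?thesis using K[of y] y by simp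
    next
      case False
      then have "norm (h y - l) < 1" using Y[of y] by (simp add: dist_norm)
      then show ?thesis using norm_triangle_sub[of "h y" l] by simp
    qed
  qed
qed

lemma mat_vec_minus: "A *v (- x) = - (A *v (x :: complex^'n))"
  by (simp add: vec_eq_iff matrix_vector_mult_def sum_negf)

locale dominated_moment_function = dominated_seq \<alpha> m s
  for \<alpha> :: real and m :: nat and s :: "nat \<Rightarrow> complex^'q^'q" +
  fixes F :: "complex \<Rightarrow> complex^'q^'q"
  assumes m: "m \<ge> 1" and A_nonneg: "nonneg_herm (s 0)"
    and F: "F \<in> S_moment_class \<alpha> (m - 1) (S_transform \<alpha> s)"
begin

abbreviation "n \<equiv> m - 1"
abbreviation "\<sigma> \<equiv> stieltjes_measure \<alpha> F"
abbreviation "M \<equiv> moment \<alpha> \<sigma>"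

lemma F_S0: "F \<in> S0_class \<alpha>" using F by (simp add: S_moment_class_def)

lemmas \<sigma> = stieltjes_measure(1)[OF F_S0] and F_int = stieltjes_measure(2)[OF F_S0]

lemma M_int: "j \<le> n \<Longrightarrow> has_mm_integral \<alpha> \<sigma> (\<lambda>t. of_real t ^ j) (M j)"
  using F by (intro has_mm_integral_moment) (simp add: S_moment_class_def Let_def)

lemma M_eq: "j < n \<Longrightarrow> M j = t j"
  using F by (simp add: S_moment_class_def Let_def)

lemma M_last: "nonneg_herm (t n - M n)"
  using F by (simp add: S_moment_class_def Let_def)

lemma power_measurable: "(\<lambda>t. complex_of_real t ^ j) \<in> borel_measurable borel" by measurable

text \<open>The form of the mass M_0 is nonnegative and at most that of t_0, by equality if n > 0
  and by the inequality of the class if n = 0. As t_0 = - A r_1 A, it is squeezed to zero on the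
  null space of A.\<close>

lemma qf_M0:
  assumes "A *v x = 0"
  shows "qf (M 0) x = 0"
proof -
  have "nonneg_herm (t 0 - M 0)"
    using M_last M_eq[of 0] by (cases "n = 0") (auto simp: nonneg_herm_iff)
  then have "0 \<le> Re (qf (t 0 - M 0) x)" by (rule nonneg_hermD)
  moreover have "t 0 *v x = 0"
    by (simp add: t_eq minus_mat_vec assms flip: matrix_vector_mul_assoc)
  moreover have "has_bochner_integral (ext_measure \<alpha> \<sigma> x) (\<lambda>t. of_real t ^ 0) (qf (M 0) x)"
    using M_int[OF le0] has_mm_integral_iff[OF \<sigma> power_measurable] by blast
  then have "qf (M 0) x = of_real (measure (ext_measure \<alpha> \<sigma> x) (space (ext_measure \<alpha> \<sigma> x)))"
    by (auto dest!: has_bochner_integral_integral_eq simp: scaleR_conv_of_real)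
  ultimately show ?thesis
    by (simp add: matrix_vector_mult_diff_rdistrib cdot_diff_right cdot_minus_right measure_le_0_iff)
qed

text \<open>Domination by A is inherited from the mass: a direction without mass does not contribute
  to any integral, in particular not to F(z) or to the moments.\<close>

lemma mm_integral_nul:
  assumes N: "has_mm_integral \<alpha> \<sigma> f N" and f: "f \<in> borel_measurable borel" and x: "A *v x = 0"
  shows "N *v x = 0" "cdot x (N *v y) = 0"
proof -
  have "qf N (y + c *s x) = qf N y" for y c
  proof -
    have "ext_measure \<alpha> \<sigma> (y + c *s x) = ext_measure \<alpha> \<sigma> y"
      by (rule ext_measure_null_direction[OF \<sigma> M_int[OF le0] qf_M0[OF x]])
    moreover have "has_bochner_integral (ext_measure \<alpha> \<sigma> v) f (qf N v)" for v
      using N has_mm_integral_iff[OF \<sigma> f] by blast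
    ultimately show ?thesis by (metis has_bochner_integral_eq)
  qed
  then show "N *v x = 0" "cdot x (N *v y) = 0" by (rule qf_invariant_nul)+
qed

lemma A_compl_P: "A *v (x - P *v x) = 0"
proof -
  have "A ** P = A" by (rule hermitian_mult_mp_inverse[OF A_herm])
  then show ?thesis by (simp add: matrix_vector_mult_diff_distrib matrix_vector_mul_assoc)
qed

lemma mm_integral_P:
  assumes N: "has_mm_integral \<alpha> \<sigma> f N" and f: "f \<in> borel_measurable borel"
  shows "P ** N = N"
proof (rule matrix_eq_if_cdot_eq)
  fix x y
  have "cdot (x - P *v x) (N *v y) = 0" by (rule mm_integral_nul(2)[OF N f A_compl_P])
  moreover have "cdot x (P ** N *v y) = cdot (P *v x) (N *v y)"
    by (metis X(5) hermitian_cdot matrix_vector_mul_assoc)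
  ultimately show "cdot x (P ** N *v y) = cdot x (N *v y)"
    by (simp only: cdot_diff_left right_minus_eq)
qed

lemma P_F: "z \<in> slit_plane \<alpha> \<Longrightarrow> P ** F z = F z"
  by (rule mm_integral_P[OF F_int]) auto

lemma P_M: "j \<le> n \<Longrightarrow> P ** M j = M j"
  by (rule mm_integral_P[OF M_int]) auto

lemma ext_S:
  assumes "z \<in> slit_plane \<alpha>"
  shows "half_line_measure.S (ext_measure \<alpha> \<sigma> x) z = qf (F z) x"
proof -
  interpret half_line_measure "ext_measure \<alpha> \<sigma> x" \<alpha> by (rule half_line_ext_measure[OF \<sigma>])
  have "has_bochner_integral (ext_measure \<alpha> \<sigma> x) (\<lambda>t. inverse (of_real t - z)) (qf (F z) x)"
    using F_int[OF assms] by (subst (asm) has_mm_integral_iff[OF \<sigma>]) auto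
  then show ?thesis unfolding S_def by (rule has_bochner_integral_integral_eq)
qed

lemma F_real: "w < \<alpha> \<Longrightarrow> nonneg_herm (F (of_real w))"
  using F_S0 by (simp add: S0_class_def S_class_def)

text \<open>A kernel vector satisfies A x = - F(z) x because P F(z) = F(z), so the forms of A and
  F(z) at x add up to zero, and \<open>add_Stieltjes_eq_0\<close> separates them. Thus the
  Moore-Penrose inverse in the transform is an ordinary inverse.\<close>

lemma one_plus_XF_inj:
  assumes z: "z \<in> slit_plane \<alpha>" and x: "(mat 1 + X ** F z) *v x = 0"
  shows "x = 0"
proof -
  have x': "x = - (X *v (F z *v x))"
    using x by (simp add: matrix_vector_mult_add_rdistrib eq_neg_iff_add_eq_0 flip: matrix_vector_mul_assoc)
  have "A *v x = - (P ** F z *v x)"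
    using arg_cong[OF x', of "(*v) A"]
    by (simp only: mat_vec_minus matrix_vector_mul_assoc matrix_mul_assoc)
  then have Ax: "A *v x = - (F z *v x)" by (simp add: P_F[OF z])
  have "qf A x = 0"
  proof (rule add_Stieltjes_eq_0[OF z half_line_ext_measure[OF \<sigma>]])
    show "qf A x + half_line_measure.S (ext_measure \<alpha> \<sigma> x) z = 0"
      by (simp add: ext_S[OF z] Ax cdot_minus_right)
    show "qf A x \<in> \<real>\<^sub>\<ge>\<^sub>0" using A_nonneg by (simp add: nonneg_herm_iff)
    show "0 \<le> Re (half_line_measure.S (ext_measure \<alpha> \<sigma> x) (of_real w))" if "w < \<alpha>" for w
      using nonneg_hermD(2)[OF F_real[OF that]] that by (simp add: ext_S slit_plane_iff)
  qed
  then have "A *v x = 0" by (rule nonneg_herm_qf_eq_0[OF A_nonneg])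
  then have "F z *v x = 0" using Ax by simp
  then show "x = 0" using x' by simp
qed

definition "B z = matrix_inv (mat 1 + X ** F z)"

lemma B:
  assumes "z \<in> slit_plane \<alpha>"
  shows "(mat 1 + X ** F z) ** B z = mat 1" "B z ** (mat 1 + X ** F z) = mat 1"
proof -
  have "\<exists>C. C ** (mat 1 + X ** F z) = mat 1"
    unfolding matrix_left_invertible_ker using one_plus_XF_inj[OF assms] by blast
  then have "\<exists>C. (mat 1 + X ** F z) ** C = mat 1 \<and> C ** (mat 1 + X ** F z) = mat 1"
    using matrix_left_right_inverse by blast
  then have "(mat 1 + X ** F z) ** B z = mat 1 \<and> B z ** (mat 1 + X ** F z) = mat 1"
    unfolding B_def matrix_inv_def by (rule someI_ex)
  then show "(mat 1 + X ** F z) ** B z = mat 1" "B z ** (mat 1 + X ** F z) = mat 1" by auto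
qed

abbreviation "G \<equiv> inv_transform \<alpha> A F"

lemma G_eq: "z \<in> slit_plane \<alpha> \<Longrightarrow> G z = - mat_scale (inverse (z - of_real \<alpha>)) (A ** B z)"
  unfolding inv_transform_def using mp_inverse_inverse[OF B] by simp

lemma G_entry: "z \<in> slit_plane \<alpha> \<Longrightarrow> G z $ i $ j = - inverse (z - of_real \<alpha>) * (A ** B z) $ i $ j"
  by (simp add: G_eq mat_scale_def)

text \<open>The substitution x = (I + X F) y removes the inverse: the form of A B at x becomes the
  pairing of x with A y, and X A = P is absorbed by F. So the forms of A and F at one vector y
  govern the form of G at x.\<close>

lemma qf_G:
  assumes z: "z \<in> slit_plane \<alpha>"
  obtains y where "qf (G z) x = - inverse (z - of_real \<alpha>) * cnj (qf A y + qf (F z) y)"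
proof -
  define y where "y = B z *v x"
  have x: "x = y + X *v (F z *v y)"
  proof -
    have "(mat 1 + X ** F z) *v y = x" by (simp add: y_def matrix_vector_mul_assoc B[OF z])
    then show ?thesis by (simp add: matrix_vector_mult_add_rdistrib flip: matrix_vector_mul_assoc)
  qed
  have "cdot (X *v (F z *v y)) (A *v y) = cdot (F z *v y) (X *v (A *v y))"
    by (rule hermitian_cdot[OF X(3)])
  also have "\<dots> = cdot (F z *v y) (P *v y)" by (simp only: matrix_vector_mul_assoc X(4))
  also have "\<dots> = cdot (P *v (F z *v y)) y" by (rule hermitian_cdot[OF X(5), symmetric])
  also have "\<dots> = cnj (qf (F z) y)" by (simp add: matrix_vector_mul_assoc P_F[OF z] cnj_cdot)
  finally have "cdot x (A *v y) = qf A y + cnj (qf (F z) y)" by (subst x) (simp add: cdot_add_left)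
  also have "\<dots> = cnj (qf A y + qf (F z) y)"
    by (simp add: cnj_cdot hermitian_cdot[OF A_herm])
  finally have "qf (G z) x = - inverse (z - of_real \<alpha>) * cnj (qf A y + qf (F z) y)"
    by (simp add: G_eq[OF z] minus_mat_vec mat_scale_vec cdot_linear y_def flip: matrix_vector_mul_assoc)
  then show thesis by (rule that)
qed

section \<open>The transform belongs to the Stieltjes class\<close>

lemma F_holomorphic: "(\<lambda>z. F z $ i $ j) holomorphic_on slit_plane \<alpha>"
  using F_S0 by (simp add: S0_class_def S_class_def)

lemma one_plus_XF_holomorphic: "(\<lambda>z. (mat 1 + X ** F z) $ i $ j) holomorphic_on slit_plane \<alpha>"
proof -
  have "(\<lambda>z. mat 1 $ i $ j + (\<Sum>k\<in>UNIV. X $ i $ k * F z $ k $ j)) holomorphic_on slit_plane \<alpha>"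
    by (intro holomorphic_intros F_holomorphic)
  then show ?thesis by (simp add: matrix_matrix_mult_def)
qed

lemma B_holomorphic: "(\<lambda>z. B z $ k $ j) holomorphic_on slit_plane \<alpha>"
proof (rule holomorphic_transform)
  let ?C = "\<lambda>z. mat 1 + X ** F z"
  show "(\<lambda>z. det (\<chi> i l. if l = k then axis j 1 $ i else ?C z $ i $ l) / det (?C z)) holomorphic_on slit_plane \<alpha>"
  proof (intro holomorphic_intros holomorphic_on_det)
    show "(\<lambda>z. (\<chi> i l. if l = k then axis j 1 $ i else ?C z $ i $ l) $ i $ l) holomorphic_on slit_plane \<alpha>" for i l
      using one_plus_XF_holomorphic[of i l] by (cases "l = k") (simp_all del: vector_add_component)
  qed (use one_plus_XF_holomorphic inverse_entry_Cramer(1)[OF B(1)] in auto)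
  show "det (\<chi> i l. if l = k then axis j 1 $ i else ?C z $ i $ l) / det (?C z) = B z $ k $ j" if "z \<in> slit_plane \<alpha>" for z
    by (rule inverse_entry_Cramer(2)[OF B(1)[OF that], symmetric])
qed

lemma G_holomorphic: "(\<lambda>z. G z $ i $ j) holomorphic_on slit_plane \<alpha>"
proof (rule holomorphic_transform)
  have "of_real \<alpha> \<notin> slit_plane \<alpha>" by (simp add: slit_plane_iff)
  then show "(\<lambda>z. - inverse (z - of_real \<alpha>) * (\<Sum>k\<in>UNIV. A $ i $ k * B z $ k $ j)) holomorphic_on slit_plane \<alpha>"
    by (intro holomorphic_intros B_holomorphic) auto
  show "- inverse (z - of_real \<alpha>) * (\<Sum>k\<in>UNIV. A $ i $ k * B z $ k $ j) = G z $ i $ j" if "z \<in> slit_plane \<alpha>" for z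
    by (simp add: G_entry[OF that] matrix_matrix_mult_def)
qed

lemma G_S_class: "G \<in> S_class \<alpha>"
  unfolding S_class_def
proof (intro CollectI conjI allI impI G_holomorphic)
  fix z :: complex assume z: "Im z > 0"
  then have zs: "z \<in> slit_plane \<alpha>" by (simp add: slit_plane_iff)
  show "nonneg_herm (im_part (G z))"
    unfolding nonneg_herm_im_part_iff
  proof
    fix x
    obtain y where y: "qf (G z) x = - inverse (z - of_real \<alpha>) * cnj (qf A y + qf (F z) y)"
      using qf_G[OF zs] by blast
    interpret half_line_measure "ext_measure \<alpha> \<sigma> y" \<alpha> by (rule half_line_ext_measure[OF \<sigma>])
    let ?Q = "qf A y + qf (F z) y" and ?d = "z - of_real \<alpha>"
    have d: "?d \<noteq> 0" using z by (auto simp: complex_eq_iff)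
    have "Im (?d * qf A y) = Re (qf A y) * Im z" by (simp add: nonneg_hermD(3)[OF A_nonneg])
    moreover have "0 \<le> Re (qf A y) * Im z"
      using z nonneg_hermD(2)[OF A_nonneg, of y] by (intro mult_nonneg_nonneg) auto
    ultimately have "0 \<le> Im (?d * qf A y)" by (simp only:)
    moreover have "0 \<le> Im (?d * qf (F z) y)" using S_mult_Im_nonneg[OF z] by (simp add: ext_S[OF zs])
    moreover define w where "w = ?d * ?Q"
    ultimately have Q: "0 \<le> Im w" by (simp only: w_def distrib_left plus_complex.sel add_nonneg_nonneg)
    \<comment> \<open>Expanding the fraction by the conjugate of z - \<alpha> writes the form of G
      as - conj(w) / |z - \<alpha>|^2, whose imaginary part has the sign of Im w.\<close>
    define k where "k = (norm ?d)\<^sup>2"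
    have "- inverse ?d * cnj ?Q = - (cnj ?Q / ?d)" by (simp only: divide_inverse mult_minus_left mult.commute)
    also have "cnj ?Q / ?d = cnj w / of_real k"
      by (subst complex_div_cnj) (simp only: w_def k_def complex_cnj_mult mult.commute)
    finally have "qf (G z) x = - (cnj w / of_real k)" by (simp only: y)
    then have "Im (qf (G z) x) = Im w / k" by (simp add: Im_divide_of_real)
    then show "0 \<le> Im (qf (G z) x)" using Q by (simp add: k_def)
  qed
next
  fix w :: real assume w: "w < \<alpha>"
  then have zs: "of_real w \<in> slit_plane \<alpha>" by (simp add: slit_plane_iff)
  show "nonneg_herm (G (of_real w))"
    unfolding nonneg_herm_iff
  proof
    fix x
    obtain y where y: "qf (G (of_real w)) x = - inverse (of_real w - of_real \<alpha>) * cnj (qf A y + qf (F (of_real w)) y)"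
      using qf_G[OF zs] by blast
    have 1: "qf A y = of_real (Re (qf A y))" by (rule qf_nonneg_herm[OF A_nonneg])
    have 2: "qf (F (of_real w)) y = of_real (Re (qf (F (of_real w)) y))" by (rule qf_nonneg_herm[OF F_real[OF w]])
    have "qf (G (of_real w)) x = of_real (inverse (\<alpha> - w) * (Re (qf A y) + Re (qf (F (of_real w)) y)))"
    proof -
      have i: "inverse (of_real w - of_real \<alpha> :: complex) = - of_real (inverse (\<alpha> - w))"
        by (metis inverse_minus_eq minus_diff_eq of_real_diff of_real_inverse)
      show ?thesis unfolding y i by (subst 1, subst 2) simp
    qed
    moreover have "0 \<le> inverse (\<alpha> - w) * (Re (qf A y) + Re (qf (F (of_real w)) y))"
      using w nonneg_hermD(2)[OF A_nonneg, of y] nonneg_hermD(2)[OF F_real[OF w], of y] by simp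
    ultimately show "qf (G (of_real w)) x \<in> \<real>\<^sub>\<ge>\<^sub>0" by (simp only: nonneg_Reals_of_real_iff)
  qed
qed

section \<open>Asymptotic expansion and moments of the transform\<close>

lemma F_expands:
  "expands (\<lambda>y. F (\<i> * of_real y) $ i $ j) (\<lambda>l. if l = 0 then 0 else - M (l - 1) $ i $ j) m"
proof -
  have qf: "expands (\<lambda>y. qf (F (\<i> * of_real y)) x) (\<lambda>l. if l = 0 then 0 else - qf (M (l - 1)) x) m" for x
  proof -
    interpret half_line_measure "ext_measure \<alpha> \<sigma> x" \<alpha> by (rule half_line_ext_measure[OF \<sigma>])
    have int: "has_bochner_integral (ext_measure \<alpha> \<sigma> x) (\<lambda>t. of_real t ^ j) (qf (M j) x)" if "j \<le> n" for j
      using M_int[OF that] has_mm_integral_iff[OF \<sigma> power_measurable] by blast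
    have "expands_at_infinity S mom n"
      using int by (intro S_expands_at_infinity) (auto simp: has_bochner_integral_iff)
    then have "expands (\<lambda>y. S (\<i> * of_real y)) (\<lambda>l. if l = 0 then 0 else - mom (l - 1)) m"
      using m by (simp add: expands_at_infinity_iff)
    then have "expands (\<lambda>y. S (\<i> * of_real y)) (\<lambda>l. if l = 0 then 0 else - qf (M (l - 1)) x) m"
      by (rule expands_cong) (use int in \<open>auto simp: has_bochner_integral_iff mom_def\<close>)
    then show ?thesis
      by (rule expands_cong_eventually)
        (use eventually_gt_at_top[of 0] in eventually_elim, simp add: ext_S slit_plane_iff)
  qed
  let ?v = "\<lambda>p. axis i 1 + \<i>^p *s axis j 1 :: complex^'q"
  have "expands (\<lambda>y. \<Sum>p<4. (-\<i>)^p / 4 * qf (F (\<i> * of_real y)) (?v p))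
     (\<lambda>l. \<Sum>p<4. (-\<i>)^p / 4 * (if l = 0 then 0 else - qf (M (l - 1)) (?v p))) m"
    by (intro expands_sum qf)
  then have "expands (\<lambda>y. F (\<i> * of_real y) $ i $ j)
     (\<lambda>l. \<Sum>p<4. (-\<i>)^p / 4 * (if l = 0 then 0 else - qf (M (l - 1)) (?v p))) m"
    by (simp only: entry_polarization[symmetric])
  then show ?thesis
  proof (rule expands_cong)
    fix l
    show "(\<Sum>p<4. (-\<i>)^p / 4 * (if l = 0 then 0 else - qf (M (l - 1)) (?v p))) = (if l = 0 then 0 else - M (l - 1) $ i $ j)"
    proof (cases l)
      case (Suc k)
      then show ?thesis by (simp add: entry_polarization[of "M k" i j] sum_negf)
    qed simp
  qed
qed

definition "a l = (if l = 0 then mat 1 else - (X ** M (l - 1)))"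

lemma one_plus_XF_expands: "expands (\<lambda>y. (mat 1 + X ** F (\<i> * of_real y)) $ i $ j) (\<lambda>l. a l $ i $ j) m"
proof -
  let ?b = "\<lambda>l. if l = 0 then 0 else - M (l - 1)"
  have const: "expands (\<lambda>y. C $ i $ j) (\<lambda>l. unit_seq C l $ i $ j) m" for C :: "complex^'q^'q" and i j
    by (rule expands_cong[OF expands_const]) (simp add: unit_seq_def)
  have Fe: "expands (\<lambda>y. F (\<i> * of_real y) $ i $ j) (\<lambda>l. ?b l $ i $ j) m" for i j
    by (rule expands_cong[OF F_expands]) simp
  have "expands (\<lambda>y. (X ** F (\<i> * of_real y)) $ i $ j) (\<lambda>l. conv (unit_seq X) ?b l $ i $ j) m"
    by (rule expands_matrix_mult[OF const Fe])
  from expands_add[OF const[of "mat 1" i j] this] show ?thesis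
    by (rule expands_cong_eventually[OF expands_cong])
      (auto simp: conv_unit_left unit_seq_def a_def matrix_mult_minus_right matrix_mult_zero)
qed

text \<open>The expected moments of G: those of s, except that the last one is lowered by the defect
  t_n - M_n of F. The sequence \<open>v\<close> is the shifted sequence of \<open>N\<close> up to
  index m.\<close>

definition "N l = (if l = m then s m - (t n - M n) else s l)"
definition "v l = (if l = m then u m - (t n - M n) else u l)"

text \<open>The coefficient form of (A B)(I + X F) = A up to order m. Below m it follows from u r =
  P; at m the defect D occurs twice, as - D in v_m and as A X D = P D = D in the product of v_0 with
  a_m, and cancels.\<close>

lemma conv_v_a:
  assumes k: "k \<le> m"
  shows "conv v a k = unit_seq A k"
proof -
  \<comment> \<open>The constant coefficient is I instead of r_0 A = P; the difference I - P is
    annihilated by u.\<close>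
  define b where "b l = (if l = 0 then mat 1 else r l ** A)" for l
  have Xt: "X ** t l = - (r (l + 1) ** A)" for l
  proof -
    have "X ** t l = - (P ** r (l + 1) ** A)" by (simp add: t_eq matrix_mult_minus_right matrix_mul_assoc X(4))
    then show ?thesis by (simp add: P_r)
  qed
  have a_b: "a l = b l" if "l < m" for l
    using that by (cases l) (simp_all add: a_def b_def M_eq Xt)
  have conv_b: "conv u b k = unit_seq A k"
  proof -
    have "conv u b k = (\<Sum>i=0..k. u i ** (r (k - i) ** A) + (if i = k then u k - u k ** (X ** A) else 0))"
      unfolding conv_def
    proof (rule sum.cong)
      fix i assume "i \<in> {0..k}"
      then show "u i ** b (k - i) = u i ** (r (k - i) ** A) + (if i = k then u k - u k ** (X ** A) else 0)"
        by (auto simp: b_def r_rec[of 0])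
    qed simp
    also have "\<dots> = conv u r k ** A + (u k - u k ** P)"
      by (simp add: sum.distrib conv_def matrix_mult_sum_left matrix_mul_assoc X(4))
    also have "\<dots> = unit_seq A k" using k by (simp add: conv_u_r u_P unit_seq_def X(1) matrix_mult_zero)
    finally show ?thesis .
  qed
  show ?thesis
  proof (cases "k = m")
    case False
    then have "conv v a k = conv u b k" using k by (intro conv_cong) (auto simp: v_def a_b)
    then show ?thesis using conv_b by simp
  next
    case True
    define D where "D = t n - M n"
    have vm: "v m = u m - D" by (simp add: v_def D_def)
    have aM: "a m = b m + X ** D"
      using m Xt[of n] by (simp add: a_def b_def D_def matrix_mult_diff_right)
    have PD: "P ** D = D"
      by (simp add: D_def matrix_mult_diff_right P_M t_eq matrix_mult_minus_right matrix_mul_assoc X(1))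
    have "conv v a m = (\<Sum>i=0..m. u i ** b (m - i) + (if i = m then - D else 0) + (if i = 0 then A ** (X ** D) else 0))"
      unfolding conv_def
    proof (rule sum.cong)
      fix i assume i: "i \<in> {0..m}"
      consider "i = 0" | "i = m" "i \<noteq> 0" | "0 < i" "i < m" using i by fastforce
      then show "v i ** a (m - i) = u i ** b (m - i) + (if i = m then - D else 0) + (if i = 0 then A ** (X ** D) else 0)"
      proof cases
        case 1
        then show ?thesis using m by (simp add: v_def aM matrix_add_ldistrib u_0)
      next
        case 2
        then show ?thesis by (simp add: vm a_def b_def)
      next
        case 3
        then show ?thesis by (simp add: v_def a_b)
      qed
    qed simp
    also have "\<dots> = conv u b m" by (simp add: sum.distrib conv_def matrix_mul_assoc PD)
    finally show ?thesis using conv_b True by simp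
  qed
qed

text \<open>No series is inverted: for the polynomial U with coefficients v, A - U (I + X F) is
  o(z^(-m)), and multiplication by B, which tends to I, turns this into A B - U.\<close>

lemma AB_expands: "expands (\<lambda>y. (A ** B (\<i> * of_real y)) $ i $ j) (\<lambda>l. v l $ i $ j) m"
proof -
  let ?z = "\<lambda>y::real. \<i> * complex_of_real y"
  define U :: "real \<Rightarrow> complex^'q^'q" where "U y = (\<chi> i j. \<Sum>l\<le>m. v l $ i $ j * inverse (?z y)^l)" for y
  let ?C = "\<lambda>y. mat 1 + X ** F (?z y)"
  have UC: "((\<lambda>y. ?z y^m * (A - U y ** ?C y) $ i $ k) \<longlongrightarrow> 0) at_top" for i k
  proof -
    have "expands (\<lambda>y. U y $ i $ j) (\<lambda>l. v l $ i $ j) m" for i j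
      unfolding U_def using expands_polynomial[where a = "\<lambda>l. v l $ i $ j"] by simp
    from expands_matrix_mult[OF this one_plus_XF_expands]
    have "expands (\<lambda>y. (U y ** ?C y) $ i $ k) (\<lambda>l. if l = 0 then A $ i $ k else 0) m"
      by (rule expands_cong) (auto simp: conv_v_a unit_seq_def)
    then have "((\<lambda>y. ?z y^m * ((U y ** ?C y) $ i $ k - A $ i $ k)) \<longlongrightarrow> 0) at_top"
      unfolding expands_def by (subst (asm) sum.atMost_shift) simp
    from tendsto_minus[OF this] show ?thesis by (simp add: algebra_simps)
  qed
  have ev: "\<forall>\<^sub>F y in at_top. ?z y \<in> slit_plane \<alpha>"
    using eventually_gt_at_top[of 0] by eventually_elim (simp add: slit_plane_iff)
  have B_lim: "((\<lambda>y. B (?z y) $ k $ j) \<longlongrightarrow> mat 1 $ k $ j) at_top" for k j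
  proof -
    have C_lim: "((\<lambda>y. ?C y $ i $ l) \<longlongrightarrow> mat 1 $ i $ l) at_top" for i l
      using expands_tendsto[OF one_plus_XF_expands] by (simp add: a_def del: vector_add_component)
    let ?R = "\<lambda>C. det (\<chi> i l. if l = k then axis j 1 $ i else C $ i $ l) / det (C :: complex^'q^'q)"
    have "((\<lambda>y. ?R (?C y)) \<longlongrightarrow> ?R (mat 1)) at_top"
    proof (intro tendsto_divide tendsto_det)
      show "((\<lambda>y. (\<chi> i l. if l = k then axis j 1 $ i else ?C y $ i $ l) $ i $ l) \<longlongrightarrow>
        (\<chi> i l. if l = k then axis j 1 $ i else mat 1 $ i $ l) $ i $ l) at_top" for i l
        using C_lim[of i l] by (cases "l = k") (simp_all del: vector_add_component)
    qed (use C_lim in auto)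
    moreover have "?R (mat 1) = mat 1 $ k $ j"
      using inverse_entry_Cramer(2)[of "mat 1 :: complex^'q^'q" "mat 1" k j] by simp
    ultimately have "((\<lambda>y. ?R (?C y)) \<longlongrightarrow> mat 1 $ k $ j) at_top" by simp
    then show ?thesis
      by (rule Lim_transform_eventually)
        (use ev in eventually_elim, rule inverse_entry_Cramer(2)[OF B(1), symmetric])
  qed
  have "((\<lambda>y. \<Sum>k\<in>UNIV. (?z y^m * (A - U y ** ?C y) $ i $ k) * B (?z y) $ k $ j) \<longlongrightarrow> (\<Sum>k\<in>UNIV. 0 * mat 1 $ k $ j)) at_top"
    by (intro tendsto_sum tendsto_mult UC B_lim)
  then have "((\<lambda>y. \<Sum>k\<in>UNIV. (?z y^m * (A - U y ** ?C y) $ i $ k) * B (?z y) $ k $ j) \<longlongrightarrow> 0) at_top"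
    by (simp only: mult_zero_left sum.neutral_const)
  then show ?thesis unfolding expands_def
  proof (rule Lim_transform_eventually)
    show "\<forall>\<^sub>F y in at_top. (\<Sum>k\<in>UNIV. (?z y^m * (A - U y ** ?C y) $ i $ k) * B (?z y) $ k $ j) =
      ?z y^m * ((A ** B (?z y)) $ i $ j - (\<Sum>l\<le>m. v l $ i $ j * inverse (?z y)^l))"
      using ev
    proof eventually_elim
      fix y assume y: "?z y \<in> slit_plane \<alpha>"
      have "(A - U y ** ?C y) ** B (?z y) = A ** B (?z y) - U y"
        by (simp only: matrix_mult_diff_left matrix_mul_assoc[symmetric] B[OF y] matrix_mul_rid)
      then have "(A ** B (?z y)) $ i $ j - U y $ i $ j = ((A - U y ** ?C y) ** B (?z y)) $ i $ j" by simp
      also have "\<dots> = (\<Sum>k\<in>UNIV. (A - U y ** ?C y) $ i $ k * B (?z y) $ k $ j)"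
        by (simp add: matrix_matrix_mult_def)
      finally show "(\<Sum>k\<in>UNIV. (?z y^m * (A - U y ** ?C y) $ i $ k) * B (?z y) $ k $ j) =
        ?z y^m * ((A ** B (?z y)) $ i $ j - (\<Sum>l\<le>m. v l $ i $ j * inverse (?z y)^l))"
        by (simp only: U_def vec_lambda_beta sum_distrib_left mult.assoc)
    qed
  qed
qed

lemma G_expands: "expands_at_infinity (\<lambda>z. G z $ i $ j) (\<lambda>l. N l $ i $ j) m"
proof -
  let ?z = "\<lambda>y::real. \<i> * complex_of_real y"
  have "((\<lambda>y. ?z y^(m + 1) * (- inverse (?z y - of_real \<alpha>) * (A ** B (?z y)) $ i $ j
     + (\<Sum>l\<le>m. N l $ i $ j * inverse (?z y)^(l + 1)))) \<longlongrightarrow> 0) at_top"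
  proof (rule expands_resolvent_mult[OF AB_expands])
    show "N 0 $ i $ j = v 0 $ i $ j" using m by (simp add: N_def v_def u_0)
    show "N (Suc l) $ i $ j = v (Suc l) $ i $ j + of_real \<alpha> * N l $ i $ j" if "l < m" for l
      using that by (auto simp: N_def v_def u_delay delay_def scaleR_conv_of_real[where 'a = complex])
  qed
  then show ?thesis unfolding expands_at_infinity_def
  proof (rule Lim_transform_eventually)
    show "\<forall>\<^sub>F y in at_top. ?z y^(m + 1) * (- inverse (?z y - of_real \<alpha>) * (A ** B (?z y)) $ i $ j
     + (\<Sum>l\<le>m. N l $ i $ j * inverse (?z y)^(l + 1))) = ?z y^(m + 1) * (G (?z y) $ i $ j + (\<Sum>l\<le>m. N l $ i $ j * inverse (?z y)^(l + 1)))"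
      using eventually_gt_at_top[of 0]
    proof eventually_elim
      fix y :: real assume "y > 0"
      then have "?z y \<in> slit_plane \<alpha>" by (simp add: slit_plane_iff)
      then show "?z y^(m + 1) * (- inverse (?z y - of_real \<alpha>) * (A ** B (?z y)) $ i $ j
     + (\<Sum>l\<le>m. N l $ i $ j * inverse (?z y)^(l + 1))) = ?z y^(m + 1) * (G (?z y) $ i $ j + (\<Sum>l\<le>m. N l $ i $ j * inverse (?z y)^(l + 1)))"
        by (simp only: G_entry)
    qed
  qed
qed

text \<open>The expansion of order 0 makes y G(i y) converge at infinity, and continuity bounds it
  on the rest of the ray.\<close>

lemma G_S0_class: "G \<in> S0_class \<alpha>"
proof -
  let ?z = "\<lambda>y::real. \<i> * complex_of_real y"
  have "\<exists>K. \<forall>y\<ge>1. norm (?z y * G (?z y) $ i $ j) \<le> K" for i j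
  proof -
    have "expands_at_infinity (\<lambda>z. G z $ i $ j) (\<lambda>l. N l $ i $ j) 0"
      by (rule expands_at_infinity_less[OF G_expands]) simp
    then have "((\<lambda>y. ?z y * (G (?z y) $ i $ j + N 0 $ i $ j * inverse (?z y)) - N 0 $ i $ j) \<longlongrightarrow> 0 - N 0 $ i $ j) at_top"
      unfolding expands_at_infinity_def by (intro tendsto_diff tendsto_const) simp
    then have lim: "((\<lambda>y. ?z y * G (?z y) $ i $ j) \<longlongrightarrow> 0 - N 0 $ i $ j) at_top"
    proof (rule Lim_transform_eventually)
      show "\<forall>\<^sub>F y in at_top. ?z y * (G (?z y) $ i $ j + N 0 $ i $ j * inverse (?z y)) - N 0 $ i $ j = ?z y * G (?z y) $ i $ j"
        using eventually_gt_at_top[of 0] by eventually_elim (simp add: field_simps)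
    qed
    have "continuous_on {1..} (\<lambda>y. ?z y * G (?z y) $ i $ j)"
      by (intro continuous_intros continuous_on_compose2[OF holomorphic_on_imp_continuous_on[OF G_holomorphic]])
        (auto simp: slit_plane_iff)
    from bounded_on_ray[OF this lim] show ?thesis by blast
  qed
  then obtain K where K: "\<And>i j y. y \<ge> 1 \<Longrightarrow> norm (?z y * G (?z y) $ i $ j) \<le> K i j" by metis
  have "y * op_norm (G (?z y)) \<le> (\<Sum>i\<in>UNIV. \<Sum>j\<in>UNIV. K i j)" if "y \<ge> 1" for y
  proof -
    have "y * op_norm (G (?z y)) \<le> y * (\<Sum>i\<in>UNIV. \<Sum>j\<in>UNIV. norm (G (?z y) $ i $ j))"
      using that by (intro mult_left_mono op_norm_le_sum_entries) auto
    also have "\<dots> = (\<Sum>i\<in>UNIV. \<Sum>j\<in>UNIV. norm (?z y * G (?z y) $ i $ j))"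
      using that by (simp add: sum_distrib_left norm_mult)
    also have "\<dots> \<le> (\<Sum>i\<in>UNIV. \<Sum>j\<in>UNIV. K i j)" by (intro sum_mono K that)
    finally show ?thesis .
  qed
  then have "bdd_above ((\<lambda>y. y * op_norm (G (?z y))) ` {1..})" by (auto intro!: bdd_aboveI)
  then show ?thesis using G_S_class by (simp add: S0_class_def)
qed

lemma G_moments:
  assumes "k \<le> m"
  shows "has_mm_integral \<alpha> (stieltjes_measure \<alpha> G) (\<lambda>t. of_real t ^ k) (N k)"
proof -
  let ?\<tau> = "stieltjes_measure \<alpha> G"
  note \<tau> = stieltjes_measure(1)[OF G_S0_class] and G_int = stieltjes_measure(2)[OF G_S0_class]
  show ?thesis
    unfolding has_mm_integral_iff[OF \<tau> power_measurable]
  proof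
    fix x
    interpret half_line_measure "ext_measure \<alpha> ?\<tau> x" \<alpha> by (rule half_line_ext_measure[OF \<tau>])
    have "expands (\<lambda>y. \<Sum>i\<in>UNIV. 1 * (\<Sum>j\<in>UNIV. cnj (x $ i) * x $ j * G (\<i> * of_real y) $ i $ j))
      (\<lambda>l. \<Sum>i\<in>UNIV. 1 * (\<Sum>j\<in>UNIV. cnj (x $ i) * x $ j * (if l = 0 then 0 else - (N (l - 1) $ i $ j)))) (m + 1)"
      using G_expands unfolding expands_at_infinity_iff by (intro expands_sum)
    then have "expands (\<lambda>y. qf (G (\<i> * of_real y)) x) (\<lambda>l. if l = 0 then 0 else - qf (N (l - 1)) x) (m + 1)"
      unfolding qf_entries
      by (rule expands_cong_eventually[OF expands_cong]) (auto simp: sum_negf)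
    then have "expands (\<lambda>y. S (\<i> * of_real y)) (\<lambda>l. if l = 0 then 0 else - qf (N (l - 1)) x) (m + 1)"
    proof (rule expands_cong_eventually)
      show "\<forall>\<^sub>F y in at_top. qf (G (\<i> * of_real y)) x = S (\<i> * of_real y)"
        using eventually_gt_at_top[of 0]
      proof eventually_elim
        fix y :: real assume "y > 0"
        then have "\<i> * of_real y \<in> slit_plane \<alpha>" by (simp add: slit_plane_iff)
        from G_int[OF this] show "qf (G (\<i> * of_real y)) x = S (\<i> * of_real y)"
          unfolding S_def by (subst (asm) has_mm_integral_iff[OF \<tau>])
            (auto intro!: has_bochner_integral_integral_eq[symmetric])
      qed
    qed
    then have "expands_at_infinity S (\<lambda>l. qf (N l) x) m" by (simp only: expands_at_infinity_iff)
    then show "has_bochner_integral (ext_measure \<alpha> ?\<tau> x) (\<lambda>t. of_real t ^ k) (qf (N k) x)"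
      using assms by (rule Hamburger_Nevanlinna)
  qed
qed

lemma G_S_moment_class: "G \<in> S_moment_class \<alpha> m s"
proof -
  have "moment_exists \<alpha> (stieltjes_measure \<alpha> G) j" if "j \<le> m" for j
    unfolding moment_exists_def using G_moments[OF that] by blast
  moreover have mom: "moment \<alpha> (stieltjes_measure \<alpha> G) j = N j" if "j \<le> m" for j
    by (rule moment_eqI[OF G_moments[OF that]])
  moreover have "nonneg_herm (s m - moment \<alpha> (stieltjes_measure \<alpha> G) m)"
    using M_last by (simp add: mom N_def)
  ultimately show ?thesis using G_S0_class by (simp add: S_moment_class_def Let_def N_def)
qed

end

section \<open>Solvability\<close>

text \<open>For n = 0 only an upper bound on the mass is prescribed, so the zero function is a
  solution. Its zeroth moment is read off from the trivial expansion, without determining the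
  measure.\<close>

lemma zero_in_S_moment_class:
  fixes t :: "nat \<Rightarrow> complex^'q^'q"
  assumes "nonneg_herm (t 0)"
  shows "(\<lambda>_. 0) \<in> S_moment_class \<alpha> 0 t"
proof -
  have zero: "im_part 0 = 0" "nonneg_herm 0" "op_norm 0 = 0"
    by (simp_all add: im_part_def mat_scale_def vec_eq_iff nonneg_herm_iff op_norm_def onorm_zero)
  have S0: "(\<lambda>_. 0 :: complex^'q^'q) \<in> S0_class \<alpha>"
    by (auto simp: S0_class_def S_class_def zero)
  let ?\<sigma> = "stieltjes_measure \<alpha> (\<lambda>_. 0 :: complex^'q^'q)"
  note \<sigma> = stieltjes_measure(1)[OF S0] and int = stieltjes_measure(2)[OF S0]
  have 0: "has_mm_integral \<alpha> ?\<sigma> (\<lambda>t. of_real t ^ 0) 0"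
  proof (subst has_mm_integral_iff[OF \<sigma>], simp, rule allI)
    fix x
    interpret half_line_measure "ext_measure \<alpha> ?\<sigma> x" \<alpha> by (rule half_line_ext_measure[OF \<sigma>])
    have S: "S z = 0" if "z \<in> slit_plane \<alpha>" for z
      using int[OF that] has_mm_integral_iff[OF \<sigma>, of "\<lambda>t. inverse (of_real t - z)" 0]
      by (auto simp: S_def dest: has_bochner_integral_integral_eq)
    have "\<forall>\<^sub>F y in at_top. S (\<i> * of_real y) = 0"
      using eventually_gt_at_top[of 0] by eventually_elim (simp add: S slit_plane_iff)
    then have "expands_at_infinity S (\<lambda>_. 0) 0"
      unfolding expands_at_infinity_def by (intro tendsto_eventually) (auto elim: eventually_mono)
    from Hamburger_Nevanlinna[OF this order_refl]
    show "has_bochner_integral (ext_measure \<alpha> ?\<sigma> x) (\<lambda>t. of_real t ^ 0) (qf 0 x)" by simp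
  qed
  have "moment_exists \<alpha> ?\<sigma> 0" unfolding moment_exists_def by (rule exI[of _ 0], rule 0)
  moreover have "moment \<alpha> ?\<sigma> 0 = 0" by (rule moment_eqI[OF 0])
  ultimately show ?thesis using S0 assms by (simp add: S_moment_class_def Let_def)
qed

lemma K_class_head: "s \<in> K_class m \<alpha> \<Longrightarrow> nonneg_herm (s 0)"
  using block_nonneg_herm_diag[OF K_class_blocks(1), of s m \<alpha> 0]
  by (cases "m = 0") (auto simp: K_class_def hankel_def)

lemma dominated_seq_K_class:
  "s \<in> K_class m \<alpha> \<Longrightarrow> s \<in> D_class m \<Longrightarrow> dominated_seq m s"
  by (simp add: dominated_seq_def K_class_hermitian)

lemma inv_transform_S_moment_class:
  assumes "m \<ge> 1" "s \<in> K_class m \<alpha>" "s \<in> D_class m"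
    and "F \<in> S_moment_class \<alpha> (m - 1) (S_transform \<alpha> s)"
  shows "inv_transform \<alpha> (s 0) F \<in> S_moment_class \<alpha> m s"
proof -
  interpret dominated_moment_function \<alpha> m s F
    using dominated_seq_K_class[OF assms(2,3)] K_class_head[OF assms(2)] assms(1,4)
    by (simp add: dominated_moment_function_def dominated_moment_function_axioms_def)
  show ?thesis by (rule G_S_moment_class)
qed

text \<open>The induction ranges over the whole class, since the transform may leave the dominated
  sequences; domination is restored at each step by lowering the last term.\<close>

lemma S_moment_class_nonempty: "t \<in> K_class n \<alpha> \<Longrightarrow> S_moment_class \<alpha> n t \<noteq> {}"
proof (induction n arbitrary: t)
  case 0
  have "nonneg_herm (t 0)" by (rule K_class_head[OF 0])
  from zero_in_S_moment_class[of t, OF this] show ?case by blast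
next
  case (Suc n)
  obtain t' where t': "t' \<in> K_class (Suc n) \<alpha>" "t' \<in> D_class (Suc n)"
      "\<And>j. j < Suc n \<Longrightarrow> t' j = t j" "nonneg_herm (t (Suc n) - t' (Suc n))"
    using K_class_dominated_modification[OF Suc.prems] by auto
  have "S_transform \<alpha> t' \<in> K_class n \<alpha>"
    using dominated_seq.S_transform_K_class[OF dominated_seq_K_class[OF t'(1,2)] _ t'(1)] by simp
  then obtain F where "F \<in> S_moment_class \<alpha> n (S_transform \<alpha> t')" using Suc.IH by blast
  then have G: "inv_transform \<alpha> (t' 0) F \<in> S_moment_class \<alpha> (Suc n) t'"
    using t' by (intro inv_transform_S_moment_class) auto
  have add: "nonneg_herm (A - C)" if "nonneg_herm (A - B)" "nonneg_herm (B - C)" for A B C :: "complex^'a^'a"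
  proof -
    have "qf (A - C) x = qf (A - B) x + qf (B - C) x" for x
      by (simp add: matrix_vector_mult_diff_rdistrib cdot_linear)
    then show ?thesis using that by (simp add: nonneg_herm_iff nonneg_Reals_add_I)
  qed
  \<comment> \<open>Only the last term was lowered, so a solution for \<open>t'\<close> has the
    right moments below it and satisfies the weaker inequality for \<open>t\<close>.\<close>
  have "inv_transform \<alpha> (t' 0) F \<in> S_moment_class \<alpha> (Suc n) t"
    using G t'(3) add[OF t'(4)] by (simp add: S_moment_class_def Let_def)
  then show ?case by blast
qed

theorem theorem10p4:
  fixes \<alpha> :: real and m :: nat and s :: "nat \<Rightarrow> complex^'q^'q"
  assumes "m \<ge> 1"
    and "s \<in> K_class m \<alpha> \<inter> D_class m"
  shows "(S_transform \<alpha> s \<in> K_class (m - 1) \<alpha> \<and>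
          S_moment_class \<alpha> (m - 1) (S_transform \<alpha> s) \<noteq> {}) \<and>
         (\<forall>F. F \<in> S_moment_class \<alpha> (m - 1) (S_transform \<alpha> s) \<longrightarrow>
              inv_transform \<alpha> (s 0) F \<in> S_moment_class \<alpha> m s)"
proof -
  have s: "s \<in> K_class m \<alpha>" "s \<in> D_class m" using assms(2) by auto
  have "S_transform \<alpha> s \<in> K_class (m - 1) \<alpha>"
    by (rule dominated_seq.S_transform_K_class[OF dominated_seq_K_class[OF s] assms(1) s(1)])
  then show ?thesis
    using S_moment_class_nonempty inv_transform_S_moment_class[OF assms(1) s] by blast
qed

end
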